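(* Let $(M,J,g,\tilde g)$ be a $2n$-dimensional almost skew-Hermitian manifold, and let $(TM,H,\hat G)$, $H=(J_1,J_2,J_3)$, be its tangent bundle with the almost hypercomplex pseudo-Hermitian structure derived from the Sasaki metric $\hat g$ as in the context. Then: 1. $(TM,J_1,\hat g)$ is Kähler if and only if $M$ is flat. 2. For each $\beta\in\{2,3\}$, $(TM,J_\beta,\hat g)$ is skew-Kähler if and only if $(M,J,g,\tilde g)$ is flat and skew-Kähler. 3. $(TM,H,\hat G)$ is a pseudo-hyper-Kähler manifold if and only if $(M,J,g,\tilde g)$ is flat and skew-Kähler.
   Context: An almost skew-Hermitian manifold $(M^{2n},J,g,\tilde g)$ is a smooth $2n$-manifold with an almost complex structure $J$ and a pseudo-Riemannian metric $g$ of signature $(n,n)$ with $g(JX,JY)=-g(X,Y)$; $\tilde g=g(\cdot,J\cdot)$. $\nabla$ is the Levi-Civita connection of $g$ and $R(X,Y)=[\nabla_X,\nabla_Y]-\nabla_{[X,Y]}$; flat means $R=0$. $(M,J,g,\tilde g)$ is skew-Kähler if $\nabla J=0$. Lifts: local coordinates $(x^i)$ on $M$ induce coordinates $(x^i,y^i)$ on $TM$, where $(y^i)$ are the components of a tangent vector with respect to $\partial/\partial x^i$. For a vector field $X=X^k\,\partial/\partial x^k$ on $M$, $X^V=X^k\,\partial/\partial y^k$ and $X^H=X^k\,\partial/\partial x^k-y^i\Gamma_{ij}^kX^j\,\partial/\partial y^k$, where $\Gamma_{ij}^k$ are the components of $\nabla$. On $TM$: $J_1X^H=X^V$, $J_1X^V=-X^H$;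 $J_2X^H=(JX)^V$, $J_2X^V=(JX)^H$; $J_3=J_1\circ J_2$. Sasaki metric: $\hat g(X^H,Y^H)=\hat g(X^V,Y^V)=g(X,Y)$, $\hat g(X^H,Y^V)=0$, with Levi-Civita connection $\hat\nabla$. It satisfies $\hat g=\hat g(J_1\cdot,J_1\cdot)=-\hat g(J_2\cdot,J_2\cdot)=-\hat g(J_3\cdot,J_3\cdot)$. $\hat G=(\hat g,\hat\Phi,\hat g_2,\hat g_3)$ with $\hat\Phi=\hat g(J_1\cdot,\cdot)$, $\hat g_2=\hat g(J_2\cdot,\cdot)$, $\hat g_3=\hat g(J_3\cdot,\cdot)$. Put $F_\alpha(A,B,C)=\hat g((\hat\nabla_AJ_\alpha)B,C)$. $(TM,J_1,\hat g)$ is Kähler if $F_1=0$; $(TM,J_\beta,\hat g)$, $\beta=2,3$, is skew-Kähler if $F_\beta=0$; $(TM,H,\hat G)$ is pseudo-hyper-Kähler if $F_1=F_2=F_3=0$. *)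

theory Defs
  imports "HOL-Analysis.Analysis"
begin

section \<open>Smooth maps between open subsets of Euclidean spaces\<close>

text \<open>\<open>Ck_on k S f\<close> is meant for open \<open>S\<close>: all iterated directional derivatives of \<open>f\<close> up to
  order \<open>k\<close> exist as Frechet derivatives and are continuous on \<open>S\<close>.\<close>

primrec Ck_on :: "nat \<Rightarrow> 'e::euclidean_space set \<Rightarrow> ('e \<Rightarrow> 'f::real_normed_vector) \<Rightarrow> bool" where
  "Ck_on 0 S f \<longleftrightarrow> continuous_on S f"
| "Ck_on (Suc k) S f \<longleftrightarrow>
     (\<forall>x\<in>S. f differentiable (at x)) \<and> (\<forall>v. Ck_on k S (\<lambda>x. frechet_derivative f (at x) v))"

definition smooth_on :: "'e::euclidean_space set \<Rightarrow> ('e \<Rightarrow> 'f::real_normed_vector) \<Rightarrow> bool" where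
  "smooth_on S f \<longleftrightarrow> (\<forall>k. Ck_on k S f)"


section \<open>Smooth manifolds\<close>

text \<open>A chart is a pair of a domain and a coordinate map with values in a Euclidean space; a
  manifold is given by its atlas. The values of the coordinate map off the domain play no role.\<close>

type_synonym ('a, 'e) chart = "'a set \<times> ('a \<Rightarrow> 'e)"

definition param :: "('a, 'e) chart \<Rightarrow> 'e \<Rightarrow> 'a" where
  "param c = inv_into (fst c) (snd c)"

definition transition :: "('a, 'e) chart \<Rightarrow> ('a, 'e) chart \<Rightarrow> 'e \<Rightarrow> 'e" where
  "transition c c' = snd c' \<circ> param c"

definition carrier :: "('a, 'e) chart set \<Rightarrow> 'a set" where
  "carrier A = (\<Union>c\<in>A. fst c)"

definition mtop :: "('a, 'e::euclidean_space) chart set \<Rightarrow> 'a topology" where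
  "mtop A = topology_generated_by {fst c \<inter> snd c -` W | c W. c \<in> A \<and> open W}"

definition smooth_manifold :: "('a, 'e::euclidean_space) chart set \<Rightarrow> bool" where
  "smooth_manifold A \<longleftrightarrow>
     (\<forall>c\<in>A. inj_on (snd c) (fst c) \<and> open (snd c ` fst c)) \<and>
     (\<forall>c\<in>A. \<forall>c'\<in>A. open (snd c ` (fst c \<inter> fst c')) \<and>
        smooth_on (snd c ` (fst c \<inter> fst c')) (transition c c')) \<and>
     Hausdorff_space (mtop A) \<and> second_countable (mtop A)"


section \<open>Tangent vectors\<close>

text \<open>A tangent vector at \<open>p\<close> is the family of its component vectors with respect to all charts
  around \<open>p\<close>, related by the differentials of the coordinate changes. It is \<open>0\<close> by convention at
  the irrelevant arguments, so that tangent vectors with equal components are equal.\<close>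

type_synonym ('a, 'e) tvec = "('a, 'e) chart \<Rightarrow> 'e"

definition tspace :: "('a, 'e::euclidean_space) chart set \<Rightarrow> 'a \<Rightarrow> ('a, 'e) tvec set" where
  "tspace A p = {v.
     (\<forall>c\<in>A. \<forall>c'\<in>A. p \<in> fst c \<and> p \<in> fst c' \<longrightarrow>
        v c' = frechet_derivative (transition c c') (at (snd c p)) (v c)) \<and>
     (\<forall>c. \<not> (c \<in> A \<and> p \<in> fst c) \<longrightarrow> v c = 0)}"

definition vadd :: "('a, 'e::euclidean_space) tvec \<Rightarrow> ('a, 'e) tvec \<Rightarrow> ('a, 'e) tvec" where
  "vadd v w = (\<lambda>c. v c + w c)"

definition vsub :: "('a, 'e::euclidean_space) tvec \<Rightarrow> ('a, 'e) tvec \<Rightarrow> ('a, 'e) tvec" where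
  "vsub v w = (\<lambda>c. v c - w c)"

definition vscale :: "real \<Rightarrow> ('a, 'e::euclidean_space) tvec \<Rightarrow> ('a, 'e) tvec" where
  "vscale r v = (\<lambda>c. r *\<^sub>R v c)"

definition vzero :: "('a, 'e::euclidean_space) tvec" where
  "vzero = (\<lambda>c. 0)"

text \<open>The coordinate vector field of the chart \<open>c\<close> with constant component vector \<open>a\<close>; for
  \<open>a\<close> the \<open>i\<close>-th basis vector this is the partial derivative field of the \<open>i\<close>-th coordinate.\<close>

definition coord_field ::
  "('a, 'e::euclidean_space) chart set \<Rightarrow> ('a, 'e) chart \<Rightarrow> 'e \<Rightarrow> 'a \<Rightarrow> ('a, 'e) tvec" where
  "coord_field A c a p = (\<lambda>c'. if c' \<in> A \<and> p \<in> fst c \<and> p \<in> fst c'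
     then frechet_derivative (transition c c') (at (snd c p)) a else 0)"


section \<open>Smooth functions and vector fields on open sets\<close>

text \<open>Functions and vector fields on an open set \<open>U\<close> are total HOL functions whose values off
  \<open>U\<close> are irrelevant.\<close>

definition smooth_fun :: "('a, 'e::euclidean_space) chart set \<Rightarrow> 'a set \<Rightarrow> ('a \<Rightarrow> real) \<Rightarrow> bool" where
  "smooth_fun A U f \<longleftrightarrow> (\<forall>c\<in>A. smooth_on (snd c ` (U \<inter> fst c)) (\<lambda>x. f (param c x)))"

definition vfields ::
  "('a, 'e::euclidean_space) chart set \<Rightarrow> 'a set \<Rightarrow> ('a \<Rightarrow> ('a, 'e) tvec) set" where
  "vfields A U = {X. (\<forall>p\<in>U. X p \<in> tspace A p) \<and>
     (\<forall>c\<in>A. smooth_on (snd c ` (U \<inter> fst c)) (\<lambda>x. X (param c x) c))}"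

text \<open>The derivative of a function in the direction of a tangent vector, computed in an arbitrarily
  chosen chart around the point; by the chain rule the choice is immaterial.\<close>

definition chart_at :: "('a, 'e) chart set \<Rightarrow> 'a \<Rightarrow> ('a, 'e) chart" where
  "chart_at A p = (SOME c. c \<in> A \<and> p \<in> fst c)"

definition vderiv ::
  "('a, 'e::euclidean_space) chart set \<Rightarrow> 'a \<Rightarrow> ('a, 'e) tvec \<Rightarrow> ('a \<Rightarrow> real) \<Rightarrow> real" where
  "vderiv A p v f = (let c = chart_at A p in
     frechet_derivative (\<lambda>x. f (param c x)) (at (snd c p)) (v c))"

definition lie_bracket ::
  "('a, 'e::euclidean_space) chart set \<Rightarrow> ('a \<Rightarrow> ('a, 'e) tvec) \<Rightarrow> ('a \<Rightarrow> ('a, 'e) tvec)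
   \<Rightarrow> 'a \<Rightarrow> ('a, 'e) tvec" where
  "lie_bracket A X Y p = (\<lambda>c. if c \<in> A \<and> p \<in> fst c
     then frechet_derivative (\<lambda>x. Y (param c x) c) (at (snd c p)) (X p c)
        - frechet_derivative (\<lambda>x. X (param c x) c) (at (snd c p)) (Y p c)
     else 0)"


section \<open>Pseudo-Riemannian metrics and connections\<close>

type_synonym ('a, 'e) bilin = "'a \<Rightarrow> ('a, 'e) tvec \<Rightarrow> ('a, 'e) tvec \<Rightarrow> real"
type_synonym ('a, 'e) endo = "'a \<Rightarrow> ('a, 'e) tvec \<Rightarrow> ('a, 'e) tvec"
type_synonym ('a, 'e) conn =
  "('a \<Rightarrow> ('a, 'e) tvec) \<Rightarrow> ('a \<Rightarrow> ('a, 'e) tvec) \<Rightarrow> 'a \<Rightarrow> ('a, 'e) tvec"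

definition pseudo_riemannian :: "('a, 'e::euclidean_space) chart set \<Rightarrow> ('a, 'e) bilin \<Rightarrow> bool" where
  "pseudo_riemannian A g \<longleftrightarrow>
     (\<forall>p\<in>carrier A. \<forall>u\<in>tspace A p. \<forall>v\<in>tspace A p. g p u v = g p v u \<and>
        (\<forall>w\<in>tspace A p. \<forall>r. g p (vadd (vscale r u) v) w = r * g p u w + g p v w)) \<and>
     (\<forall>p\<in>carrier A. \<forall>u\<in>tspace A p. (\<forall>v\<in>tspace A p. g p u v = 0) \<longrightarrow> u = vzero) \<and>
     (\<forall>U X Y. openin (mtop A) U \<and> X \<in> vfields A U \<and> Y \<in> vfields A U \<longrightarrow>
        smooth_fun A U (\<lambda>p. g p (X p) (Y p)))"

text \<open>When the dimension is \<open>r + s\<close>, the orthonormal family below is automatically a basis.\<close>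

definition has_signature ::
  "('a, 'e::euclidean_space) chart set \<Rightarrow> ('a, 'e) bilin \<Rightarrow> nat \<Rightarrow> nat \<Rightarrow> bool" where
  "has_signature A g r s \<longleftrightarrow> DIM('e) = r + s \<and>
     (\<forall>p\<in>carrier A. \<exists>e :: nat \<Rightarrow> ('a, 'e) tvec. (\<forall>i<r+s. e i \<in> tspace A p) \<and>
        (\<forall>i<r+s. \<forall>j<r+s. g p (e i) (e j) = (if i = j then (if i < r then 1 else -1) else 0)))"

text \<open>A connection is an operator on the vector fields over each open subset. As the functions
  and fields only need to be smooth on \<open>U\<close>, the axioms entail that the value at a point depends
  only on the germs of the two fields there.\<close>

definition affine_connection :: "('a, 'e::euclidean_space) chart set \<Rightarrow> ('a, 'e) conn \<Rightarrow> bool" where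
  "affine_connection A D \<longleftrightarrow>
     (\<forall>U X Y Z f. openin (mtop A) U \<and> X \<in> vfields A U \<and> Y \<in> vfields A U \<and> Z \<in> vfields A U \<and>
        smooth_fun A U f \<longrightarrow>
        D X Y \<in> vfields A U \<and>
        (\<forall>p\<in>U.
          D (\<lambda>q. vadd (X q) (Z q)) Y p = vadd (D X Y p) (D Z Y p) \<and>
          D (\<lambda>q. vscale (f q) (X q)) Y p = vscale (f p) (D X Y p) \<and>
          D X (\<lambda>q. vadd (Y q) (Z q)) p = vadd (D X Y p) (D X Z p) \<and>
          D X (\<lambda>q. vscale (f q) (Y q)) p
            = vadd (vscale (vderiv A p (X p) f) (Y p)) (vscale (f p) (D X Y p))))"

definition levi_civita ::
  "('a, 'e::euclidean_space) chart set \<Rightarrow> ('a, 'e) bilin \<Rightarrow> ('a, 'e) conn \<Rightarrow> bool" where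
  "levi_civita A g D \<longleftrightarrow> affine_connection A D \<and>
     (\<forall>U X Y Z. openin (mtop A) U \<and> X \<in> vfields A U \<and> Y \<in> vfields A U \<and> Z \<in> vfields A U \<longrightarrow>
        (\<forall>p\<in>U.
          vsub (D X Y p) (D Y X p) = lie_bracket A X Y p \<and>
          vderiv A p (X p) (\<lambda>q. g q (Y q) (Z q)) = g p (D X Y p) (Z p) + g p (Y p) (D X Z p)))"

definition curvature ::
  "('a, 'e::euclidean_space) chart set \<Rightarrow> ('a, 'e) conn \<Rightarrow> ('a \<Rightarrow> ('a, 'e) tvec)
   \<Rightarrow> ('a \<Rightarrow> ('a, 'e) tvec) \<Rightarrow> ('a \<Rightarrow> ('a, 'e) tvec) \<Rightarrow> 'a \<Rightarrow> ('a, 'e) tvec" where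
  "curvature A D X Y Z p =
     vsub (vsub (D X (D Y Z) p) (D Y (D X Z) p)) (D (lie_bracket A X Y) Z p)"

definition flat :: "('a, 'e::euclidean_space) chart set \<Rightarrow> ('a, 'e) conn \<Rightarrow> bool" where
  "flat A D \<longleftrightarrow>
     (\<forall>U X Y Z. openin (mtop A) U \<and> X \<in> vfields A U \<and> Y \<in> vfields A U \<and> Z \<in> vfields A U \<longrightarrow>
        (\<forall>p\<in>U. curvature A D X Y Z p = vzero))"

definition cov_deriv_endo ::
  "('a, 'e::euclidean_space) conn \<Rightarrow> ('a, 'e) endo \<Rightarrow> ('a \<Rightarrow> ('a, 'e) tvec)
   \<Rightarrow> ('a \<Rightarrow> ('a, 'e) tvec) \<Rightarrow> 'a \<Rightarrow> ('a, 'e) tvec" where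
  "cov_deriv_endo D J X Y p = vsub (D X (\<lambda>q. J q (Y q)) p) (J p (D X Y p))"


section \<open>Almost skew-Hermitian and skew-Kaehler manifolds\<close>

definition almost_complex :: "('a, 'e::euclidean_space) chart set \<Rightarrow> ('a, 'e) endo \<Rightarrow> bool" where
  "almost_complex A J \<longleftrightarrow>
     (\<forall>p\<in>carrier A. \<forall>u\<in>tspace A p. J p u \<in> tspace A p \<and> J p (J p u) = vscale (-1) u \<and>
        (\<forall>v\<in>tspace A p. \<forall>r. J p (vadd (vscale r u) v) = vadd (vscale r (J p u)) (J p v))) \<and>
     (\<forall>U X. openin (mtop A) U \<and> X \<in> vfields A U \<longrightarrow> (\<lambda>p. J p (X p)) \<in> vfields A U)"

definition almost_skew_hermitian ::
  "nat \<Rightarrow> ('a, 'e::euclidean_space) chart set \<Rightarrow> ('a, 'e) endo \<Rightarrow> ('a, 'e) bilin \<Rightarrow> ('a, 'e) bilin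
   \<Rightarrow> bool" where
  "almost_skew_hermitian n A J g gt \<longleftrightarrow>
     smooth_manifold A \<and> DIM('e) = 2 * n \<and>
     almost_complex A J \<and> pseudo_riemannian A g \<and> has_signature A g n n \<and>
     (\<forall>p\<in>carrier A. \<forall>u\<in>tspace A p. \<forall>v\<in>tspace A p.
        g p (J p u) (J p v) = - g p u v \<and> gt p u v = g p u (J p v))"

text \<open>\<open>D\<close> is meant to be the Levi-Civita connection.\<close>

definition skew_kaehler_base ::
  "('a, 'e::euclidean_space) chart set \<Rightarrow> ('a, 'e) endo \<Rightarrow> ('a, 'e) conn \<Rightarrow> bool" where
  "skew_kaehler_base A J D \<longleftrightarrow>
     (\<forall>U X Y. openin (mtop A) U \<and> X \<in> vfields A U \<and> Y \<in> vfields A U \<longrightarrow>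
        (\<forall>p\<in>U. cov_deriv_endo D J X Y p = vzero))"


section \<open>The tangent bundle and lifts\<close>

definition induced_chart ::
  "('a, 'e::euclidean_space) chart set \<Rightarrow> ('a, 'e) chart \<Rightarrow> ('a \<times> ('a, 'e) tvec, 'e \<times> 'e) chart" where
  "induced_chart A c =
     ({(p, y). p \<in> fst c \<and> y \<in> tspace A p}, \<lambda>(p, y). (snd c p, y c))"

definition tangent_bundle ::
  "('a, 'e::euclidean_space) chart set \<Rightarrow> ('a \<times> ('a, 'e) tvec, 'e \<times> 'e) chart set" where
  "tangent_bundle A = induced_chart A ` A"

text \<open>Connection components in the chart \<open>c\<close>: \<open>christoffel A D c p a b\<close> is the component vector
  with entries \<open>\<Gamma>\<^sub>i\<^sub>j\<^sup>k a\<^sup>i b\<^sup>j\<close>.\<close>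

definition christoffel ::
  "('a, 'e::euclidean_space) chart set \<Rightarrow> ('a, 'e) conn \<Rightarrow> ('a, 'e) chart \<Rightarrow> 'a \<Rightarrow> 'e \<Rightarrow> 'e \<Rightarrow> 'e" where
  "christoffel A D c p a b = D (coord_field A c a) (coord_field A c b) p c"

text \<open>The lifts of a vector field \<open>X\<close> to the tangent bundle at \<open>(p, y)\<close> depend only on the value
  of \<open>X\<close> at \<open>p\<close>, so they are given as maps of tangent vectors. They are prescribed by their
  components in every induced chart.\<close>

definition vlift ::
  "('a, 'e::euclidean_space) chart set \<Rightarrow> 'a \<times> ('a, 'e) tvec \<Rightarrow> ('a, 'e) tvec
   \<Rightarrow> ('a \<times> ('a, 'e) tvec, 'e \<times> 'e) tvec" where
  "vlift A q w = (THE \<xi>. \<xi> \<in> tspace (tangent_bundle A) q \<and>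
     (\<forall>c\<in>A. fst q \<in> fst c \<longrightarrow> \<xi> (induced_chart A c) = (0, w c)))"

definition hlift ::
  "('a, 'e::euclidean_space) chart set \<Rightarrow> ('a, 'e) conn \<Rightarrow> 'a \<times> ('a, 'e) tvec \<Rightarrow> ('a, 'e) tvec
   \<Rightarrow> ('a \<times> ('a, 'e) tvec, 'e \<times> 'e) tvec" where
  "hlift A D q w = (THE \<xi>. \<xi> \<in> tspace (tangent_bundle A) q \<and>
     (\<forall>c\<in>A. fst q \<in> fst c \<longrightarrow>
        \<xi> (induced_chart A c) = (w c, - christoffel A D c (fst q) (snd q c) (w c))))"

text \<open>Every tangent vector of the tangent bundle is uniquely the sum of a horizontal and a vertical
  lift; \<open>lift_parts\<close> is the pair of lifted vectors. Tensors on the tangent bundle prescribed on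
  lifts are extended linearly through it.\<close>

definition lift_parts ::
  "('a, 'e::euclidean_space) chart set \<Rightarrow> ('a, 'e) conn \<Rightarrow> 'a \<times> ('a, 'e) tvec
   \<Rightarrow> ('a \<times> ('a, 'e) tvec, 'e \<times> 'e) tvec \<Rightarrow> ('a, 'e) tvec \<times> ('a, 'e) tvec" where
  "lift_parts A D q \<xi> = (THE P. fst P \<in> tspace A (fst q) \<and> snd P \<in> tspace A (fst q) \<and>
     \<xi> = vadd (hlift A D q (fst P)) (vlift A q (snd P)))"

definition J1_lift ::
  "('a, 'e::euclidean_space) chart set \<Rightarrow> ('a, 'e) conn \<Rightarrow> ('a \<times> ('a, 'e) tvec, 'e \<times> 'e) endo" where
  "J1_lift A D q \<xi> = (case lift_parts A D q \<xi> of (x, y) \<Rightarrow>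
     vsub (vlift A q x) (hlift A D q y))"

definition J2_lift ::
  "('a, 'e::euclidean_space) chart set \<Rightarrow> ('a, 'e) conn \<Rightarrow> ('a, 'e) endo
   \<Rightarrow> ('a \<times> ('a, 'e) tvec, 'e \<times> 'e) endo" where
  "J2_lift A D J q \<xi> = (case lift_parts A D q \<xi> of (x, y) \<Rightarrow>
     vadd (vlift A q (J (fst q) x)) (hlift A D q (J (fst q) y)))"

definition J3_lift ::
  "('a, 'e::euclidean_space) chart set \<Rightarrow> ('a, 'e) conn \<Rightarrow> ('a, 'e) endo
   \<Rightarrow> ('a \<times> ('a, 'e) tvec, 'e \<times> 'e) endo" where
  "J3_lift A D J q = J1_lift A D q \<circ> J2_lift A D J q"

definition sasaki ::
  "('a, 'e::euclidean_space) chart set \<Rightarrow> ('a, 'e) conn \<Rightarrow> ('a, 'e) bilin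
   \<Rightarrow> ('a \<times> ('a, 'e) tvec, 'e \<times> 'e) bilin" where
  "sasaki A D g q \<xi> \<eta> = (case (lift_parts A D q \<xi>, lift_parts A D q \<eta>) of
     ((x, y), (x', y')) \<Rightarrow> g (fst q) x x' + g (fst q) y y')"


section \<open>Kaehler-type classes\<close>

text \<open>\<open>F_tensor h D J\<close> is the tensor \<open>F(B, C, E) = h((D\<^sub>B J) C, E)\<close>; again \<open>D\<close> is meant to be the
  Levi-Civita connection of \<open>h\<close>.\<close>

definition F_tensor ::
  "('a, 'e::euclidean_space) bilin \<Rightarrow> ('a, 'e) conn \<Rightarrow> ('a, 'e) endo \<Rightarrow> ('a \<Rightarrow> ('a, 'e) tvec)
   \<Rightarrow> ('a \<Rightarrow> ('a, 'e) tvec) \<Rightarrow> ('a \<Rightarrow> ('a, 'e) tvec) \<Rightarrow> 'a \<Rightarrow> real" where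
  "F_tensor h D J B C E p = h p (cov_deriv_endo D J B C p) (E p)"

definition F_vanishes ::
  "('a, 'e::euclidean_space) chart set \<Rightarrow> ('a, 'e) bilin \<Rightarrow> ('a, 'e) conn \<Rightarrow> ('a, 'e) endo \<Rightarrow> bool" where
  "F_vanishes A h D J \<longleftrightarrow>
     (\<forall>U B C E. openin (mtop A) U \<and> B \<in> vfields A U \<and> C \<in> vfields A U \<and> E \<in> vfields A U \<longrightarrow>
        (\<forall>p\<in>U. F_tensor h D J B C E p = 0))"

text \<open>Compatibility of the metric with \<open>J\<close> (Hermitian for \<open>J\<^sub>1\<close>, skew-Hermitian for
  \<open>J\<^sub>2, J\<^sub>3\<close>) holds for the structures on the tangent bundle by construction, so the
  following two classes are given by the same equation.\<close>

definition kaehler ::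
  "('a, 'e::euclidean_space) chart set \<Rightarrow> ('a, 'e) endo \<Rightarrow> ('a, 'e) bilin \<Rightarrow> ('a, 'e) conn \<Rightarrow> bool" where
  "kaehler A J1 h D \<longleftrightarrow> F_vanishes A h D J1"

definition skew_kaehler ::
  "('a, 'e::euclidean_space) chart set \<Rightarrow> ('a, 'e) endo \<Rightarrow> ('a, 'e) bilin \<Rightarrow> ('a, 'e) conn \<Rightarrow> bool" where
  "skew_kaehler A J h D \<longleftrightarrow> F_vanishes A h D J"

definition derived_metrics ::
  "('a, 'e::euclidean_space) bilin \<Rightarrow> ('a, 'e) endo \<times> ('a, 'e) endo \<times> ('a, 'e) endo
   \<Rightarrow> ('a, 'e) bilin \<times> ('a, 'e) bilin \<times> ('a, 'e) bilin \<times> ('a, 'e) bilin" where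
  "derived_metrics h H = (case H of (J1, J2, J3) \<Rightarrow>
     (h, \<lambda>p u v. h p (J1 p u) v, \<lambda>p u v. h p (J2 p u) v, \<lambda>p u v. h p (J3 p u) v))"

text \<open>The last three components of \<open>G\<close> are part of the structure but do not enter the condition.\<close>

definition pseudo_hyper_kaehler ::
  "('a, 'e::euclidean_space) chart set \<Rightarrow> ('a, 'e) endo \<times> ('a, 'e) endo \<times> ('a, 'e) endo
   \<Rightarrow> ('a, 'e) bilin \<times> ('a, 'e) bilin \<times> ('a, 'e) bilin \<times> ('a, 'e) bilin \<Rightarrow> ('a, 'e) conn \<Rightarrow> bool"
  where
  "pseudo_hyper_kaehler A H G D \<longleftrightarrow> (case (H, G) of ((J1, J2, J3), (h, _)) \<Rightarrow>
     F_vanishes A h D J1 \<and> F_vanishes A h D J2 \<and> F_vanishes A h D J3)"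

end

theory Submission
  imports Defs
begin

text \<open>
  Fix a chart of \<open>M\<close> and let \<open>y\<close> be the fibre coordinate of a point of the tangent bundle. The
  bundle has the frame consisting of the horizontal and vertical lifts of the coordinate fields; write
  \<open>(a, a')\<close> for the field \<open>a\<^sup>H + a'\<^sup>V\<close> with constant \<open>a\<close> and \<open>a'\<close>. In this frame the Sasaki metric is
  \<open>g \<oplus> g\<close> (\<open>sasaki_frame\<close>), and the brackets of frame fields involve the Christoffel symbols \<open>\<Gamma>\<close> and the
  curvature \<open>R\<close> only (\<open>lie_bracket_frame\<close>). The Koszul argument therefore determines the Levi-Civita connection of
  the Sasaki metric: its coefficient \<open>N((a, a'), (b, b'))\<close> has the vertical part
  \<open>\<Gamma>(a, b') - R(a, b)y / 2\<close>, and its horizontal part differs from \<open>\<Gamma>(a, b)\<close> by the vector whose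
  product with \<open>w\<close> is \<open>(g(R(b, w)y, a') - g(R(w, a)y, b')) / 2\<close> (\<open>N_snd\<close>, \<open>N_fst\<close>).

  Each of \<open>J\<^sub>1, J\<^sub>2, J\<^sub>3\<close> acts on frame coefficients by a linear map \<open>K\<close> that depends on the base point only:
  \<open>(a, a')\<close> goes to \<open>(- a', a)\<close>, \<open>(J a', J a)\<close>, \<open>(- J a, J a')\<close>. As the covariant derivative of an
  endomorphism field is tensorial and the Sasaki metric is nondegenerate, the tensor \<open>F\<close> vanishes iff
  \<open>(\<partial>\<^sub>aK) v + N(u, K v) - K (N(u, v)) = 0\<close> for all \<open>u = (a, a')\<close> and \<open>v\<close> (\<open>F_vanishes_iff\<close>).

  If \<open>R = 0\<close> then \<open>N = (\<Gamma>(a, b), \<Gamma>(a, b'))\<close>, so the equation holds for \<open>J\<^sub>1\<close>, and for \<open>J\<^sub>2\<close> and \<open>J\<^sub>3\<close> it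
  says \<open>\<nabla>J = 0\<close>. Conversely, for \<open>J\<^sub>1\<close> and \<open>J\<^sub>2\<close> two vertical arguments \<open>u\<close> and \<open>v\<close> leave only the curvature
  term in the horizontal part of the equation, and so \<open>R = 0\<close>. For \<open>J\<^sub>3\<close> two horizontal arguments give \<open>\<nabla>J = 0\<close> and
  \<open>R(a, - J b) y = J R(a, b) y\<close>. A parallel \<open>J\<close> commutes with the curvature, and then the first Bianchi
  identity for \<open>a, b, - J z\<close> becomes \<open>- 2 J R(a, b) z = 0\<close>.

  The tangent bundle and its lifts are described by components in charts, so the same local theory of
  connections is developed for an arbitrary compatible atlas and applied to \<open>M\<close> and to its tangent bundle. Its main
  results are the formula \<open>\<nabla>\<^sub>XY = dY(X) + \<Gamma>(X, Y)\<close> (\<open>D_local\<close>) and its consequences for the derivative of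
  an endomorphism field and for the curvature (\<open>cov_deriv_local\<close>, \<open>curvature_local\<close>).
\<close>

section \<open>Calculus of smooth maps\<close>

lemma Ck_on_subset: "Ck_on k S f \<Longrightarrow> T \<subseteq> S \<Longrightarrow> Ck_on k T f"
  by (induction k arbitrary: f) (auto intro: continuous_on_subset)

lemma Ck_on_has_derivative:
  "Ck_on (Suc k) S f \<Longrightarrow> x \<in> S \<Longrightarrow> (f has_derivative frechet_derivative f (at x)) (at x)"
  unfolding Ck_on.simps by (metis frechet_derivative_works)

lemma Ck_on_cong:
  assumes "open S"
  shows "Ck_on k S f \<Longrightarrow> (\<And>x. x \<in> S \<Longrightarrow> f x = g x) \<Longrightarrow> Ck_on k S g"
proof (induction k arbitrary: f g)
  case 0
  then show ?case by (metis Ck_on.simps(1) continuous_on_eq)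
next
  case (Suc k)
  have d: "(g has_derivative frechet_derivative f (at x)) (at x)" if x: "x \<in> S" for x
    by (rule has_derivative_transform_within_open[OF Ck_on_has_derivative[OF Suc.prems(1) x] assms x Suc.prems(2)])
  have "Ck_on k S (\<lambda>x. frechet_derivative g (at x) v)" for v
  proof (rule Suc.IH)
    show "Ck_on k S (\<lambda>x. frechet_derivative f (at x) v)" using Suc.prems(1) by simp
    show "frechet_derivative f (at x) v = frechet_derivative g (at x) v" if "x \<in> S" for x
      using frechet_derivative_at[OF d[OF that]] by simp
  qed
  then show ?case using d differentiableI by (metis Ck_on.simps(2))
qed

lemma Ck_on_SucD: "Ck_on (Suc k) S f \<Longrightarrow> Ck_on k S f"
proof (induction k arbitrary: f)
  case 0
  then show ?case
    by (auto intro!: continuous_at_imp_continuous_on differentiable_imp_continuous_within)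
next
  case (Suc k)
  then show ?case unfolding Ck_on.simps(2)[of "Suc k"] Ck_on.simps(2)[of k] by blast
qed

lemma Ck_on_SucI:
  assumes "open S" "\<And>x. x \<in> S \<Longrightarrow> (f has_derivative f' x) (at x)"
    and "\<And>v. Ck_on k S (\<lambda>x. f' x v)"
  shows "Ck_on (Suc k) S f"
proof -
  have "frechet_derivative f (at x) = f' x" if "x \<in> S" for x
    using frechet_derivative_at[OF assms(2)[OF that]] by simp
  then have "Ck_on k S (\<lambda>x. frechet_derivative f (at x) v)" for v
    by (intro Ck_on_cong[OF assms(1) assms(3)]) simp
  then show ?thesis using assms(2) differentiableI by (metis Ck_on.simps(2))
qed

lemma Ck_on_const: "Ck_on k S (\<lambda>x. c)"
  by (induction k arbitrary: c) auto

lemma Ck_on_add: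
  assumes "open S"
  shows "Ck_on k S f \<Longrightarrow> Ck_on k S g \<Longrightarrow> Ck_on k S (\<lambda>x. f x + g x)"
proof (induction k arbitrary: f g)
  case 0 then show ?case by (simp add: continuous_on_add)
next
  case (Suc k)
  show ?case
    by (rule Ck_on_SucI[OF assms has_derivative_add[OF Ck_on_has_derivative Ck_on_has_derivative]])
      (use Suc in auto)
qed

lemma Ck_on_bilinear:
  assumes "open S" "bounded_bilinear B"
  shows "Ck_on k S f \<Longrightarrow> Ck_on k S g \<Longrightarrow> Ck_on k S (\<lambda>x. B (f x) (g x))"
proof (induction k arbitrary: f g)
  case 0 then show ?case by (auto intro: bounded_bilinear.continuous_on[OF assms(2)])
next
  case (Suc k)
  have k: "Ck_on k S f" "Ck_on k S g" using Suc.prems by (auto intro: Ck_on_SucD simp del: Ck_on.simps)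
  show ?case
    by (rule Ck_on_SucI[OF assms(1) bounded_bilinear.FDERIV[OF assms(2)
            Ck_on_has_derivative[OF Suc.prems(1)] Ck_on_has_derivative[OF Suc.prems(2)]]])
      (use Suc.prems k in \<open>auto intro!: Ck_on_add[OF assms(1)] Suc.IH\<close>)
qed

lemma Ck_on_bounded_linear:
  assumes "open S" "bounded_linear L"
  shows "Ck_on k S f \<Longrightarrow> Ck_on k S (\<lambda>x. L (f x))"
proof (induction k arbitrary: f)
  case 0 then show ?case
    using bounded_linear.continuous_on[OF assms(2)] by auto
next
  case (Suc k)
  show ?case
    by (rule Ck_on_SucI[OF assms(1) bounded_linear.has_derivative[OF assms(2)
            Ck_on_has_derivative]])
      (use Suc in auto)
qed

lemma Ck_on_ident:
  assumes "open S" shows "Ck_on k S (\<lambda>x. x)"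
proof (cases k)
  case 0 then show ?thesis by (simp add: continuous_on_id)
next
  case (Suc j)
  then show ?thesis by (auto intro: Ck_on_SucI[OF assms has_derivative_ident] Ck_on_const simp del: Ck_on.simps)
qed

lemma Ck_on_sum:
  assumes "open S" "\<And>i. i \<in> I \<Longrightarrow> Ck_on k S (f i)"
  shows "Ck_on k S (\<lambda>x. \<Sum>i\<in>I. f i x)"
  using assms(2)
  by (induction I rule: infinite_finite_induct) (auto intro: Ck_on_const Ck_on_add[OF assms(1)])

lemma linear_eq_sum_Basis:
  fixes f :: "'e::euclidean_space \<Rightarrow> 'f::real_vector"
  assumes "linear f"
  shows "f a = (\<Sum>i\<in>Basis. (a \<bullet> i) *\<^sub>R f i)"
proof -
  have "f a = f (\<Sum>i\<in>Basis. (a \<bullet> i) *\<^sub>R i)" by (simp add: euclidean_representation)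
  then show ?thesis using assms by (simp add: linear_sum linear_cmul)
qed

text \<open>Writing the derivative of the outer map through its values on the basis turns the chain rule into a
  finite sum of products of \<open>C\<^sup>k\<close> functions of \<open>x\<close>, to which the induction hypothesis applies.\<close>

lemma Ck_on_compose:
  fixes f :: "'e::euclidean_space \<Rightarrow> 'f::real_normed_vector" and g :: "'d::euclidean_space \<Rightarrow> 'e"
  assumes "open S" "open T" "g ` S \<subseteq> T"
  shows "Ck_on k T f \<Longrightarrow> Ck_on k S g \<Longrightarrow> Ck_on k S (\<lambda>x. f (g x))"
proof (induction k arbitrary: f)
  case 0 then show ?case by (metis Ck_on.simps(1) continuous_on_compose2 assms(3))
next
  case (Suc k)
  have gT: "g x \<in> T" if "x \<in> S" for x using that assms(3) by auto
  show ?case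
  proof (rule Ck_on_SucI[OF assms(1)])
    show "((\<lambda>x. f (g x)) has_derivative
        (\<lambda>v. \<Sum>i\<in>Basis. (frechet_derivative g (at x) v \<bullet> i) *\<^sub>R frechet_derivative f (at (g x)) i)) (at x)"
      if x: "x \<in> S" for x
    proof -
      have f: "f differentiable at (g x)" using Suc.prems(1) gT[OF x] unfolding Ck_on.simps by blast
      have "(f \<circ> g has_derivative frechet_derivative f (at (g x)) \<circ> frechet_derivative g (at x)) (at x)"
        by (rule diff_chain_at[OF Ck_on_has_derivative[OF Suc.prems(2) x]
              Ck_on_has_derivative[OF Suc.prems(1) gT[OF x]]])
      moreover have "frechet_derivative f (at (g x)) \<circ> frechet_derivative g (at x) =
        (\<lambda>v. \<Sum>i\<in>Basis. (frechet_derivative g (at x) v \<bullet> i) *\<^sub>R frechet_derivative f (at (g x)) i)"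
        unfolding comp_def by (rule ext, rule linear_eq_sum_Basis[OF linear_frechet_derivative[OF f]])
      ultimately show ?thesis by (simp add: o_def)
    qed
    show "Ck_on k S (\<lambda>x. \<Sum>i\<in>Basis.
        (frechet_derivative g (at x) v \<bullet> i) *\<^sub>R frechet_derivative f (at (g x)) i)" for v
    proof (rule Ck_on_sum[OF assms(1)])
      fix i :: 'e assume "i \<in> Basis"
      show "Ck_on k S (\<lambda>x. (frechet_derivative g (at x) v \<bullet> i) *\<^sub>R frechet_derivative f (at (g x)) i)"
      proof (rule Ck_on_bilinear[OF assms(1) bounded_bilinear_scaleR])
        show "Ck_on k S (\<lambda>x. frechet_derivative g (at x) v \<bullet> i)"
          using Suc.prems(2) by (intro Ck_on_bounded_linear[OF assms(1) bounded_linear_inner_left]) auto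
        show "Ck_on k S (\<lambda>x. frechet_derivative f (at (g x)) i)"
        proof (rule Suc.IH)
          show "Ck_on k T (\<lambda>y. frechet_derivative f (at y) i)" using Suc.prems(1) by simp
          show "Ck_on k S g" by (rule Ck_on_SucD[OF Suc.prems(2)])
        qed
      qed
    qed
  qed
qed

lemma smooth_on_subset: "smooth_on S f \<Longrightarrow> T \<subseteq> S \<Longrightarrow> smooth_on T f"
  unfolding smooth_on_def by (blast intro: Ck_on_subset)

lemma smooth_on_cong:
  "open S \<Longrightarrow> smooth_on S f \<Longrightarrow> (\<And>x. x \<in> S \<Longrightarrow> f x = g x) \<Longrightarrow> smooth_on S g"
  using Ck_on_cong[of S _ f g] by (simp add: smooth_on_def)

lemma smooth_on_const: "smooth_on S (\<lambda>x. c)"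
  by (simp add: smooth_on_def Ck_on_const)

lemma smooth_on_ident: "open S \<Longrightarrow> smooth_on S (\<lambda>x. x)"
  by (simp add: smooth_on_def Ck_on_ident)

lemma smooth_on_add:
  "open S \<Longrightarrow> smooth_on S f \<Longrightarrow> smooth_on S g \<Longrightarrow> smooth_on S (\<lambda>x. f x + g x)"
  by (simp add: smooth_on_def Ck_on_add)

lemma smooth_on_sum:
  "open S \<Longrightarrow> (\<And>i. i \<in> I \<Longrightarrow> smooth_on S (f i)) \<Longrightarrow> smooth_on S (\<lambda>x. \<Sum>i\<in>I. f i x)"
  by (simp add: smooth_on_def Ck_on_sum)

lemma smooth_on_scaleR:
  "open S \<Longrightarrow> smooth_on S f \<Longrightarrow> smooth_on S g \<Longrightarrow> smooth_on S (\<lambda>x. f x *\<^sub>R g x)"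
  by (simp add: smooth_on_def Ck_on_bilinear[OF _ bounded_bilinear_scaleR])

lemma smooth_on_linear:
  fixes L :: "'b::euclidean_space \<Rightarrow> 'c::real_normed_vector"
  shows "open S \<Longrightarrow> linear L \<Longrightarrow> smooth_on S f \<Longrightarrow> smooth_on S (\<lambda>x. L (f x))"
  by (simp add: smooth_on_def Ck_on_bounded_linear linear_conv_bounded_linear)

lemma smooth_on_compose:
  "smooth_on T f \<Longrightarrow> smooth_on S g \<Longrightarrow> open S \<Longrightarrow> open T \<Longrightarrow> g ` S \<subseteq> T \<Longrightarrow> smooth_on S (\<lambda>x. f (g x))"
  by (simp add: smooth_on_def Ck_on_compose[of S T g])

lemma smooth_on_frechet_derivative:
  "smooth_on S f \<Longrightarrow> smooth_on S (\<lambda>x. frechet_derivative f (at x) v)"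
  unfolding smooth_on_def by (metis Ck_on.simps(2))

lemma smooth_on_differentiable: "smooth_on S f \<Longrightarrow> x \<in> S \<Longrightarrow> f differentiable (at x)"
  unfolding smooth_on_def by (metis Ck_on.simps(2))

lemma smooth_on_has_derivative:
  "smooth_on S f \<Longrightarrow> x \<in> S \<Longrightarrow> (f has_derivative frechet_derivative f (at x)) (at x)"
  using smooth_on_differentiable frechet_derivative_works by blast

lemma smooth_on_inner_left:
  fixes f :: "'e::euclidean_space \<Rightarrow> 'b::euclidean_space"
  assumes "open S" "smooth_on S f" shows "smooth_on S (\<lambda>x. f x \<bullet> i)"
  by (rule smooth_on_linear[OF assms(1) _ assms(2)])
    (simp add: bounded_linear.linear bounded_linear_inner_left)

lemma smooth_on_Pair:
  fixes f :: "'e::euclidean_space \<Rightarrow> 'b::euclidean_space" and g :: "'e \<Rightarrow> 'c::euclidean_space"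
  assumes "open S" "smooth_on S f" "smooth_on S g"
  shows "smooth_on S (\<lambda>x. (f x, g x))"
proof -
  have "linear (\<lambda>a::'b. (a, 0::'c))" "linear (\<lambda>b::'c. (0::'b, b))" by (auto intro!: linearI)
  from smooth_on_add[OF assms(1) smooth_on_linear[OF assms(1) this(1) assms(2)]
      smooth_on_linear[OF assms(1) this(2) assms(3)]]
  show ?thesis by simp
qed

text \<open>Tensor fields appear in charts as families of linear maps that are smooth at every constant vector.
  Expanding the argument in the basis reduces smoothness and the product rule for such families to
  those for finite sums.\<close>

lemma smooth_on_linear_family:
  fixes T :: "'x::euclidean_space \<Rightarrow> 'e::euclidean_space \<Rightarrow> 'f::real_normed_vector"
  assumes "open S" "\<And>x. x \<in> S \<Longrightarrow> linear (T x)"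
    and "\<And>a. smooth_on S (\<lambda>x. T x a)" "smooth_on S f"
  shows "smooth_on S (\<lambda>x. T x (f x))"
proof (rule smooth_on_cong[OF assms(1)])
  show "smooth_on S (\<lambda>x. \<Sum>i\<in>Basis. (f x \<bullet> i) *\<^sub>R T x i)"
    by (intro smooth_on_sum smooth_on_scaleR smooth_on_inner_left assms)
qed (rule linear_eq_sum_Basis[OF assms(2), symmetric])

lemma has_derivative_linear_family:
  fixes T :: "'x::euclidean_space \<Rightarrow> 'e::euclidean_space \<Rightarrow> 'f::real_normed_vector"
  assumes "open S" "x \<in> S" "\<And>x. x \<in> S \<Longrightarrow> linear (T x)"
    and "\<And>a. ((\<lambda>z. T z a) has_derivative T' a) (at x)" "(f has_derivative f') (at x)"
  shows "((\<lambda>z. T z (f z)) has_derivative (\<lambda>v. T' (f x) v + T x (f' v))) (at x)"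
proof -
  have lin: "T z a = (\<Sum>i\<in>Basis. (a \<bullet> i) *\<^sub>R T z i)" if "z \<in> S" for z a
    using linear_eq_sum_Basis[OF assms(3)[OF that]] by blast
  have T': "T' a v = (\<Sum>i\<in>Basis. (a \<bullet> i) *\<^sub>R T' i v)" for a v
  proof -
    have "((\<lambda>z. T z a) has_derivative (\<lambda>v. \<Sum>i\<in>Basis. (a \<bullet> i) *\<^sub>R T' i v)) (at x)"
    proof (rule has_derivative_transform_within_open[OF _ assms(1,2)])
      show "((\<lambda>z. \<Sum>i\<in>Basis. (a \<bullet> i) *\<^sub>R T z i) has_derivative (\<lambda>v. \<Sum>i\<in>Basis. (a \<bullet> i) *\<^sub>R T' i v)) (at x)"
        by (intro has_derivative_sum has_derivative_scaleR_right assms)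
    qed (metis lin)
    from has_derivative_unique[OF assms(4) this] show ?thesis by (rule fun_cong)
  qed
  show ?thesis
  proof (rule has_derivative_transform_within_open[OF _ assms(1,2)])
    have "((\<lambda>z. \<Sum>i\<in>Basis. (f z \<bullet> i) *\<^sub>R T z i) has_derivative
        (\<lambda>v. \<Sum>i\<in>Basis. (f x \<bullet> i) *\<^sub>R T' i v + (f' v \<bullet> i) *\<^sub>R T x i)) (at x)"
      by (intro has_derivative_sum has_derivative_scaleR assms
          has_derivative_inner_left)
    moreover have "(\<Sum>i\<in>Basis. (f x \<bullet> i) *\<^sub>R T' i v + (f' v \<bullet> i) *\<^sub>R T x i) = T' (f x) v + T x (f' v)" for v
      by (simp only: sum.distrib T'[of "f x"] lin[OF assms(2), of "f' v"])
    ultimately show "((\<lambda>z. \<Sum>i\<in>Basis. (f z \<bullet> i) *\<^sub>R T z i) has_derivative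
        (\<lambda>v. T' (f x) v + T x (f' v))) (at x)" by simp
  qed (use lin in metis)
qed

section \<open>Symmetry of second derivatives\<close>

text \<open>The mean value theorem, applied to the difference in direction \<open>v\<close> as a function of the position in
  direction \<open>u\<close> and then to the derivative along \<open>u\<close>, expresses the second difference by a mixed
  derivative at an intermediate point.\<close>

lemma second_difference_mean_value:
  fixes f :: "'e::euclidean_space \<Rightarrow> real"
  assumes "Ck_on 2 S f" "h > 0"
    and S: "\<And>s t. 0 \<le> s \<Longrightarrow> s \<le> h \<Longrightarrow> 0 \<le> t \<Longrightarrow> t \<le> h \<Longrightarrow> x + s *\<^sub>R u + t *\<^sub>R v \<in> S"
  shows "\<exists>s t. 0 < s \<and> s < h \<and> 0 < t \<and> t < h \<and>
    f (x + h *\<^sub>R u + h *\<^sub>R v) - f (x + h *\<^sub>R u) - f (x + h *\<^sub>R v) + f x =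
    h * h * frechet_derivative (\<lambda>z. frechet_derivative f (at z) u) (at (x + s *\<^sub>R u + t *\<^sub>R v)) v"
proof -
  let ?D = "\<lambda>z. frechet_derivative f (at z)"
  let ?E = "\<lambda>z. frechet_derivative (\<lambda>z. ?D z u) (at z)"
  have C: "Ck_on (Suc 1) S f" "Ck_on (Suc 0) S (\<lambda>z. ?D z u)" using assms(1) by (auto simp: numeral_2_eq_2)
  have d1: "((\<lambda>s. f (x + s *\<^sub>R u + t *\<^sub>R v)) has_derivative (\<lambda>r. r * ?D (x + s *\<^sub>R u + t *\<^sub>R v) u)) (at s)"
    if "0 \<le> s" "s \<le> h" "0 \<le> t" "t \<le> h" for s t
  proof -
    have "((\<lambda>s. f (x + s *\<^sub>R u + t *\<^sub>R v)) has_derivative (\<lambda>r. ?D (x + s *\<^sub>R u + t *\<^sub>R v) (r *\<^sub>R u))) (at s)"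
      by (rule has_derivative_compose[where f = "\<lambda>s. x + s *\<^sub>R u + t *\<^sub>R v" and g = f,
            OF _ Ck_on_has_derivative[OF C(1) S[OF that]]])
        (auto intro!: derivative_eq_intros)
    moreover have "linear (?D (x + s *\<^sub>R u + t *\<^sub>R v))"
      using C(1) S[OF that] by (intro linear_frechet_derivative) auto
    ultimately show ?thesis by (simp add: linear_cmul)
  qed
  have d2: "((\<lambda>t. ?D (x + s *\<^sub>R u + t *\<^sub>R v) u) has_derivative (\<lambda>r. r * ?E (x + s *\<^sub>R u + t *\<^sub>R v) v)) (at t)"
    if "0 \<le> s" "s \<le> h" "0 \<le> t" "t \<le> h" for s t
  proof -
    have "((\<lambda>t. ?D (x + s *\<^sub>R u + t *\<^sub>R v) u) has_derivative (\<lambda>r. ?E (x + s *\<^sub>R u + t *\<^sub>R v) (r *\<^sub>R v))) (at t)"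
      by (rule has_derivative_compose[where f = "\<lambda>t. x + s *\<^sub>R u + t *\<^sub>R v" and g = "\<lambda>z. ?D z u",
            OF _ Ck_on_has_derivative[OF C(2) S[OF that]]])
        (auto intro!: derivative_eq_intros)
    moreover have "linear (?E (x + s *\<^sub>R u + t *\<^sub>R v))"
      using C(2) S[OF that] by (intro linear_frechet_derivative) auto
    ultimately show ?thesis by (simp add: linear_cmul)
  qed
  let ?\<phi> = "\<lambda>s. f (x + s *\<^sub>R u + h *\<^sub>R v) - f (x + s *\<^sub>R u + 0 *\<^sub>R v)"
  obtain s where s: "0 < s" "s < h"
    "?\<phi> h - ?\<phi> 0 = (h - 0) * ?D (x + s *\<^sub>R u + h *\<^sub>R v) u - (h - 0) * ?D (x + s *\<^sub>R u + 0 *\<^sub>R v) u"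
  proof -
    have "\<exists>s\<in>{0<..<h}. ?\<phi> h - ?\<phi> 0 = (\<lambda>r. r * ?D (x + s *\<^sub>R u + h *\<^sub>R v) u - r * ?D (x + s *\<^sub>R u + 0 *\<^sub>R v) u) (h - 0)"
    proof (rule mvt_simple[OF assms(2)])
      fix s assume "0 \<le> s" "s \<le> h"
      then have "(?\<phi> has_derivative (\<lambda>r. r * ?D (x + s *\<^sub>R u + h *\<^sub>R v) u - r * ?D (x + s *\<^sub>R u + 0 *\<^sub>R v) u)) (at s)"
        using assms(2) by (intro has_derivative_diff d1) auto
      then show "(?\<phi> has_derivative (\<lambda>r. r * ?D (x + s *\<^sub>R u + h *\<^sub>R v) u - r * ?D (x + s *\<^sub>R u + 0 *\<^sub>R v) u)) (at s within {0..h})"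
        by (rule has_derivative_at_withinI)
    qed
    then show ?thesis using that by auto
  qed
  obtain t where t: "0 < t" "t < h"
    "?D (x + s *\<^sub>R u + h *\<^sub>R v) u - ?D (x + s *\<^sub>R u + 0 *\<^sub>R v) u = (h - 0) * ?E (x + s *\<^sub>R u + t *\<^sub>R v) v"
    using mvt_simple[OF assms(2), of "\<lambda>t. ?D (x + s *\<^sub>R u + t *\<^sub>R v) u" "\<lambda>t r. r * ?E (x + s *\<^sub>R u + t *\<^sub>R v) v"]
      d2[THEN has_derivative_at_withinI] s by auto
  have "?\<phi> h - ?\<phi> 0 = h * (?D (x + s *\<^sub>R u + h *\<^sub>R v) u - ?D (x + s *\<^sub>R u + 0 *\<^sub>R v) u)"
    using s(3) by (simp add: algebra_simps)
  also have "\<dots> = h * h * ?E (x + s *\<^sub>R u + t *\<^sub>R v) v" by (simp only: t(3)) simp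
  finally show ?thesis using s t by (intro exI[of _ s] exI[of _ t]) (simp add: algebra_simps)
qed

text \<open>The second difference does not change when \<open>u\<close> and \<open>v\<close> are exchanged. So the two mixed derivatives
  take a common value at points arbitrarily close to \<open>x\<close>, which their continuity rules out if they
  differ at \<open>x\<close>.\<close>

lemma second_derivative_symmetric_real:
  fixes f :: "'e::euclidean_space \<Rightarrow> real"
  assumes "open S" "smooth_on S f" "x \<in> S"
  shows "frechet_derivative (\<lambda>z. frechet_derivative f (at z) u) (at x) v
       = frechet_derivative (\<lambda>z. frechet_derivative f (at z) v) (at x) u"
proof (rule ccontr)
  let ?E = "\<lambda>u v z. frechet_derivative (\<lambda>z. frechet_derivative f (at z) u) (at z) v"
  assume ne: "?E u v x \<noteq> ?E v u x"
  define e where "e = \<bar>?E u v x - ?E v u x\<bar> / 2"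
  have e: "e > 0" using ne by (simp add: e_def)
  have "isCont (?E u v) x" for u v
    using smooth_on_frechet_derivative[OF smooth_on_frechet_derivative[OF assms(2)]]
      assms(3) smooth_on_differentiable differentiable_imp_continuous_within by blast
  then have "\<forall>\<^sub>F z in nhds x. dist (?E u v z) (?E u v x) < e \<and> dist (?E v u z) (?E v u x) < e \<and> z \<in> S"
    using e assms(1,3) by (intro eventually_conj tendstoD eventually_nhds_in_open)
      (simp_all add: continuous_at tendsto_nhds_iff)
  then obtain r where r: "r > 0"
    "\<And>z. dist z x < r \<Longrightarrow> dist (?E u v z) (?E u v x) < e \<and> dist (?E v u z) (?E v u x) < e \<and> z \<in> S"
    by (auto simp: eventually_nhds_metric)
  define h where "h = r / (2 * (norm u + norm v + 1))"
  have np: "norm u + norm v + 1 > 0" using norm_ge_zero[of u] norm_ge_zero[of v] by linarith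
  have h: "h > 0" using r np by (simp add: h_def)
  \<comment> \<open>The denominator of \<open>h\<close> keeps the parallelogram spanned by \<open>h u\<close> and \<open>h v\<close> inside the ball of radius \<open>r\<close>.\<close>
  have near: "dist (x + s *\<^sub>R u + t *\<^sub>R v) x < r" if "0 \<le> s" "s \<le> h" "0 \<le> t" "t \<le> h" for s t
  proof -
    have "norm (s *\<^sub>R u + t *\<^sub>R v) \<le> s * norm u + t * norm v"
      using norm_triangle_ineq[of "s *\<^sub>R u" "t *\<^sub>R v"] that by simp
    also have "\<dots> \<le> h * norm u + h * norm v"
      using that by (intro add_mono mult_right_mono) auto
    also have "\<dots> \<le> h * (norm u + norm v + 1)" using h by (simp add: algebra_simps)
    also have "\<dots> = r / 2" using np by (simp add: h_def field_simps)
    also have "\<dots> < r" using r by simp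
    finally show ?thesis by (simp add: dist_norm add.assoc)
  qed
  have C: "Ck_on 2 S f" using assms(2) by (simp add: smooth_on_def)
  obtain s t where st: "0 < s" "s < h" "0 < t" "t < h"
    "f (x + h *\<^sub>R u + h *\<^sub>R v) - f (x + h *\<^sub>R u) - f (x + h *\<^sub>R v) + f x = h * h * ?E u v (x + s *\<^sub>R u + t *\<^sub>R v)"
    using second_difference_mean_value[OF C h, of x u v] near r(2) by blast
  obtain t' s' where st': "0 < t'" "t' < h" "0 < s'" "s' < h"
    "f (x + h *\<^sub>R v + h *\<^sub>R u) - f (x + h *\<^sub>R v) - f (x + h *\<^sub>R u) + f x = h * h * ?E v u (x + t' *\<^sub>R v + s' *\<^sub>R u)"
    using second_difference_mean_value[OF C h, of x v u] near r(2)
    by (smt (verit, del_insts) add.commute add.left_commute)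
  have "h * h * ?E u v (x + s *\<^sub>R u + t *\<^sub>R v) = h * h * ?E v u (x + s' *\<^sub>R u + t' *\<^sub>R v)"
    using st(5) st'(5) by (simp add: algebra_simps)
  then have "?E u v (x + s *\<^sub>R u + t *\<^sub>R v) = ?E v u (x + s' *\<^sub>R u + t' *\<^sub>R v)" using h by simp
  moreover have "dist (?E u v (x + s *\<^sub>R u + t *\<^sub>R v)) (?E u v x) < e"
    "dist (?E v u (x + s' *\<^sub>R u + t' *\<^sub>R v)) (?E v u x) < e"
    using r(2) near st st' by auto
  ultimately show False unfolding dist_real_def e_def by argo
qed

lemma second_derivative_symmetric:
  fixes f :: "'e::euclidean_space \<Rightarrow> 'f::euclidean_space"
  assumes "open S" "smooth_on S f" "x \<in> S"
  shows "frechet_derivative (\<lambda>z. frechet_derivative f (at z) u) (at x) v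
       = frechet_derivative (\<lambda>z. frechet_derivative f (at z) v) (at x) u"
proof (rule euclidean_eqI)
  fix i :: 'f assume "i \<in> Basis"
  have D: "frechet_derivative (\<lambda>z. f z \<bullet> i) (at z) u = frechet_derivative f (at z) u \<bullet> i"
    if "z \<in> S" "smooth_on S f" for z u and f :: "'e \<Rightarrow> 'f"
    using frechet_derivative_at[OF has_derivative_inner_left[OF smooth_on_has_derivative[OF that(2,1)]]]
    by metis
  have E: "frechet_derivative (\<lambda>z. frechet_derivative (\<lambda>z. f z \<bullet> i) (at z) u) (at x) v
      = frechet_derivative (\<lambda>z. frechet_derivative f (at z) u) (at x) v \<bullet> i" for u v
  proof -
    have s: "smooth_on S (\<lambda>z. frechet_derivative f (at z) u)"
      using smooth_on_frechet_derivative[OF assms(2)] .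
    have s': "((\<lambda>z. frechet_derivative f (at z) u \<bullet> i) has_derivative
        (\<lambda>v. frechet_derivative (\<lambda>z. frechet_derivative f (at z) u) (at x) v \<bullet> i)) (at x)"
      by (rule has_derivative_inner_left[OF smooth_on_has_derivative[OF s assms(3)]])
    have "((\<lambda>z. frechet_derivative (\<lambda>z. f z \<bullet> i) (at z) u) has_derivative
        (\<lambda>v. frechet_derivative (\<lambda>z. frechet_derivative f (at z) u) (at x) v \<bullet> i)) (at x)"
      by (rule has_derivative_transform_within_open[OF s' assms(1,3)]) (use D assms(2) in simp)
    from frechet_derivative_at[OF this] show ?thesis by metis
  qed
  show "frechet_derivative (\<lambda>z. frechet_derivative f (at z) u) (at x) v \<bullet> i
      = frechet_derivative (\<lambda>z. frechet_derivative f (at z) v) (at x) u \<bullet> i"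
    using second_derivative_symmetric_real[OF assms(1) smooth_on_inner_left[OF assms(1,2)] assms(3)]
    by (metis E)
qed

section \<open>Charts, tangent vectors and vector fields\<close>

text \<open>The compatibility conditions for charts, which a manifold and its tangent bundle share.\<close>

locale smooth_atlas =
  fixes A :: "('a, 'e::euclidean_space) chart set"
  assumes inj_chart: "c \<in> A \<Longrightarrow> inj_on (snd c) (fst c)"
    and open_image: "c \<in> A \<Longrightarrow> open (snd c ` fst c)"
    and open_overlap: "c \<in> A \<Longrightarrow> c' \<in> A \<Longrightarrow> open (snd c ` (fst c \<inter> fst c'))"
    and smooth_transition: "c \<in> A \<Longrightarrow> c' \<in> A \<Longrightarrow> smooth_on (snd c ` (fst c \<inter> fst c')) (transition c c')"
begin

lemma param_chart: "c \<in> A \<Longrightarrow> p \<in> fst c \<Longrightarrow> param c (snd c p) = p"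
  by (simp add: param_def inj_chart)

lemma param_in: "x \<in> snd c ` (U \<inter> fst c) \<Longrightarrow> c \<in> A \<Longrightarrow> param c x \<in> U \<inter> fst c"
  using param_chart by fastforce

lemma chart_param: "c \<in> A \<Longrightarrow> x \<in> snd c ` fst c \<Longrightarrow> snd c (param c x) = x"
  using param_chart by fastforce

lemma transition_apply: "c \<in> A \<Longrightarrow> p \<in> fst c \<Longrightarrow> transition c c' (snd c p) = snd c' p"
  by (simp add: transition_def param_chart)

lemma transition_has_derivative:
  assumes "c \<in> A" "c' \<in> A" "p \<in> fst c" "p \<in> fst c'"
  shows "(transition c c' has_derivative frechet_derivative (transition c c') (at (snd c p))) (at (snd c p))"
  by (rule smooth_on_has_derivative[OF smooth_transition[OF assms(1,2)]]) (use assms in auto)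

lemma linear_transition_derivative:
  assumes "c \<in> A" "c' \<in> A" "p \<in> fst c" "p \<in> fst c'"
  shows "linear (frechet_derivative (transition c c') (at (snd c p)))"
  using transition_has_derivative[OF assms] has_derivative_linear by blast

lemma has_derivative_change_chart:
  fixes f :: "'a \<Rightarrow> 'b::real_normed_vector"
  assumes c: "c \<in> A" "c' \<in> A" "p \<in> fst c" "p \<in> fst c'"
    and f: "((\<lambda>x. f (param c' x)) has_derivative f') (at (snd c' p))"
  shows "((\<lambda>x. f (param c x)) has_derivative
    (\<lambda>v. f' (frechet_derivative (transition c c') (at (snd c p)) v))) (at (snd c p))"
proof (rule has_derivative_transform_within_open[OF _ open_overlap[OF c(1,2)]])
  show "((\<lambda>x. f (param c' (transition c c' x))) has_derivative
    (\<lambda>v. f' (frechet_derivative (transition c c') (at (snd c p)) v))) (at (snd c p))"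
    by (rule has_derivative_compose[where f = "transition c c'" and g = "\<lambda>x. f (param c' x)",
          OF transition_has_derivative[OF c]]) (use f c transition_apply in simp)
  show "snd c p \<in> snd c ` (fst c \<inter> fst c')" using c by auto
qed (auto simp: param_chart[OF c(1)] param_chart[OF c(2)] transition_apply[OF c(1)])

text \<open>The chain rule for coordinate changes; it makes the coordinate fields tangent vectors.\<close>

lemma transition_cocycle:
  assumes "c \<in> A" "c' \<in> A" "c'' \<in> A" "p \<in> fst c" "p \<in> fst c'" "p \<in> fst c''"
  shows "frechet_derivative (transition c c'') (at (snd c p)) v =
    frechet_derivative (transition c' c'') (at (snd c' p)) (frechet_derivative (transition c c') (at (snd c p)) v)"
proof -
  have "((\<lambda>x. snd c'' (param c' x)) has_derivative frechet_derivative (transition c' c'') (at (snd c' p))) (at (snd c' p))"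
    using transition_has_derivative[of c' c'' p] assms by (simp add: transition_def o_def)
  from has_derivative_change_chart[OF assms(1,2,4,5) this]
  have "(transition c c'' has_derivative (\<lambda>v. frechet_derivative (transition c' c'') (at (snd c' p))
      (frechet_derivative (transition c c') (at (snd c p)) v))) (at (snd c p))"
    by (simp add: transition_def o_def)
  from has_derivative_unique[OF this transition_has_derivative[OF assms(1,3,4,6)]]
  show ?thesis by metis
qed

lemma transition_self_derivative:
  assumes "c \<in> A" "p \<in> fst c"
  shows "frechet_derivative (transition c c) (at (snd c p)) v = v"
proof -
  have "(transition c c has_derivative (\<lambda>v. v)) (at (snd c p))"
    by (rule has_derivative_transform_within_open[OF has_derivative_ident open_image[OF assms(1)]])
      (use assms(2) in \<open>auto simp: transition_apply[OF assms(1)]\<close>)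
  then show ?thesis by (metis frechet_derivative_at)
qed

lemma continuous_transition:
  assumes "c \<in> A" "c' \<in> A"
  shows "continuous_on (snd c ` (fst c \<inter> fst c')) (transition c c')"
  using smooth_transition[OF assms] by (metis smooth_on_def Ck_on.simps(1))

text \<open>Open sets are generated by preimages under charts, for which the claim is the continuity of the coordinate
  changes; finite intersections are preserved because charts are injective.\<close>

lemma open_chart_image:
  assumes "openin (mtop A) U" "c \<in> A"
  shows "open (snd c ` (U \<inter> fst c))"
proof -
  have "generate_topology_on {fst c \<inter> snd c -` W |c W. c \<in> A \<and> open W} U"
    using assms(1) unfolding mtop_def openin_topology_generated_by_iff .
  then show ?thesis
  proof induction
    case Empty show ?case by simp
  next
    case (Int a b)
    have "snd c ` (a \<inter> b \<inter> fst c) = snd c ` (a \<inter> fst c) \<inter> snd c ` (b \<inter> fst c)"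
      using inj_on_image_Int[OF inj_chart[OF assms(2)], of "a \<inter> fst c" "b \<inter> fst c"]
      by (simp add: Int_ac)
    then show ?case using Int by auto
  next
    case (UN K)
    have "snd c ` (\<Union> K \<inter> fst c) = (\<Union>k\<in>K. snd c ` (k \<inter> fst c))" by auto
    then show ?case using UN by auto
  next
    case (Basis s)
    then obtain c' W where s: "s = fst c' \<inter> snd c' -` W" "c' \<in> A" "open W" by blast
    have "snd c ` (s \<inter> fst c) = snd c ` (fst c \<inter> fst c') \<inter> transition c c' -` W"
      unfolding s(1) by (auto simp: transition_apply[OF assms(2)] intro!: imageI)
    then show ?case
      using continuous_open_preimage[OF continuous_transition[OF assms(2) s(2)] open_overlap[OF assms(2) s(2)] s(3)]
      by simp
  qed
qed

lemma openin_chart: "c \<in> A \<Longrightarrow> openin (mtop A) (fst c)"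
proof -
  assume "c \<in> A"
  then have "fst c \<inter> snd c -` UNIV \<in> {fst c \<inter> snd c -` W |c W. c \<in> A \<and> open W}" by blast
  then show ?thesis unfolding mtop_def openin_topology_generated_by_iff
    by (metis (no_types, lifting) generate_topology_on.Basis inf_top.right_neutral vimage_UNIV)
qed

lemma openin_carrier:
  assumes "openin (mtop A) U" "p \<in> U"
  obtains c where "c \<in> A" "p \<in> fst c"
proof -
  have "p \<in> topspace (mtop A)" using assms openin_subset by blast
  then show ?thesis using that by (auto simp: mtop_def)
qed

lemma tspaceD:
  "v \<in> tspace A p \<Longrightarrow> c \<in> A \<Longrightarrow> c' \<in> A \<Longrightarrow> p \<in> fst c \<Longrightarrow> p \<in> fst c' \<Longrightarrow>
    v c' = frechet_derivative (transition c c') (at (snd c p)) (v c)"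
  unfolding tspace_def by blast

lemma tspaceI:
  assumes "\<And>c c'. c \<in> A \<Longrightarrow> c' \<in> A \<Longrightarrow> p \<in> fst c \<Longrightarrow> p \<in> fst c' \<Longrightarrow>
      v c' = frechet_derivative (transition c c') (at (snd c p)) (v c)"
    and "\<And>c. \<not> (c \<in> A \<and> p \<in> fst c) \<Longrightarrow> v c = 0"
  shows "v \<in> tspace A p"
  using assms unfolding tspace_def by blast

lemma tspace_outside: "v \<in> tspace A p \<Longrightarrow> \<not> (c \<in> A \<and> p \<in> fst c) \<Longrightarrow> v c = 0"
  unfolding tspace_def by blast

lemma tspace_eqI:
  assumes "u \<in> tspace A p" "v \<in> tspace A p" "c \<in> A" "p \<in> fst c" "u c = v c"
  shows "u = v"
proof
  fix c'
  show "u c' = v c'"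
  proof (cases "c' \<in> A \<and> p \<in> fst c'")
    case True
    then show ?thesis using tspaceD assms by metis
  next
    case False
    then show ?thesis using assms(1,2) tspace_outside by metis
  qed
qed

lemma vadd_vscale_tspace:
  assumes u: "u \<in> tspace A p" and v: "v \<in> tspace A p"
  shows "vadd (vscale r u) v \<in> tspace A p"
proof (rule tspaceI)
  fix c c' assume c: "c \<in> A" "c' \<in> A" "p \<in> fst c" "p \<in> fst c'"
  show "vadd (vscale r u) v c' = frechet_derivative (transition c c') (at (snd c p)) (vadd (vscale r u) v c)"
    unfolding vadd_def vscale_def tspaceD[OF u c] tspaceD[OF v c]
    by (simp add: linear_add[OF linear_transition_derivative[OF c]] linear_cmul[OF linear_transition_derivative[OF c]])
qed (simp add: vadd_def vscale_def tspace_outside[OF u] tspace_outside[OF v])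

lemma vzero_tspace: "vzero \<in> tspace A p"
  by (rule tspaceI) (simp_all add: vzero_def linear_0[OF linear_transition_derivative])

lemma vadd_tspace: "u \<in> tspace A p \<Longrightarrow> v \<in> tspace A p \<Longrightarrow> vadd u v \<in> tspace A p"
  using vadd_vscale_tspace[of u p v 1] by (simp add: vscale_def)

lemma vsub_tspace: "u \<in> tspace A p \<Longrightarrow> v \<in> tspace A p \<Longrightarrow> vsub u v \<in> tspace A p"
  using vadd_vscale_tspace[of v p u "-1"] by (simp add: vscale_def vadd_def vsub_def)

lemma vscale_tspace: "u \<in> tspace A p \<Longrightarrow> vscale r u \<in> tspace A p"
  using vadd_vscale_tspace[OF _ vzero_tspace, of u p r] by (simp add: vadd_def vzero_def)

lemma coord_field_tspace:
  assumes "c \<in> A" "p \<in> fst c" shows "coord_field A c a p \<in> tspace A p"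
proof (rule tspaceI)
  fix c' c'' assume c: "c' \<in> A" "c'' \<in> A" "p \<in> fst c'" "p \<in> fst c''"
  show "coord_field A c a p c'' = frechet_derivative (transition c' c'') (at (snd c' p)) (coord_field A c a p c')"
    using transition_cocycle[OF assms(1) c(1,2) assms(2) c(3,4), of a] assms c by (simp add: coord_field_def)
qed (auto simp: coord_field_def)

lemma coord_field_self: "c \<in> A \<Longrightarrow> p \<in> fst c \<Longrightarrow> coord_field A c a p c = a"
  by (simp add: coord_field_def transition_self_derivative)

lemma coord_field_of_component:
  assumes "v \<in> tspace A p" "c \<in> A" "p \<in> fst c" shows "coord_field A c (v c) p = v"
  by (rule tspace_eqI[OF coord_field_tspace[OF assms(2,3)] assms coord_field_self[OF assms(2,3)]])

lemma coord_field_add: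
  "c \<in> A \<Longrightarrow> coord_field A c (a + b) p = vadd (coord_field A c a p) (coord_field A c b p)"
  by (auto simp: coord_field_def vadd_def linear_add[OF linear_transition_derivative])

lemma coord_field_scale:
  "c \<in> A \<Longrightarrow> coord_field A c (r *\<^sub>R a) p = vscale r (coord_field A c a p)"
  by (auto simp: coord_field_def vscale_def linear_cmul[OF linear_transition_derivative])

lemma vfields_subset: "X \<in> vfields A U \<Longrightarrow> U' \<subseteq> U \<Longrightarrow> X \<in> vfields A U'"
  unfolding vfields_def by (blast intro: smooth_on_subset)

lemma vfieldsI:
  assumes "\<And>p. p \<in> U \<Longrightarrow> X p \<in> tspace A p"
    and "\<And>c. c \<in> A \<Longrightarrow> smooth_on (snd c ` (U \<inter> fst c)) (\<lambda>x. X (param c x) c)"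
  shows "X \<in> vfields A U"
  using assms unfolding vfields_def by blast

lemma vfieldsD: "X \<in> vfields A U \<Longrightarrow> p \<in> U \<Longrightarrow> X p \<in> tspace A p"
  unfolding vfields_def by auto

lemma vfields_smooth: "X \<in> vfields A U \<Longrightarrow> c \<in> A \<Longrightarrow> smooth_on (snd c ` (U \<inter> fst c)) (\<lambda>x. X (param c x) c)"
  unfolding vfields_def by auto

lemma vfields_has_derivative:
  assumes "X \<in> vfields A U" "c \<in> A" "p \<in> U" "p \<in> fst c"
  shows "((\<lambda>x. X (param c x) c) has_derivative frechet_derivative (\<lambda>x. X (param c x) c) (at (snd c p))) (at (snd c p))"
  by (rule smooth_on_has_derivative[OF vfields_smooth[OF assms(1,2)]]) (use assms in auto)

lemma vfields_vadd:
  assumes "openin (mtop A) U" "X \<in> vfields A U" "Y \<in> vfields A U"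
  shows "(\<lambda>q. vadd (X q) (Y q)) \<in> vfields A U"
proof (rule vfieldsI)
  show "smooth_on (snd c ` (U \<inter> fst c)) (\<lambda>x. vadd (X (param c x)) (Y (param c x)) c)" if "c \<in> A" for c
    unfolding vadd_def
    by (intro smooth_on_add open_chart_image[OF assms(1) that] vfields_smooth[OF _ that] assms)
qed (intro vadd_tspace vfieldsD[OF assms(2)] vfieldsD[OF assms(3)])

lemma vfields_vscale:
  assumes "openin (mtop A) U" "X \<in> vfields A U" "smooth_fun A U f"
  shows "(\<lambda>q. vscale (f q) (X q)) \<in> vfields A U"
proof (rule vfieldsI)
  show "smooth_on (snd c ` (U \<inter> fst c)) (\<lambda>x. vscale (f (param c x)) (X (param c x)) c)" if "c \<in> A" for c
    unfolding vscale_def using assms(3) that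
    by (intro smooth_on_scaleR open_chart_image[OF assms(1) that] vfields_smooth[OF assms(2) that])
      (simp add: smooth_fun_def)
qed (intro vscale_tspace vfieldsD[OF assms(2)])

lemma smooth_fun_const: "smooth_fun A U (\<lambda>q. r)"
  unfolding smooth_fun_def by (simp add: smooth_on_const)

lemma vfields_vsub:
  assumes "openin (mtop A) U" "X \<in> vfields A U" "Y \<in> vfields A U"
  shows "(\<lambda>q. vsub (X q) (Y q)) \<in> vfields A U"
proof -
  have "(\<lambda>q. vadd (X q) (vscale (-1) (Y q))) \<in> vfields A U"
    by (intro vfields_vadd vfields_vscale smooth_fun_const assms)
  then show ?thesis by (simp add: vadd_def vsub_def vscale_def)
qed

lemma vfields_vzero: "(\<lambda>q. vzero) \<in> vfields A U"
  by (rule vfieldsI) (simp_all add: vzero_tspace, simp add: vzero_def smooth_on_const)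

text \<open>Over a part of one chart domain, smoothness in that chart implies smoothness in every chart. For vector
  fields (\<open>vfieldsI_chart\<close>) the components change by the differential of the coordinate change, which is a
  smooth family of linear maps.\<close>

lemma smooth_on_change_chart:
  fixes f :: "'a \<Rightarrow> 'b::real_normed_vector"
  assumes U: "openin (mtop A) U" "U \<subseteq> fst c" and c: "c \<in> A" "c' \<in> A"
    and f: "smooth_on (snd c ` U) (\<lambda>x. f (param c x))"
  shows "smooth_on (snd c' ` (U \<inter> fst c')) (\<lambda>x. f (param c' x))"
proof (rule smooth_on_cong)
  show o: "open (snd c' ` (U \<inter> fst c'))" by (rule open_chart_image[OF U(1) c(2)])
  have o': "open (snd c ` U)" using open_chart_image[OF U(1) c(1)] U(2) by (simp add: Int_absorb2)
  have "smooth_on (snd c' ` (U \<inter> fst c')) (transition c' c)"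
    by (rule smooth_on_subset[OF smooth_transition[OF c(2,1)]]) (use U(2) in auto)
  then show "smooth_on (snd c' ` (U \<inter> fst c')) (\<lambda>x. f (param c (transition c' c x)))"
    by (rule smooth_on_compose[OF f _ o o']) (auto simp: transition_apply[OF c(2)])
  show "f (param c (transition c' c x)) = f (param c' x)" if "x \<in> snd c' ` (U \<inter> fst c')" for x
    using that U(2) by (auto simp: param_chart[OF c(1)] param_chart[OF c(2)] transition_apply[OF c(2)] subset_iff)
qed

lemma smooth_funI_chart:
  assumes "openin (mtop A) U" "U \<subseteq> fst c" "c \<in> A" "smooth_on (snd c ` U) (\<lambda>x. f (param c x))"
  shows "smooth_fun A U f"
  unfolding smooth_fun_def using smooth_on_change_chart[OF assms(1-3) _ assms(4)] by blast

lemma vfieldsI_chart: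
  assumes U: "openin (mtop A) U" "U \<subseteq> fst c" and c: "c \<in> A"
    and X: "\<And>p. p \<in> U \<Longrightarrow> X p \<in> tspace A p" "smooth_on (snd c ` U) (\<lambda>x. X (param c x) c)"
  shows "X \<in> vfields A U"
  unfolding vfields_def
proof (intro CollectI conjI ballI X(1))
  fix c' assume c': "c' \<in> A"
  have o: "open (snd c' ` (U \<inter> fst c'))" by (rule open_chart_image[OF U(1) c'])
  have o2: "open (snd c ` (fst c \<inter> fst c'))" by (rule open_overlap[OF c c'])
  let ?D = "\<lambda>p. frechet_derivative (transition c c') (at (snd c p))"
  show "smooth_on (snd c' ` (U \<inter> fst c')) (\<lambda>x. X (param c' x) c')"
  proof (rule smooth_on_cong[OF o])
    show "smooth_on (snd c' ` (U \<inter> fst c')) (\<lambda>x. ?D (param c' x) (X (param c' x) c))"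
    proof (rule smooth_on_linear_family[where T = "\<lambda>x. ?D (param c' x)" and f = "\<lambda>x. X (param c' x) c", OF o])
      show "linear (?D (param c' x))" if "x \<in> snd c' ` (U \<inter> fst c')" for x
        by (rule linear_transition_derivative[OF c c']) (use param_in[OF that c'] U(2) in auto)
      have "smooth_on (snd c ` (fst c \<inter> fst c')) (\<lambda>x. ?D (param c x) a)" for a
        by (rule smooth_on_cong[OF o2 smooth_on_frechet_derivative[OF smooth_transition[OF c c']]])
          (auto simp: param_chart[OF c])
      then have s: "smooth_on (snd c ` (U \<inter> fst c')) (\<lambda>x. ?D (param c x) a)" for a
        by (rule smooth_on_subset) (use U in auto)
      have o3: "openin (mtop A) (U \<inter> fst c')" by (rule openin_Int[OF U(1) openin_chart[OF c']])
      have "U \<inter> fst c' \<subseteq> fst c" using U(2) by auto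
      from smooth_on_change_chart[OF o3 this c c' s]
      show "smooth_on (snd c' ` (U \<inter> fst c')) (\<lambda>x. ?D (param c' x) a)" for a
        by (simp add: Int_assoc)
      show "smooth_on (snd c' ` (U \<inter> fst c')) (\<lambda>x. X (param c' x) c)"
        by (rule smooth_on_change_chart[OF U c c' X(2)])
    qed
    show "?D (param c' x) (X (param c' x) c) = X (param c' x) c'" if "x \<in> snd c' ` (U \<inter> fst c')" for x
      by (rule tspaceD[OF X(1) c c', symmetric]) (use param_in[OF that c'] U(2) in auto)
  qed
qed

lemma coord_field_vfields: "c \<in> A \<Longrightarrow> coord_field A c a \<in> vfields A (fst c)"
proof (rule vfieldsI_chart[OF openin_chart subset_refl])
  assume c: "c \<in> A"
  show "smooth_on (snd c ` fst c) (\<lambda>x. coord_field A c a (param c x) c)"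
    by (rule smooth_on_cong[OF open_image[OF c] smooth_on_const[of _ a]])
      (auto simp: coord_field_self[OF c] param_chart[OF c])
qed (auto intro: coord_field_tspace)

lemma component_smooth_fun:
  assumes "openin (mtop A) U" "U \<subseteq> fst c" "c \<in> A" "X \<in> vfields A U"
  shows "smooth_fun A U (\<lambda>q. X q c \<bullet> i)"
proof (rule smooth_funI_chart[OF assms(1-3)])
  show "smooth_on (snd c ` U) (\<lambda>x. X (param c x) c \<bullet> i)"
    using smooth_on_inner_left[OF open_chart_image[OF assms(1,3)] vfields_smooth[OF assms(4,3)]] assms(2)
    by (simp add: Int_absorb2)
qed

lemma vderiv_chart:
  assumes "smooth_fun A U f" "p \<in> U" "c \<in> A" "p \<in> fst c" "v \<in> tspace A p"
  shows "vderiv A p v f = frechet_derivative (\<lambda>x. f (param c x)) (at (snd c p)) (v c)"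
proof -
  define c0 where "c0 = chart_at A p"
  have c0: "c0 \<in> A" "p \<in> fst c0"
    using someI[of "\<lambda>c. c \<in> A \<and> p \<in> fst c" c] assms unfolding c0_def chart_at_def by auto
  have "((\<lambda>x. f (param c0 x)) has_derivative frechet_derivative (\<lambda>x. f (param c0 x)) (at (snd c0 p))) (at (snd c0 p))"
    by (rule smooth_on_has_derivative[of "snd c0 ` (U \<inter> fst c0)"]) (use assms c0 in \<open>auto simp: smooth_fun_def\<close>)
  from frechet_derivative_at[OF has_derivative_change_chart[OF assms(3) c0(1) assms(4) c0(2) this]]
  show ?thesis
    unfolding vderiv_def Let_def c0_def[symmetric] tspaceD[OF assms(5,3) c0(1) assms(4) c0(2)]
    by metis
qed

end

section \<open>Affine connections in a chart\<close>

locale connection = smooth_atlas A for A :: "('a, 'e::euclidean_space) chart set" +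
  fixes D :: "('a, 'e) conn"
  assumes affine: "affine_connection A D"
begin

abbreviation \<Gamma> :: "('a, 'e) chart \<Rightarrow> 'a \<Rightarrow> 'e \<Rightarrow> 'e \<Rightarrow> 'e" where
  "\<Gamma> \<equiv> christoffel A D"

lemma affineD:
  assumes "openin (mtop A) U" "X \<in> vfields A U" "Y \<in> vfields A U" "Z \<in> vfields A U" "smooth_fun A U f"
  shows "D X Y \<in> vfields A U"
    and "p \<in> U \<Longrightarrow> D (\<lambda>q. vadd (X q) (Z q)) Y p = vadd (D X Y p) (D Z Y p)"
    and "p \<in> U \<Longrightarrow> D (\<lambda>q. vscale (f q) (X q)) Y p = vscale (f p) (D X Y p)"
    and "p \<in> U \<Longrightarrow> D X (\<lambda>q. vadd (Y q) (Z q)) p = vadd (D X Y p) (D X Z p)"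
    and "p \<in> U \<Longrightarrow> D X (\<lambda>q. vscale (f q) (Y q)) p
            = vadd (vscale (vderiv A p (X p) f) (Y p)) (vscale (f p) (D X Y p))"
  using affine[unfolded affine_connection_def, rule_format, of U X Y Z f] assms by blast+

lemma D_vfields: "openin (mtop A) U \<Longrightarrow> X \<in> vfields A U \<Longrightarrow> Y \<in> vfields A U \<Longrightarrow> D X Y \<in> vfields A U"
  by (rule affineD(1)[OF _ _ _ _ smooth_fun_const])

lemma smooth_fun_indicator:
  assumes "openin (mtop A) U" shows "smooth_fun A U (\<lambda>q. if q \<in> U then 0 else 1)"
  unfolding smooth_fun_def
proof
  fix c assume c: "c \<in> A"
  show "smooth_on (snd c ` (U \<inter> fst c)) (\<lambda>x. if param c x \<in> U then 0 else 1 :: real)"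
    by (rule smooth_on_cong[OF open_chart_image[OF assms c] smooth_on_const[of _ 0]])
      (auto simp: param_chart[OF c])
qed

text \<open>Locality of a connection. A field \<open>Z\<close> that vanishes on \<open>U\<close> equals \<open>h Z\<close> everywhere, where
  \<open>h\<close> is \<open>0\<close> on \<open>U\<close> and \<open>1\<close> elsewhere. In the second argument the Leibniz rule produces an
  additional multiple of \<open>Z p\<close>, which is \<open>0\<close>.\<close>

lemma D_zero_left:
  assumes U: "openin (mtop A) U" "Z \<in> vfields A U" "Y \<in> vfields A U" "p \<in> U"
    and "\<And>q. q \<in> U \<Longrightarrow> Z q = vzero"
  shows "D Z Y p = vzero"
proof -
  have "Z = (\<lambda>q. vscale (if q \<in> U then 0 else 1) (Z q))"
    using assms(5) by (auto simp: vscale_def vzero_def fun_eq_iff)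
  then have "D Z Y p = vscale (if p \<in> U then 0 else 1) (D Z Y p)"
    using affineD(3)[OF U(1,2,3,3) smooth_fun_indicator[OF U(1)] U(4)] by metis
  then show ?thesis using U(4) by (simp add: vscale_def vzero_def)
qed

lemma D_zero_right:
  assumes U: "openin (mtop A) U" "X \<in> vfields A U" "Z \<in> vfields A U" "p \<in> U"
    and "\<And>q. q \<in> U \<Longrightarrow> Z q = vzero"
  shows "D X Z p = vzero"
proof -
  have "Z = (\<lambda>q. vscale (if q \<in> U then 0 else 1) (Z q))"
    using assms(5) by (auto simp: vscale_def vzero_def fun_eq_iff)
  then have "D X Z p = vadd (vscale (vderiv A p (X p) (\<lambda>q. if q \<in> U then 0 else 1)) (Z p))
      (vscale (if p \<in> U then 0 else 1) (D X Z p))"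
    using affineD(5)[OF U(1,2,3,3) smooth_fun_indicator[OF U(1)] U(4)] by metis
  then show ?thesis using U(4) assms(5) by (simp add: vscale_def vzero_def vadd_def)
qed

lemma D_cong:
  assumes U: "openin (mtop A) U" "p \<in> U"
    and X: "X \<in> vfields A U" "X' \<in> vfields A U" "\<And>q. q \<in> U \<Longrightarrow> X q = X' q"
    and Y: "Y \<in> vfields A U" "Y' \<in> vfields A U" "\<And>q. q \<in> U \<Longrightarrow> Y q = Y' q"
  shows "D X Y p = D X' Y' p"
proof -
  let ?Z = "\<lambda>q. vsub (X' q) (X q)" and ?W = "\<lambda>q. vsub (Y' q) (Y q)"
  have v: "?Z \<in> vfields A U" "?W \<in> vfields A U" using vfields_vsub U X Y by auto
  have "D ?Z Y p = vzero"
    by (rule D_zero_left[OF U(1) v(1) Y(1) U(2)]) (simp add: X(3) vsub_def vzero_def)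
  then have "D (\<lambda>q. vadd (X q) (?Z q)) Y p = D X Y p"
    using affineD(2)[OF U(1) X(1) Y(1) v(1) smooth_fun_const U(2)] by (simp add: vadd_def vzero_def)
  moreover have "D X' ?W p = vzero"
    by (rule D_zero_right[OF U(1) X(2) v(2) U(2)]) (simp add: Y(3) vsub_def vzero_def)
  then have "D X' (\<lambda>q. vadd (Y q) (?W q)) p = D X' Y p"
    using affineD(4)[OF U(1) X(2) Y(1) v(2) smooth_fun_const U(2)] by (simp add: vadd_def vzero_def)
  ultimately show ?thesis by (simp add: vadd_def vsub_def)
qed

lemma D_sum_left:
  assumes U: "openin (mtop A) U" "p \<in> U" "Y \<in> vfields A U" and "finite I"
    and X: "\<And>i. X i \<in> vfields A U" "\<And>i. smooth_fun A U (f i)"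
  shows "(\<lambda>q c. \<Sum>i\<in>I. f i q *\<^sub>R X i q c) \<in> vfields A U \<and>
    D (\<lambda>q c. \<Sum>i\<in>I. f i q *\<^sub>R X i q c) Y p = (\<lambda>c. \<Sum>i\<in>I. f i p *\<^sub>R D (X i) Y p c)"
  using assms(4)
proof induction
  case empty
  have "(\<lambda>q. vzero) \<in> vfields A U" "D (\<lambda>q. vzero) Y p = vzero"
    using D_zero_left[OF U(1) vfields_vzero U(3,2)] vfields_vzero by auto
  then show ?case by (simp add: vzero_def)
next
  case (insert i I)
  let ?S = "\<lambda>q c. \<Sum>i\<in>I. f i q *\<^sub>R X i q c" and ?T = "\<lambda>q. vscale (f i q) (X i q)"
  have S: "?S \<in> vfields A U" "?T \<in> vfields A U" using insert vfields_vscale[OF U(1) X] by auto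
  have e: "(\<lambda>q c. \<Sum>i\<in>insert i I. f i q *\<^sub>R X i q c) = (\<lambda>q. vadd (?T q) (?S q))"
    using insert(1,2) by (simp add: vadd_def vscale_def)
  show ?case unfolding e
  proof (intro conjI vfields_vadd[OF U(1) S(2,1)])
    show "D (\<lambda>q. vadd (?T q) (?S q)) Y p = (\<lambda>c. \<Sum>i\<in>insert i I. f i p *\<^sub>R D (X i) Y p c)"
      using affineD(2)[OF U(1) S(2) U(3) S(1) smooth_fun_const U(2)]
        affineD(3)[OF U(1) X(1) U(3) S(1) X(2) U(2)] insert
      by (simp add: vadd_def vscale_def)
  qed
qed

lemma D_sum_right:
  assumes U: "openin (mtop A) U" "p \<in> U" "X \<in> vfields A U" and "finite I"
    and Y: "\<And>i. Y i \<in> vfields A U" "\<And>i. smooth_fun A U (f i)"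
  shows "(\<lambda>q c. \<Sum>i\<in>I. f i q *\<^sub>R Y i q c) \<in> vfields A U \<and>
    D X (\<lambda>q c. \<Sum>i\<in>I. f i q *\<^sub>R Y i q c) p =
      (\<lambda>c. \<Sum>i\<in>I. vderiv A p (X p) (f i) *\<^sub>R Y i p c + f i p *\<^sub>R D X (Y i) p c)"
  using assms(4)
proof induction
  case empty
  have "(\<lambda>q. vzero) \<in> vfields A U" "D X (\<lambda>q. vzero) p = vzero"
    using D_zero_right[OF U(1,3) vfields_vzero U(2)] vfields_vzero by auto
  then show ?case by (simp add: vzero_def)
next
  case (insert i I)
  let ?S = "\<lambda>q c. \<Sum>i\<in>I. f i q *\<^sub>R Y i q c" and ?T = "\<lambda>q. vscale (f i q) (Y i q)"
  have S: "?S \<in> vfields A U" "?T \<in> vfields A U" using insert vfields_vscale[OF U(1) Y] by auto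
  have e: "(\<lambda>q c. \<Sum>i\<in>insert i I. f i q *\<^sub>R Y i q c) = (\<lambda>q. vadd (?T q) (?S q))"
    using insert(1,2) by (simp add: vadd_def vscale_def)
  show ?case unfolding e
  proof (intro conjI vfields_vadd[OF U(1) S(2,1)])
    show "D X (\<lambda>q. vadd (?T q) (?S q)) p =
        (\<lambda>c. \<Sum>i\<in>insert i I. vderiv A p (X p) (f i) *\<^sub>R Y i p c + f i p *\<^sub>R D X (Y i) p c)"
      using affineD(4)[OF U(1,3) S(2,1) smooth_fun_const U(2)]
        affineD(5)[OF U(1,3) Y(1) S(1) Y(2) U(2)] insert
      by (simp add: vadd_def vscale_def)
  qed
qed

lemma christoffel_linear:
  assumes c: "c \<in> A" and p: "p \<in> fst c"
  shows "linear (\<lambda>a. \<Gamma> c p a b)" "linear (\<Gamma> c p a)"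
proof -
  note o = openin_chart[OF c] and cf = coord_field_vfields[OF c]
  note ax = affineD[OF o cf cf cf smooth_fun_const]
  have cs: "coord_field A c (a + b) = (\<lambda>q. vadd (coord_field A c a q) (coord_field A c b q))"
    "coord_field A c (r *\<^sub>R a) = (\<lambda>q. vscale r (coord_field A c a q))" for a b r
    using coord_field_add[OF c] coord_field_scale[OF c] by auto
  show "linear (\<lambda>a. \<Gamma> c p a b)"
    by (rule linearI) (simp_all add: christoffel_def cs ax(2,3)[OF p], simp_all add: vadd_def vscale_def)
  have "vderiv A p (coord_field A c a p) (\<lambda>q. r) = 0" for r
    by (simp add: vderiv_def Let_def)
  then show "linear (\<Gamma> c p a)"
    by (intro linearI) (simp_all add: christoffel_def cs ax(4,5)[OF p], simp_all add: vadd_def vscale_def)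
qed

lemma christoffel_zero:
  assumes "c \<in> A" "p \<in> fst c" shows "\<Gamma> c p 0 a = 0" "\<Gamma> c p a 0 = 0"
  using linear_0[OF christoffel_linear(1)[OF assms]] linear_0[OF christoffel_linear(2)[OF assms]] by auto

lemma christoffel_smooth:
  assumes c: "c \<in> A" shows "smooth_on (snd c ` fst c) (\<lambda>x. \<Gamma> c (param c x) a b)"
  using vfields_smooth[OF D_vfields[OF openin_chart[OF c] coord_field_vfields[OF c] coord_field_vfields[OF c]] c]
  by (simp add: christoffel_def)

lemma tspace_expansion:
  assumes "v \<in> tspace A q" "c \<in> A" "q \<in> fst c"
  shows "v = (\<lambda>c'. \<Sum>i\<in>Basis. (v c \<bullet> i) *\<^sub>R coord_field A c i q c')"
proof
  fix c'
  have "linear (\<lambda>a. coord_field A c a q c')"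
    by (rule linearI) (simp_all add: coord_field_add[OF assms(2)] coord_field_scale[OF assms(2)] vadd_def vscale_def)
  from linear_eq_sum_Basis[OF this, of "v c"]
  show "v c' = (\<Sum>i\<in>Basis. (v c \<bullet> i) *\<^sub>R coord_field A c i q c')"
    unfolding coord_field_of_component[OF assms] .
qed

text \<open>Near \<open>p\<close> both fields are combinations of coordinate fields with smooth coefficients. Linearity in the
  first argument and the Leibniz rule in the second one give \<open>\<nabla>\<^sub>XY = dY(X) + \<Gamma>(X, Y)\<close>.\<close>

lemma D_local:
  assumes U: "openin (mtop A) U" "X \<in> vfields A U" "Y \<in> vfields A U" "p \<in> U" and c: "c \<in> A" "p \<in> fst c"
  shows "D X Y p c = frechet_derivative (\<lambda>x. Y (param c x) c) (at (snd c p)) (X p c) + \<Gamma> c p (X p c) (Y p c)"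
proof -
  define U' where "U' = U \<inter> fst c"
  have U': "openin (mtop A) U'" "U' \<subseteq> fst c" "U' \<subseteq> U" "p \<in> U'"
    using openin_Int[OF U(1) openin_chart[OF c(1)]] U(4) c(2) by (auto simp: U'_def)
  have X: "X \<in> vfields A U'" and Y: "Y \<in> vfields A U'" using vfields_subset U U'(3) by auto
  have cf: "coord_field A c i \<in> vfields A U'" for i
    using vfields_subset[OF coord_field_vfields[OF c(1)] U'(2)] .
  note sf = component_smooth_fun[OF U'(1,2) c(1)]
  let ?X = "\<lambda>q c'. \<Sum>i\<in>Basis. (X q c \<bullet> i) *\<^sub>R coord_field A c i q c'"
  let ?Y = "\<lambda>q c'. \<Sum>i\<in>Basis. (Y q c \<bullet> i) *\<^sub>R coord_field A c i q c'"
  note sl = D_sum_left[where X = "\<lambda>i. coord_field A c i" and f = "\<lambda>i q. X q c \<bullet> i", OF U'(1,4) _ finite_Basis cf sf[OF X]]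
  note sr = D_sum_right[where Y = "\<lambda>i. coord_field A c i" and f = "\<lambda>i q. Y q c \<bullet> i", OF U'(1,4) _ finite_Basis cf sf[OF Y]]
  have eX: "X q = ?X q" and eY: "Y q = ?Y q" if "q \<in> U'" for q
    using that tspace_expansion[OF vfieldsD c(1)] X Y U'(2) by blast+
  have DX: "D X (coord_field A c b) p c = \<Gamma> c p (X p c) b" for b
  proof -
    have "D X (coord_field A c b) p = D ?X (coord_field A c b) p"
      by (rule D_cong[OF U'(1,4) X _ eX cf cf refl]) (rule conjunct1[OF sl[OF cf]])
    also have "\<dots> = (\<lambda>c'. \<Sum>i\<in>Basis. (X p c \<bullet> i) *\<^sub>R D (coord_field A c i) (coord_field A c b) p c')"
      using sl[OF cf] by blast
    finally have "D X (coord_field A c b) p c = (\<Sum>i\<in>Basis. (X p c \<bullet> i) *\<^sub>R \<Gamma> c p i b)"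
      by (simp add: christoffel_def)
    then show ?thesis using linear_eq_sum_Basis[OF christoffel_linear(1)[OF c]] by metis
  qed
  have d: "((\<lambda>x. Y (param c x) c) has_derivative frechet_derivative (\<lambda>x. Y (param c x) c) (at (snd c p))) (at (snd c p))"
    by (rule vfields_has_derivative[OF U(3) c(1) U(4) c(2)])
  have vd: "vderiv A p (X p) (\<lambda>q. Y q c \<bullet> i) = frechet_derivative (\<lambda>x. Y (param c x) c) (at (snd c p)) (X p c) \<bullet> i" for i
    unfolding vderiv_chart[OF sf[OF Y] U'(4) c vfieldsD[OF U(2,4)]]
    using frechet_derivative_at[OF has_derivative_inner_left[OF d]] by metis
  have "D X Y p c = D X ?Y p c"
    by (rule fun_cong, rule D_cong[OF U'(1,4) X X refl Y _ eY]) (rule conjunct1[OF sr[OF X]])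
  also have "\<dots> = (\<Sum>i\<in>Basis. vderiv A p (X p) (\<lambda>q. Y q c \<bullet> i) *\<^sub>R coord_field A c i p c
      + (Y p c \<bullet> i) *\<^sub>R D X (coord_field A c i) p c)"
    using sr[OF X] by simp
  also have "\<dots> = (\<Sum>i\<in>Basis. (frechet_derivative (\<lambda>x. Y (param c x) c) (at (snd c p)) (X p c) \<bullet> i) *\<^sub>R i)
      + (\<Sum>i\<in>Basis. (Y p c \<bullet> i) *\<^sub>R \<Gamma> c p (X p c) i)"
    unfolding vd DX coord_field_self[OF c] by (rule sum.distrib)
  also have "(\<Sum>i\<in>Basis. (Y p c \<bullet> i) *\<^sub>R \<Gamma> c p (X p c) i) = \<Gamma> c p (X p c) (Y p c)"
    by (rule linear_eq_sum_Basis[OF christoffel_linear(2)[OF c], symmetric])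
  finally show ?thesis by (simp only: euclidean_representation)
qed

end

section \<open>Endomorphism fields and curvature in a chart\<close>

text \<open>Smooth tensor fields of type \<open>(1, 1)\<close>: what the almost complex structure of \<open>M\<close> and the structures on the
  tangent bundle have in common.\<close>

definition smooth_endo :: "('a, 'e::euclidean_space) chart set \<Rightarrow> ('a, 'e) endo \<Rightarrow> bool" where
  "smooth_endo A J \<longleftrightarrow>
     (\<forall>p\<in>carrier A. \<forall>u\<in>tspace A p. J p u \<in> tspace A p \<and>
        (\<forall>v\<in>tspace A p. \<forall>r. J p (vadd (vscale r u) v) = vadd (vscale r (J p u)) (J p v))) \<and>
     (\<forall>U X. openin (mtop A) U \<and> X \<in> vfields A U \<longrightarrow> (\<lambda>p. J p (X p)) \<in> vfields A U)"

lemma almost_complex_smooth_endo: "almost_complex A J \<Longrightarrow> smooth_endo A J"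
  unfolding almost_complex_def smooth_endo_def by blast

definition endo_comp ::
  "('a, 'e::euclidean_space) chart set \<Rightarrow> ('a, 'e) endo \<Rightarrow> ('a, 'e) chart \<Rightarrow> 'a \<Rightarrow> 'e \<Rightarrow> 'e" where
  "endo_comp A J c p a = J p (coord_field A c a p) c"

context smooth_atlas
begin

lemma carrierI: "c \<in> A \<Longrightarrow> p \<in> fst c \<Longrightarrow> p \<in> carrier A"
  unfolding carrier_def by blast

lemma smooth_endo_tspace:
  "smooth_endo A J \<Longrightarrow> c \<in> A \<Longrightarrow> p \<in> fst c \<Longrightarrow> u \<in> tspace A p \<Longrightarrow> J p u \<in> tspace A p"
  unfolding smooth_endo_def using carrierI by blast

lemma smooth_endo_linear:
  "smooth_endo A J \<Longrightarrow> c \<in> A \<Longrightarrow> p \<in> fst c \<Longrightarrow> u \<in> tspace A p \<Longrightarrow> v \<in> tspace A p \<Longrightarrow>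
    J p (vadd (vscale r u) v) = vadd (vscale r (J p u)) (J p v)"
  unfolding smooth_endo_def using carrierI by blast

lemma smooth_endo_vfields:
  "smooth_endo A J \<Longrightarrow> openin (mtop A) U \<Longrightarrow> X \<in> vfields A U \<Longrightarrow> (\<lambda>p. J p (X p)) \<in> vfields A U"
  unfolding smooth_endo_def by blast

lemma endo_comp_apply:
  "c \<in> A \<Longrightarrow> p \<in> fst c \<Longrightarrow> u \<in> tspace A p \<Longrightarrow> J p u c = endo_comp A J c p (u c)"
  by (simp add: endo_comp_def coord_field_of_component)

lemma endo_comp_linear:
  assumes J: "smooth_endo A J" and c: "c \<in> A" "p \<in> fst c"
  shows "linear (endo_comp A J c p)"
proof -
  have l: "endo_comp A J c p (r *\<^sub>R a + b) = r *\<^sub>R endo_comp A J c p a + endo_comp A J c p b" for r a b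
    unfolding endo_comp_def coord_field_add[OF c(1)] coord_field_scale[OF c(1)]
      smooth_endo_linear[OF J c coord_field_tspace[OF c] coord_field_tspace[OF c]]
    by (simp add: vadd_def vscale_def)
  have z: "endo_comp A J c p 0 = 0" using l[of "-1" 0 0] by simp
  show ?thesis
    by (rule linearI) (use l[of 1] l[of _ _ 0] z in simp_all)
qed

lemma endo_comp_smooth:
  assumes J: "smooth_endo A J" and c: "c \<in> A"
  shows "smooth_on (snd c ` fst c) (\<lambda>x. endo_comp A J c (param c x) a)"
  using vfields_smooth[OF smooth_endo_vfields[OF J openin_chart[OF c] coord_field_vfields[OF c]] c]
  by (simp add: endo_comp_def)

lemma tspace_eq_vzero_iff: "v \<in> tspace A p \<Longrightarrow> c \<in> A \<Longrightarrow> p \<in> fst c \<Longrightarrow> v = vzero \<longleftrightarrow> v c = 0"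
  by (metis tspace_eqI vzero_tspace vzero_def)

end

definition endo_deriv_comp ::
  "('a, 'e::euclidean_space) chart set \<Rightarrow> ('a, 'e) endo \<Rightarrow> ('a, 'e) chart \<Rightarrow> 'a \<Rightarrow> 'e \<Rightarrow> 'e \<Rightarrow> 'e" where
  "endo_deriv_comp A J c p a b = frechet_derivative (\<lambda>x. endo_comp A J c (param c x) b) (at (snd c p)) a"

text \<open>The coordinate expression \<open>\<partial>\<^sub>a\<Gamma>\<^sub>b - \<partial>\<^sub>b\<Gamma>\<^sub>a + [\<Gamma>\<^sub>a, \<Gamma>\<^sub>b]\<close> of \<open>R(a, b)\<close>, where \<open>\<Gamma>\<^sub>a\<close> is the
  endomorphism \<open>\<Gamma>(a, \<cdot>)\<close>.\<close>

definition curv_comp ::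
  "('a, 'e::euclidean_space) chart set \<Rightarrow> ('a, 'e) conn \<Rightarrow> ('a, 'e) chart \<Rightarrow> 'a \<Rightarrow> 'e \<Rightarrow> 'e \<Rightarrow> 'e \<Rightarrow> 'e" where
  "curv_comp A D c p a b z =
     frechet_derivative (\<lambda>x. christoffel A D c (param c x) b z) (at (snd c p)) a
   - frechet_derivative (\<lambda>x. christoffel A D c (param c x) a z) (at (snd c p)) b
   + christoffel A D c p a (christoffel A D c p b z) - christoffel A D c p b (christoffel A D c p a z)"

context connection
begin

lemma curv_comp_zero:
  assumes c: "c \<in> A" "p \<in> fst c"
  shows "curv_comp A D c p b 0 z = 0" "curv_comp A D c p 0 b z = 0"
proof -
  have x: "snd c p \<in> snd c ` fst c" using c(2) by auto
  have "((\<lambda>x. \<Gamma> c (param c x) 0 y) has_derivative (\<lambda>v. 0)) (at (snd c p))" for y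
    by (rule has_derivative_transform_within_open[OF has_derivative_const[of 0] open_image[OF c(1)] x])
      (use c(1) in \<open>auto simp: param_chart[OF c(1)] christoffel_zero\<close>)
  note d = frechet_derivative_at[OF this, symmetric]
  have "linear (frechet_derivative (\<lambda>x. \<Gamma> c (param c x) b y) (at (snd c p)))" for y
    by (rule linear_frechet_derivative[OF smooth_on_differentiable[OF christoffel_smooth[OF c(1)] x]])
  from linear_0[OF this] show "curv_comp A D c p b 0 z = 0" "curv_comp A D c p 0 b z = 0"
    unfolding curv_comp_def d by (simp_all add: christoffel_zero[OF c])
qed

lemma cov_deriv_tspace:
  assumes J: "smooth_endo A J" and U: "openin (mtop A) U" "X \<in> vfields A U" "Y \<in> vfields A U" "p \<in> U"
  shows "cov_deriv_endo D J X Y p \<in> tspace A p"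
proof -
  obtain c where c: "c \<in> A" "p \<in> fst c" using openin_carrier[OF U(1,4)] .
  show ?thesis unfolding cov_deriv_endo_def
    by (rule vsub_tspace[OF vfieldsD[OF D_vfields[OF U(1,2) smooth_endo_vfields[OF J U(1,3)]] U(4)]
          smooth_endo_tspace[OF J c vfieldsD[OF D_vfields[OF U(1,2,3)] U(4)]]])
qed

text \<open>The derivatives of the components of \<open>Y\<close> cancel, so that \<open>(\<nabla>\<^sub>XJ)Y\<close> depends on the values of \<open>X\<close> and
  \<open>Y\<close> at the point only.\<close>

lemma cov_deriv_local:
  assumes J: "smooth_endo A J" and U: "openin (mtop A) U" "X \<in> vfields A U" "Y \<in> vfields A U" "p \<in> U"
    and c: "c \<in> A" "p \<in> fst c"
  shows "cov_deriv_endo D J X Y p c = endo_deriv_comp A J c p (X p c) (Y p c)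
    + \<Gamma> c p (X p c) (endo_comp A J c p (Y p c)) - endo_comp A J c p (\<Gamma> c p (X p c) (Y p c))"
proof -
  let ?Y = "\<lambda>x. Y (param c x) c" and ?E = "\<lambda>x. endo_comp A J c (param c x)" and ?S = "snd c ` (U \<inter> fst c)"
  have o: "open ?S" by (rule open_chart_image[OF U(1) c(1)])
  have S: "snd c p \<in> ?S" using U(4) c(2) by auto
  have pc: "param c (snd c p) = p" by (rule param_chart[OF c])
  have E: "((\<lambda>x. ?E x a) has_derivative (\<lambda>v. endo_deriv_comp A J c p v a)) (at (snd c p))" for a
    unfolding endo_deriv_comp_def
    by (rule smooth_on_has_derivative[OF endo_comp_smooth[OF J c(1)]]) (use c(2) in auto)
  have d: "((\<lambda>x. ?E x (?Y x)) has_derivative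
      (\<lambda>v. endo_deriv_comp A J c p v (?Y (snd c p)) + ?E (snd c p) (frechet_derivative ?Y (at (snd c p)) v))) (at (snd c p))"
  proof (rule has_derivative_linear_family[where T = ?E, OF o S _ E])
    show "linear (?E x)" if "x \<in> ?S" for x
      using param_in[OF that c(1)] endo_comp_linear[OF J c(1)] by blast
    show "(?Y has_derivative frechet_derivative ?Y (at (snd c p))) (at (snd c p))"
      by (rule vfields_has_derivative[OF U(3) c(1) U(4) c(2)])
  qed
  have "((\<lambda>x. J (param c x) (Y (param c x)) c) has_derivative
      (\<lambda>v. endo_deriv_comp A J c p v (Y p c) + endo_comp A J c p (frechet_derivative ?Y (at (snd c p)) v))) (at (snd c p))"
  proof (rule has_derivative_transform_within_open[OF _ o S])
    show "?E x (?Y x) = J (param c x) (Y (param c x)) c" if "x \<in> ?S" for x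
      using param_in[OF that c(1)] endo_comp_apply[OF c(1) _ vfieldsD[OF U(3)], of _ J] by simp
  qed (use d pc in simp)
  from frechet_derivative_at[OF this]
  have "D X (\<lambda>q. J q (Y q)) p c = endo_deriv_comp A J c p (X p c) (Y p c)
      + endo_comp A J c p (frechet_derivative ?Y (at (snd c p)) (X p c)) + \<Gamma> c p (X p c) (endo_comp A J c p (Y p c))"
    unfolding D_local[OF U(1,2) smooth_endo_vfields[OF J U(1,3)] U(4) c]
    by (metis endo_comp_apply[OF c vfieldsD[OF U(3,4)]])
  moreover have "J p (D X Y p) c = endo_comp A J c p (frechet_derivative ?Y (at (snd c p)) (X p c))
      + endo_comp A J c p (\<Gamma> c p (X p c) (Y p c))"
    unfolding endo_comp_apply[OF c vfieldsD[OF D_vfields[OF U(1,2,3)] U(4)]] D_local[OF U c]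
    by (rule linear_add[OF endo_comp_linear[OF J c]])
  ultimately show ?thesis by (simp add: cov_deriv_endo_def vsub_def)
qed

end

text \<open>Torsion-freeness enters in three ways: it shows that the bracket of vector fields is a vector field, it makes
  the Christoffel symbols symmetric, and it removes the derivatives of the fields from the curvature.\<close>

locale torsion_free_connection = connection A D
  for A :: "('a, 'e::euclidean_space) chart set" and D +
  assumes torsion_free: "openin (mtop A) U \<Longrightarrow> X \<in> vfields A U \<Longrightarrow> Y \<in> vfields A U \<Longrightarrow> p \<in> U \<Longrightarrow>
    vsub (D X Y p) (D Y X p) = lie_bracket A X Y p"
begin

lemma lie_bracket_vfields:
  assumes U: "openin (mtop A) U" "X \<in> vfields A U" "Y \<in> vfields A U"
  shows "lie_bracket A X Y \<in> vfields A U"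
proof (rule vfieldsI)
  let ?Z = "\<lambda>q. vsub (D X Y q) (D Y X q)"
  have Z: "?Z \<in> vfields A U" by (intro vfields_vsub D_vfields U)
  show "lie_bracket A X Y p \<in> tspace A p" if "p \<in> U" for p
    using vfieldsD[OF Z that] torsion_free[OF U that] by simp
  show "smooth_on (snd c ` (U \<inter> fst c)) (\<lambda>x. lie_bracket A X Y (param c x) c)" if c: "c \<in> A" for c
    by (rule smooth_on_cong[OF open_chart_image[OF U(1) c] vfields_smooth[OF Z c]])
      (use param_in[OF _ c] torsion_free[OF U] in auto)
qed

text \<open>The coordinate fields of a chart have constant components there, hence their bracket is \<open>0\<close>.\<close>

lemma christoffel_sym:
  assumes c: "c \<in> A" "p \<in> fst c" shows "\<Gamma> c p a b = \<Gamma> c p b a"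
proof -
  have "frechet_derivative (\<lambda>x. coord_field A c b (param c x) c) (at (snd c p)) = (\<lambda>v. 0)" for b
  proof -
    have "((\<lambda>x. coord_field A c b (param c x) c) has_derivative (\<lambda>v. 0)) (at (snd c p))"
      by (rule has_derivative_transform_within_open[OF has_derivative_const[of b] open_image[OF c(1)]])
        (use c(2) in \<open>auto simp: coord_field_self[OF c(1)] param_chart[OF c(1)]\<close>)
    then show ?thesis by (rule frechet_derivative_at[symmetric])
  qed
  then have "lie_bracket A (coord_field A c a) (coord_field A c b) p c = 0"
    by (simp add: lie_bracket_def)
  then have "vsub (D (coord_field A c a) (coord_field A c b) p) (D (coord_field A c b) (coord_field A c a) p) c = 0"
    using torsion_free[OF openin_chart[OF c(1)] coord_field_vfields[OF c(1)] coord_field_vfields[OF c(1)] c(2)]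
    by simp
  then show ?thesis by (simp add: vsub_def christoffel_def)
qed

lemma curvature_tspace:
  assumes U: "openin (mtop A) U" "X \<in> vfields A U" "Y \<in> vfields A U" "Z \<in> vfields A U" "p \<in> U"
  shows "curvature A D X Y Z p \<in> tspace A p"
  unfolding curvature_def
  by (intro vsub_tspace vfieldsD[of _ U] D_vfields lie_bracket_vfields U)

lemma D_D_local:
  assumes U: "openin (mtop A) U" "X \<in> vfields A U" "Y \<in> vfields A U" "Z \<in> vfields A U" "p \<in> U"
    and c: "c \<in> A" "p \<in> fst c"
  defines "d W v \<equiv> frechet_derivative (\<lambda>x. W (param c x) c) (at (snd c p)) v"
    and "d\<Gamma> v a b \<equiv> frechet_derivative (\<lambda>x. \<Gamma> c (param c x) a b) (at (snd c p)) v"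
  shows "D X (D Y Z) p c =
    frechet_derivative (\<lambda>x. frechet_derivative (\<lambda>x. Z (param c x) c) (at x) (Y p c)) (at (snd c p)) (X p c)
    + d Z (d Y (X p c)) + d\<Gamma> (X p c) (Y p c) (Z p c) + \<Gamma> c p (Y p c) (d Z (X p c)) + \<Gamma> c p (d Y (X p c)) (Z p c)
    + \<Gamma> c p (X p c) (d Z (Y p c)) + \<Gamma> c p (X p c) (\<Gamma> c p (Y p c) (Z p c))"
proof -
  let ?Y = "\<lambda>x. Y (param c x) c" and ?Z = "\<lambda>x. Z (param c x) c" and ?S = "snd c ` (U \<inter> fst c)"
  let ?G = "\<lambda>x. \<Gamma> c (param c x)" and ?x = "snd c p"
  have o: "open ?S" by (rule open_chart_image[OF U(1) c(1)])
  have S: "?x \<in> ?S" using U(5) c(2) by auto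
  have pc: "param c ?x = p" by (rule param_chart[OF c])
  have Sc: "param c x \<in> U" "param c x \<in> fst c" "snd c (param c x) = x" if "x \<in> ?S" for x
    using param_in[OF that c(1)] that chart_param[OF c(1)] by auto
  note Yd = vfields_has_derivative[OF U(3) c(1) U(5) c(2)] and Zd = vfields_has_derivative[OF U(4) c(1) U(5) c(2)]
  have "((\<lambda>x. frechet_derivative ?Z (at x) (?Y x)) has_derivative
      (\<lambda>v. frechet_derivative (\<lambda>x. frechet_derivative ?Z (at x) (?Y ?x)) (at ?x) v
        + frechet_derivative ?Z (at ?x) (frechet_derivative ?Y (at ?x) v))) (at ?x)"
  proof (rule has_derivative_linear_family[where T = "\<lambda>x. frechet_derivative ?Z (at x)", OF o S _ _ Yd])
    show "linear (frechet_derivative ?Z (at x))" if "x \<in> ?S" for x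
      by (rule linear_frechet_derivative[OF smooth_on_differentiable[OF vfields_smooth[OF U(4) c(1)] that]])
    show "((\<lambda>x. frechet_derivative ?Z (at x) a) has_derivative
        frechet_derivative (\<lambda>x. frechet_derivative ?Z (at x) a) (at ?x)) (at ?x)" for a
      by (rule smooth_on_has_derivative[OF smooth_on_frechet_derivative[OF vfields_smooth[OF U(4) c(1)]] S])
  qed
  moreover have "((\<lambda>x. ?G x (?Y x) (?Z x)) has_derivative
      (\<lambda>v. (d\<Gamma> v (?Y ?x) (?Z ?x) + ?G ?x (?Y ?x) (frechet_derivative ?Z (at ?x) v))
         + ?G ?x (frechet_derivative ?Y (at ?x) v) (?Z ?x))) (at ?x)"
  proof (rule has_derivative_linear_family[where T = "\<lambda>x b. ?G x b (?Z x)", OF o S _ _ Yd])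
    show "linear (\<lambda>b. ?G x b (?Z x))" if "x \<in> ?S" for x
      by (rule christoffel_linear(1)[OF c(1) Sc(2)[OF that]])
    show "((\<lambda>x. ?G x a (?Z x)) has_derivative
        (\<lambda>v. d\<Gamma> v a (?Z ?x) + ?G ?x a (frechet_derivative ?Z (at ?x) v))) (at ?x)" for a
    proof (rule has_derivative_linear_family[where T = "\<lambda>x. ?G x a", OF o S _ _ Zd])
      show "linear (?G x a)" if "x \<in> ?S" for x
        by (rule christoffel_linear(2)[OF c(1) Sc(2)[OF that]])
      show "((\<lambda>x. ?G x a b) has_derivative (\<lambda>v. d\<Gamma> v a b)) (at ?x)" for b
        unfolding d\<Gamma>_def by (rule smooth_on_has_derivative[OF christoffel_smooth[OF c(1)]]) (use c(2) in auto)
    qed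
  qed
  ultimately have "((\<lambda>x. frechet_derivative ?Z (at x) (?Y x) + ?G x (?Y x) (?Z x)) has_derivative
     (\<lambda>v. (frechet_derivative (\<lambda>x. frechet_derivative ?Z (at x) (?Y ?x)) (at ?x) v
        + frechet_derivative ?Z (at ?x) (frechet_derivative ?Y (at ?x) v))
       + ((d\<Gamma> v (?Y ?x) (?Z ?x) + ?G ?x (?Y ?x) (frechet_derivative ?Z (at ?x) v))
         + ?G ?x (frechet_derivative ?Y (at ?x) v) (?Z ?x)))) (at ?x)"
    by (rule has_derivative_add)
  then have "((\<lambda>x. D Y Z (param c x) c) has_derivative
     (\<lambda>v. (frechet_derivative (\<lambda>x. frechet_derivative ?Z (at x) (?Y ?x)) (at ?x) v
        + frechet_derivative ?Z (at ?x) (frechet_derivative ?Y (at ?x) v))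
       + ((d\<Gamma> v (?Y ?x) (?Z ?x) + ?G ?x (?Y ?x) (frechet_derivative ?Z (at ?x) v))
         + ?G ?x (frechet_derivative ?Y (at ?x) v) (?Z ?x)))) (at ?x)"
    by (rule has_derivative_transform_within_open[OF _ o S])
      (simp add: D_local[OF U(1,3,4) Sc(1) c(1) Sc(2)] Sc(3))
  from fun_cong[OF frechet_derivative_at[OF this, symmetric], of "X p c"]
  have "frechet_derivative (\<lambda>x. D Y Z (param c x) c) (at ?x) (X p c) =
    (frechet_derivative (\<lambda>x. frechet_derivative ?Z (at x) (Y p c)) (at ?x) (X p c) + d Z (d Y (X p c)))
    + ((d\<Gamma> (X p c) (Y p c) (Z p c) + \<Gamma> c p (Y p c) (d Z (X p c))) + \<Gamma> c p (d Y (X p c)) (Z p c))"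
    unfolding pc d_def .
  moreover have "\<Gamma> c p (X p c) (D Y Z p c) = \<Gamma> c p (X p c) (d Z (Y p c)) + \<Gamma> c p (X p c) (\<Gamma> c p (Y p c) (Z p c))"
    unfolding D_local[OF U(1,3,4,5) c] d_def by (rule linear_add[OF christoffel_linear(2)[OF c]])
  ultimately show ?thesis
    unfolding D_local[OF U(1,2) D_vfields[OF U(1,3,4)] U(5) c] by (simp add: add.assoc)
qed

text \<open>In the difference of the two iterated derivatives, the second derivatives of \<open>Z\<close> cancel by symmetry and the
  terms with a first derivative of \<open>X\<close> or \<open>Y\<close> cancel against the bracket term.\<close>

lemma curvature_local:
  assumes U: "openin (mtop A) U" "X \<in> vfields A U" "Y \<in> vfields A U" "Z \<in> vfields A U" "p \<in> U"
    and c: "c \<in> A" "p \<in> fst c"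
  shows "curvature A D X Y Z p c = curv_comp A D c p (X p c) (Y p c) (Z p c)"
proof -
  let ?d = "\<lambda>W. frechet_derivative (\<lambda>x. W (param c x) c) (at (snd c p))"
  let ?S = "snd c ` (U \<inter> fst c)"
  have S: "snd c p \<in> ?S" using U(5) c(2) by auto
  have L: "linear (?d Z)"
    by (rule linear_frechet_derivative[OF smooth_on_differentiable[OF vfields_smooth[OF U(4) c(1)] S]])
  have s: "frechet_derivative (\<lambda>x. frechet_derivative (\<lambda>x. Z (param c x) c) (at x) (Y p c)) (at (snd c p)) (X p c)
    = frechet_derivative (\<lambda>x. frechet_derivative (\<lambda>x. Z (param c x) c) (at x) (X p c)) (at (snd c p)) (Y p c)"
    by (rule second_derivative_symmetric[OF open_chart_image[OF U(1) c(1)] vfields_smooth[OF U(4) c(1)] S])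
  have b: "lie_bracket A X Y p c = ?d Y (X p c) - ?d X (Y p c)"
    using c by (simp add: lie_bracket_def)
  have "D (lie_bracket A X Y) Z p c = ?d Z (?d Y (X p c)) - ?d Z (?d X (Y p c))
     + \<Gamma> c p (?d Y (X p c)) (Z p c) - \<Gamma> c p (?d X (Y p c)) (Z p c)"
    unfolding D_local[OF U(1) lie_bracket_vfields[OF U(1,2,3)] U(4,5) c] b
      linear_diff[OF L] linear_diff[OF christoffel_linear(1)[OF c]] by simp
  then show ?thesis
    unfolding curvature_def vsub_def D_D_local[OF U c] D_D_local[OF U(1,3,2,4,5) c] s curv_comp_def
    by simp
qed

lemma flat_iff_curv_comp:
  "flat A D \<longleftrightarrow> (\<forall>c\<in>A. \<forall>p\<in>fst c. \<forall>a b z. curv_comp A D c p a b z = 0)"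
proof
  assume f: "flat A D"
  show "\<forall>c\<in>A. \<forall>p\<in>fst c. \<forall>a b z. curv_comp A D c p a b z = 0"
  proof (intro ballI allI)
    fix c p a b z assume c: "c \<in> A" "p \<in> fst c"
    note cf = openin_chart[OF c(1)] coord_field_vfields[OF c(1)] coord_field_vfields[OF c(1)] coord_field_vfields[OF c(1)]
    have "curvature A D (coord_field A c a) (coord_field A c b) (coord_field A c z) p = vzero"
      using f cf c(2) unfolding flat_def by blast
    then show "curv_comp A D c p a b z = 0"
      using curvature_local[OF cf c(2) c, of a b z] coord_field_self[OF c] by (simp add: vzero_def)
  qed
next
  assume z: "\<forall>c\<in>A. \<forall>p\<in>fst c. \<forall>a b z. curv_comp A D c p a b z = 0"
  show "flat A D" unfolding flat_def
  proof (intro allI impI ballI)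
    fix U X Y Z p
    assume "openin (mtop A) U \<and> X \<in> vfields A U \<and> Y \<in> vfields A U \<and> Z \<in> vfields A U" and p: "p \<in> U"
    then have U: "openin (mtop A) U" "X \<in> vfields A U" "Y \<in> vfields A U" "Z \<in> vfields A U" by auto
    obtain c where c: "c \<in> A" "p \<in> fst c" using openin_carrier[OF U(1) p] .
    show "curvature A D X Y Z p = vzero"
      unfolding tspace_eq_vzero_iff[OF curvature_tspace[OF U p] c] curvature_local[OF U p c] using z c by blast
  qed
qed

definition cov_endo_comp :: "('a, 'e) endo \<Rightarrow> ('a, 'e) chart \<Rightarrow> 'a \<Rightarrow> 'e \<Rightarrow> 'e \<Rightarrow> 'e" where
  "cov_endo_comp J c p a b = endo_deriv_comp A J c p a b + \<Gamma> c p a (endo_comp A J c p b) - endo_comp A J c p (\<Gamma> c p a b)"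

lemma skew_kaehler_base_iff:
  assumes J: "smooth_endo A J"
  shows "skew_kaehler_base A J D \<longleftrightarrow> (\<forall>c\<in>A. \<forall>p\<in>fst c. \<forall>a b. cov_endo_comp J c p a b = 0)"
proof
  assume f: "skew_kaehler_base A J D"
  show "\<forall>c\<in>A. \<forall>p\<in>fst c. \<forall>a b. cov_endo_comp J c p a b = 0"
  proof (intro ballI allI)
    fix c p a b assume c: "c \<in> A" "p \<in> fst c"
    note cf = openin_chart[OF c(1)] coord_field_vfields[OF c(1)] coord_field_vfields[OF c(1)]
    have "cov_deriv_endo D J (coord_field A c a) (coord_field A c b) p = vzero"
      using f cf c(2) unfolding skew_kaehler_base_def by blast
    then show "cov_endo_comp J c p a b = 0"
      using cov_deriv_local[OF J cf c(2) c, of a b] coord_field_self[OF c] by (simp add: vzero_def cov_endo_comp_def)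
  qed
next
  assume z: "\<forall>c\<in>A. \<forall>p\<in>fst c. \<forall>a b. cov_endo_comp J c p a b = 0"
  show "skew_kaehler_base A J D" unfolding skew_kaehler_base_def
  proof (intro allI impI ballI)
    fix U X Y p
    assume "openin (mtop A) U \<and> X \<in> vfields A U \<and> Y \<in> vfields A U" and p: "p \<in> U"
    then have U: "openin (mtop A) U" "X \<in> vfields A U" "Y \<in> vfields A U" by auto
    obtain c where c: "c \<in> A" "p \<in> fst c" using openin_carrier[OF U(1) p] .
    show "cov_deriv_endo D J X Y p = vzero"
      unfolding tspace_eq_vzero_iff[OF cov_deriv_tspace[OF J U p] c] cov_deriv_local[OF J U p c]
        cov_endo_comp_def[symmetric] using z c by blast
  qed
qed

text \<open>A parallel \<open>J\<close> can be moved out of each covariant derivative in \<open>R(X, Y)(J Z)\<close>. The field \<open>J Z\<close> is in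
  general no coordinate field, so the result is translated to components by the tensoriality of the curvature.\<close>

lemma curv_comp_commutes_parallel_endo:
  assumes J: "smooth_endo A J" and par: "skew_kaehler_base A J D" and c: "c \<in> A" "p \<in> fst c"
  shows "curv_comp A D c p a b (endo_comp A J c p z) = endo_comp A J c p (curv_comp A D c p a b z)"
proof -
  note o = openin_chart[OF c(1)] and cf = coord_field_vfields[OF c(1)]
  let ?X = "coord_field A c a" and ?Y = "coord_field A c b" and ?Z = "coord_field A c z"
  have swap: "D W (\<lambda>q. J q (V q)) r = J r (D W V r)"
    if "W \<in> vfields A (fst c)" "V \<in> vfields A (fst c)" "r \<in> fst c" for W V r
  proof -
    have "cov_deriv_endo D J W V r = vzero" using par o that unfolding skew_kaehler_base_def by blast
    then show ?thesis by (auto simp: cov_deriv_endo_def vsub_def vzero_def fun_eq_iff)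
  qed
  note Jv = smooth_endo_vfields[OF J o] and Dv = D_vfields[OF o]
  have swap2: "D W (D V (\<lambda>q. J q (?Z q))) p = J p (D W (D V ?Z) p)"
    if "W \<in> vfields A (fst c)" "V \<in> vfields A (fst c)" for W V
  proof -
    have "D W (D V (\<lambda>q. J q (?Z q))) p = D W (\<lambda>q. J q (D V ?Z q)) p"
      by (rule D_cong[OF o c(2) that(1,1) refl Dv[OF that(2) Jv[OF cf]] Jv[OF Dv[OF that(2) cf]] swap[OF that(2) cf]])
    then show ?thesis using swap[OF that(1) Dv[OF that(2) cf] c(2)] by simp
  qed
  have sub: "J p (vsub u v) = vsub (J p u) (J p v)" if "u \<in> tspace A p" "v \<in> tspace A p" for u v
    using smooth_endo_linear[OF J c that(2,1), of "-1"] by (simp add: vadd_def vsub_def vscale_def)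
  note t = vfieldsD[OF _ c(2)]
  have "curvature A D ?X ?Y (\<lambda>q. J q (?Z q)) p = J p (curvature A D ?X ?Y ?Z p)"
    unfolding curvature_def swap2[OF cf cf] swap[OF lie_bracket_vfields[OF o cf cf] cf c(2)]
      sub[OF vsub_tspace[OF t[OF Dv[OF cf Dv[OF cf cf]]] t[OF Dv[OF cf Dv[OF cf cf]]]]
        t[OF Dv[OF lie_bracket_vfields[OF o cf cf] cf]]]
      sub[OF t[OF Dv[OF cf Dv[OF cf cf]]] t[OF Dv[OF cf Dv[OF cf cf]]]] ..
  from fun_cong[OF this, of c]
  show ?thesis
    unfolding curvature_local[OF o cf cf Jv[OF cf] c(2) c] endo_comp_apply[OF c curvature_tspace[OF o cf cf cf c(2)]]
      curvature_local[OF o cf cf cf c(2) c] endo_comp_apply[OF c coord_field_tspace[OF c]] coord_field_self[OF c] .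
qed

end

section \<open>The tangent bundle as a manifold\<close>

lemma smooth_on_fst_compose:
  fixes f :: "'e::euclidean_space \<Rightarrow> 'f::real_normed_vector"
  assumes "open S" "smooth_on S f"
  shows "smooth_on (S \<times> (UNIV :: 'd::euclidean_space set)) (\<lambda>z. f (fst z))"
proof (rule smooth_on_compose[OF assms(2) _ _ assms(1)])
  have o: "open (S \<times> (UNIV :: 'd set))" by (rule open_Times[OF assms(1) open_UNIV])
  then show "open (S \<times> (UNIV :: 'd set))" .
  show "smooth_on (S \<times> (UNIV :: 'd set)) (\<lambda>z. fst z)"
    by (rule smooth_on_linear[OF o linear_fst smooth_on_ident[OF o]])
qed auto

lemma smooth_on_snd:
  assumes "open S" shows "smooth_on (S :: ('e::euclidean_space \<times> 'd::euclidean_space) set) (\<lambda>z. snd z)"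
  by (rule smooth_on_linear[OF assms linear_snd smooth_on_ident[OF assms]])

context smooth_atlas
begin

abbreviation bundle_chart :: "('a, 'e) chart \<Rightarrow> ('a \<times> ('a, 'e) tvec, 'e \<times> 'e) chart" where
  "bundle_chart \<equiv> induced_chart A"

lemma mem_bundle_chart: "q \<in> fst (bundle_chart c) \<longleftrightarrow> fst q \<in> fst c \<and> snd q \<in> tspace A (fst q)"
  by (auto simp: induced_chart_def)

lemma bundle_chart_apply: "snd (bundle_chart c) q = (snd c (fst q), snd q c)"
  by (auto simp: induced_chart_def split: prod.split)

lemma bundle_chart_image:
  assumes "c \<in> A" "U \<subseteq> fst c"
  shows "snd (bundle_chart c) ` {q. fst q \<in> U \<and> snd q \<in> tspace A (fst q)} = (snd c ` U) \<times> UNIV"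
proof (intro set_eqI iffI)
  fix z :: "'e \<times> 'e" assume "z \<in> (snd c ` U) \<times> UNIV"
  then obtain p y where z: "p \<in> U" "z = (snd c p, y)" by auto
  then have "z = snd (bundle_chart c) (p, coord_field A c y p)"
    using assms by (simp add: bundle_chart_apply coord_field_self subset_iff)
  then show "z \<in> snd (bundle_chart c) ` {q. fst q \<in> U \<and> snd q \<in> tspace A (fst q)}"
    using z(1) assms coord_field_tspace[of c p y] by (auto simp: subset_iff)
qed (auto simp: bundle_chart_apply)

lemma bundle_chart_full_image:
  "c \<in> A \<Longrightarrow> snd (bundle_chart c) ` fst (bundle_chart c) = (snd c ` fst c) \<times> UNIV"
  using bundle_chart_image[OF _ subset_refl] mem_bundle_chart by (metis (no_types, lifting) Collect_cong Collect_mem_eq)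

lemma bundle_chart_overlap_image:
  assumes "c \<in> A"
  shows "snd (bundle_chart c) ` (fst (bundle_chart c) \<inter> fst (bundle_chart c')) = (snd c ` (fst c \<inter> fst c')) \<times> UNIV"
proof -
  have "fst (bundle_chart c) \<inter> fst (bundle_chart c') =
      {q. fst q \<in> fst c \<inter> fst c' \<and> snd q \<in> tspace A (fst q)}"
    using mem_bundle_chart[of _ c] mem_bundle_chart[of _ c'] by blast
  then show ?thesis using bundle_chart_image[OF assms, of "fst c \<inter> fst c'"] by simp
qed

lemma inj_bundle_chart: "c \<in> A \<Longrightarrow> inj_on (snd (bundle_chart c)) (fst (bundle_chart c))"
proof (rule inj_onI)
  fix q q' assume c: "c \<in> A" and q: "q \<in> fst (bundle_chart c)" "q' \<in> fst (bundle_chart c)"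
    and "snd (bundle_chart c) q = snd (bundle_chart c) q'"
  then have e: "snd c (fst q) = snd c (fst q')" "snd q c = snd q' c" by (auto simp: bundle_chart_apply)
  note q = q[unfolded mem_bundle_chart]
  have p: "fst q = fst q'" using inj_onD[OF inj_chart[OF c] e(1)] q by blast
  have "snd q = snd q'" by (rule tspace_eqI[of _ "fst q" _ c]) (use q p c e in auto)
  with p show "q = q'" by (simp add: prod_eq_iff)
qed

lemma param_bundle_chart:
  assumes "c \<in> A" "x \<in> snd c ` fst c"
  shows "param (bundle_chart c) (x, y) = (param c x, coord_field A c y (param c x))"
proof -
  have p: "param c x \<in> fst c" "snd c (param c x) = x"
    using param_in[of x c UNIV] chart_param assms by auto
  show ?thesis unfolding param_def[of "bundle_chart c"]
  proof (rule inv_into_f_eq[OF inj_bundle_chart[OF assms(1)]])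
    show "(param c x, coord_field A c y (param c x)) \<in> fst (bundle_chart c)"
      using p assms(1) coord_field_tspace by (simp add: mem_bundle_chart)
    show "snd (bundle_chart c) (param c x, coord_field A c y (param c x)) = (x, y)"
      using p assms(1) by (simp add: bundle_chart_apply coord_field_self)
  qed
qed

lemma transition_bundle_chart:
  assumes "c \<in> A" "c' \<in> A" "z \<in> (snd c ` (fst c \<inter> fst c')) \<times> UNIV"
  shows "transition (bundle_chart c) (bundle_chart c') z
    = (transition c c' (fst z), frechet_derivative (transition c c') (at (fst z)) (snd z))"
proof -
  obtain p where p: "p \<in> fst c" "p \<in> fst c'" "fst z = snd c p" using assms(3) by auto
  then have "transition (bundle_chart c) (bundle_chart c') z =
      (transition c c' (fst z), coord_field A c (snd z) p c')"
    using param_bundle_chart[OF assms(1), of "fst z" "snd z"] assms(1)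
    by (cases z) (simp add: transition_def bundle_chart_apply param_chart)
  then show ?thesis using assms p by (simp add: coord_field_def)
qed

lemma smooth_atlas_tangent_bundle: "smooth_atlas (tangent_bundle A)"
proof
  fix c assume "c \<in> tangent_bundle A"
  then obtain d where d: "d \<in> A" "c = bundle_chart d" by (auto simp: tangent_bundle_def)
  show "inj_on (snd c) (fst c)" using inj_bundle_chart d by simp
  show "open (snd c ` fst c)" using bundle_chart_full_image[OF d(1)] d open_image
    by (simp add: open_Times)
  fix c' assume "c' \<in> tangent_bundle A"
  then obtain d' where d': "d' \<in> A" "c' = bundle_chart d'" by (auto simp: tangent_bundle_def)
  let ?S = "snd d ` (fst d \<inter> fst d')"
  have o: "open ?S" by (rule open_overlap[OF d(1) d'(1)])
  have im: "snd c ` (fst c \<inter> fst c') = ?S \<times> UNIV" using bundle_chart_overlap_image d d' by simp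
  show oS: "open (snd c ` (fst c \<inter> fst c'))" unfolding im by (rule open_Times[OF o open_UNIV])
  let ?t = "transition d d'"
  show "smooth_on (snd c ` (fst c \<inter> fst c')) (transition c c')"
  proof (rule smooth_on_cong[OF oS])
    show "smooth_on (snd c ` (fst c \<inter> fst c')) (\<lambda>z. (?t (fst z), frechet_derivative ?t (at (fst z)) (snd z)))"
      unfolding im
    proof (intro smooth_on_Pair oS[unfolded im] smooth_on_fst_compose[OF o smooth_transition[OF d(1) d'(1)]])
      show "smooth_on (?S \<times> UNIV) (\<lambda>z. frechet_derivative ?t (at (fst z)) (snd z))"
      proof (rule smooth_on_linear_family[where T = "\<lambda>z. frechet_derivative ?t (at (fst z))" and f = snd,
            OF oS[unfolded im] _ _ smooth_on_snd[OF oS[unfolded im]]])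
        show "linear (frechet_derivative ?t (at (fst z)))" if "z \<in> ?S \<times> UNIV" for z
          using that linear_transition_derivative[OF d(1) d'(1)] by auto
        show "smooth_on (?S \<times> UNIV) (\<lambda>z. frechet_derivative ?t (at (fst z)) a)" for a
          by (rule smooth_on_fst_compose[OF o smooth_on_frechet_derivative[OF smooth_transition[OF d(1) d'(1)]]])
      qed
    qed
    show "(?t (fst z), frechet_derivative ?t (at (fst z)) (snd z)) = transition c c' z"
      if "z \<in> snd c ` (fst c \<inter> fst c')" for z
      unfolding d(2) d'(2) by (rule transition_bundle_chart[OF d(1) d'(1), symmetric]) (use that im in simp)
  qed
qed

text \<open>Bundle charts are related by \<open>(x, y) \<mapsto> (\<tau> x, d\<tau>\<^sub>x y)\<close>. The second derivative of \<open>\<tau>\<close> that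
  appears here is the inhomogeneous term in the transformation law of the Christoffel symbols.\<close>

lemma transition_bundle_chart_derivative:
  assumes c: "c \<in> A" "c' \<in> A" and p: "p \<in> fst c" "p \<in> fst c'"
  shows "frechet_derivative (transition (bundle_chart c) (bundle_chart c')) (at (snd c p, y)) (a, b) =
    (frechet_derivative (transition c c') (at (snd c p)) a,
     frechet_derivative (\<lambda>x. frechet_derivative (transition c c') (at x) y) (at (snd c p)) a
     + frechet_derivative (transition c c') (at (snd c p)) b)"
proof -
  let ?S = "snd c ` (fst c \<inter> fst c')" and ?t = "transition c c'"
  have o: "open (?S \<times> (UNIV :: 'e set))" by (rule open_Times[OF open_overlap[OF c] open_UNIV])
  have z: "(snd c p, y) \<in> ?S \<times> UNIV" using p by auto
  have df: "(fst has_derivative fst) (at (snd c p, y))" "(snd has_derivative snd) (at (snd c p, y))"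
    by (rule has_derivative_fst[OF has_derivative_ident] has_derivative_snd[OF has_derivative_ident])+
  have xS: "snd c p \<in> ?S" using p by auto
  have d1: "((\<lambda>z. ?t (fst z)) has_derivative (\<lambda>v. frechet_derivative ?t (at (snd c p)) (fst v))) (at (snd c p, y))"
    using has_derivative_compose[where g = ?t, OF df(1)] transition_has_derivative[OF c p] by simp
  have d2: "((\<lambda>z. frechet_derivative ?t (at (fst z)) (snd z)) has_derivative
      (\<lambda>v. frechet_derivative (\<lambda>x. frechet_derivative ?t (at x) (snd (snd c p, y))) (at (snd c p)) (fst v)
        + frechet_derivative ?t (at (fst (snd c p, y))) (snd v))) (at (snd c p, y))"
  proof (rule has_derivative_linear_family[where T = "\<lambda>z. frechet_derivative ?t (at (fst z))", OF o z _ _ df(2)])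
    show "linear (frechet_derivative ?t (at (fst z)))" if "z \<in> ?S \<times> UNIV" for z :: "'e \<times> 'e"
      using that linear_transition_derivative[OF c] by auto
    show "((\<lambda>z. frechet_derivative ?t (at (fst z)) a) has_derivative
        (\<lambda>v. frechet_derivative (\<lambda>x. frechet_derivative ?t (at x) a) (at (snd c p)) (fst v))) (at (snd c p, y))" for a
      using has_derivative_compose[where g = "\<lambda>x. frechet_derivative ?t (at x) a", OF df(1)]
        smooth_on_has_derivative[OF smooth_on_frechet_derivative[OF smooth_transition[OF c]] xS] by simp
  qed
  have "(transition (bundle_chart c) (bundle_chart c') has_derivative
     (\<lambda>v. (frechet_derivative ?t (at (snd c p)) (fst v),
      frechet_derivative (\<lambda>x. frechet_derivative ?t (at x) (snd (snd c p, y))) (at (snd c p)) (fst v)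
        + frechet_derivative ?t (at (fst (snd c p, y))) (snd v)))) (at (snd c p, y))"
    by (rule has_derivative_transform_within_open[OF has_derivative_Pair[OF d1 d2] o z])
      (rule transition_bundle_chart[OF c, symmetric])
  from fun_cong[OF frechet_derivative_at[OF this, symmetric], of "(a, b)"] show ?thesis by simp
qed

end

section \<open>Lifts and the adapted frame\<close>

locale base_manifold = torsion_free_connection M D
  for M :: "('a, 'e::euclidean_space) chart set" and D
begin

sublocale TM: smooth_atlas "tangent_bundle M" by (rule smooth_atlas_tangent_bundle)

lemma bundle_chart_in: "c \<in> M \<Longrightarrow> bundle_chart c \<in> tangent_bundle M"
  by (simp add: tangent_bundle_def)

text \<open>The derivative \<open>\<nabla>\<^sub>a\<partial>\<^sub>b\<close> of coordinate fields of \<open>c\<close> is a tangent vector; its components in \<open>c'\<close> are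
  computed once from those in \<open>c\<close> and once by \<open>D_local\<close> in \<open>c'\<close>.\<close>

lemma christoffel_transformation:
  assumes c: "c \<in> M" "c' \<in> M" and p: "p \<in> fst c" "p \<in> fst c'"
  defines "d \<equiv> frechet_derivative (transition c c') (at (snd c p))"
  shows "\<Gamma> c' p (d a) (d b) =
    d (\<Gamma> c p a b) - frechet_derivative (\<lambda>x. frechet_derivative (transition c c') (at x) b) (at (snd c p)) a"
proof -
  note cf = openin_chart[OF c(1)] coord_field_vfields[OF c(1)] coord_field_vfields[OF c(1)]
  have comp: "coord_field M c v p c' = d v" for v using c p by (simp add: coord_field_def d_def)
  let ?b = "\<lambda>x. coord_field M c b (param c' x) c'"
  let ?S = "snd c ` (fst c \<inter> fst c')"
  have "(?b has_derivative frechet_derivative ?b (at (snd c' p))) (at (snd c' p))"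
    by (rule vfields_has_derivative[OF cf(2) c(2) p])
  from has_derivative_change_chart[where f = "\<lambda>q. coord_field M c b q c'", OF c p this]
  have "((\<lambda>x. frechet_derivative (transition c c') (at x) b) has_derivative
      (\<lambda>v. frechet_derivative ?b (at (snd c' p)) (d v))) (at (snd c p))"
    unfolding d_def
    by (rule has_derivative_transform_within_open[OF _ open_overlap[OF c]])
      (use p in \<open>auto simp: param_chart[OF c(1)] coord_field_def c\<close>)
  from frechet_derivative_at[OF this]
  have e: "frechet_derivative (\<lambda>x. frechet_derivative (transition c c') (at x) b) (at (snd c p)) a
    = frechet_derivative ?b (at (snd c' p)) (d a)" by metis
  have "D (coord_field M c a) (coord_field M c b) p c' = d (\<Gamma> c p a b)"
    unfolding christoffel_def d_def by (rule tspaceD[OF vfieldsD[OF D_vfields[OF cf] p(1)] c p])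
  moreover have "D (coord_field M c a) (coord_field M c b) p c' =
      frechet_derivative ?b (at (snd c' p)) (d a) + \<Gamma> c' p (d a) (d b)"
    unfolding D_local[OF cf p(1) c(2) p(2)] comp ..
  ultimately have "d (\<Gamma> c p a b) = frechet_derivative ?b (at (snd c' p)) (d a) + \<Gamma> c' p (d a) (d b)"
    by (rule trans[OF sym])
  then show ?thesis unfolding e by simp
qed

text \<open>With respect to the bundle chart, \<open>(a, a' - \<Gamma>(y, a))\<close> are the components of \<open>a\<^sup>H + a'\<^sup>V\<close>; the map
  \<open>frame_coeff\<close> recovers \<open>(a, a')\<close> from them.\<close>

definition frame_comp :: "('a, 'e) chart \<Rightarrow> 'a \<times> ('a, 'e) tvec \<Rightarrow> 'e \<times> 'e \<Rightarrow> 'e \<times> 'e" where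
  "frame_comp c q v = (fst v, snd v - \<Gamma> c (fst q) (snd q c) (fst v))"

definition frame_coeff :: "('a, 'e) chart \<Rightarrow> 'a \<times> ('a, 'e) tvec \<Rightarrow> 'e \<times> 'e \<Rightarrow> 'e \<times> 'e" where
  "frame_coeff c q v = (fst v, snd v + \<Gamma> c (fst q) (snd q c) (fst v))"

text \<open>Defined through one chart; \<open>frame_other_chart\<close> identifies it with \<open>a\<^sup>H + a'\<^sup>V\<close>.\<close>

definition frame :: "('a, 'e) chart \<Rightarrow> 'e \<times> 'e \<Rightarrow> 'a \<times> ('a, 'e) tvec \<Rightarrow> ('a \<times> ('a, 'e) tvec, 'e \<times> 'e) tvec" where
  "frame c v q = coord_field (tangent_bundle M) (bundle_chart c) (frame_comp c q v) q"

lemma frame_coeff_comp [simp]: "frame_coeff c q (frame_comp c q v) = v"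
  and frame_comp_coeff [simp]: "frame_comp c q (frame_coeff c q v) = v"
  by (simp_all add: frame_coeff_def frame_comp_def)

lemma frame_comp_linear:
  assumes "c \<in> M" "q \<in> fst (bundle_chart c)"
  shows "linear (frame_comp c q)" "linear (frame_coeff c q)"
proof -
  note l = christoffel_linear(2)[OF assms(1), of "fst q" "snd q c"]
  have p: "fst q \<in> fst c" using assms by (simp add: mem_bundle_chart)
  show "linear (frame_comp c q)" "linear (frame_coeff c q)"
    by (rule linearI; simp add: frame_comp_def frame_coeff_def linear_add[OF l[OF p]] linear_cmul[OF l[OF p]]
        algebra_simps)+
qed

lemma frame_tspace: "c \<in> M \<Longrightarrow> q \<in> fst (bundle_chart c) \<Longrightarrow> frame c v q \<in> tspace (tangent_bundle M) q"
  unfolding frame_def by (rule TM.coord_field_tspace[OF bundle_chart_in])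

lemma frame_self: "c \<in> M \<Longrightarrow> q \<in> fst (bundle_chart c) \<Longrightarrow> frame c v q (bundle_chart c) = frame_comp c q v"
  unfolding frame_def by (rule TM.coord_field_self[OF bundle_chart_in])

lemma frame_of_coeff:
  assumes "c \<in> M" "q \<in> fst (bundle_chart c)" "\<xi> \<in> tspace (tangent_bundle M) q"
  shows "frame c (frame_coeff c q (\<xi> (bundle_chart c))) q = \<xi>"
  by (rule TM.tspace_eqI[OF frame_tspace[OF assms(1,2)] assms(3) bundle_chart_in[OF assms(1)] assms(2)])
    (simp add: frame_self[OF assms(1,2)])

lemma frame_inject:
  "c \<in> M \<Longrightarrow> q \<in> fst (bundle_chart c) \<Longrightarrow> frame c v q = frame c w q \<longleftrightarrow> v = w"
  using frame_self frame_coeff_comp by metis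

lemma frame_eqI:
  assumes "c \<in> M" "q \<in> fst (bundle_chart c)" "\<xi> \<in> tspace (tangent_bundle M) q" "\<xi> (bundle_chart c) = frame_comp c q v"
  shows "\<xi> = frame c v q"
  by (rule TM.tspace_eqI[OF assms(3) frame_tspace[OF assms(1,2)] bundle_chart_in[OF assms(1)] assms(2)])
    (simp add: assms frame_self[OF assms(1,2)])

text \<open>Lifts are prescribed by components in all bundle charts, and a tangent vector is determined by its
  components in one of them. So it suffices that a frame vector has the prescribed components.\<close>

lemma the_prescribed_vector:
  assumes c: "c \<in> M" and q: "q \<in> fst (bundle_chart c)"
    and f: "\<And>c'. c' \<in> M \<Longrightarrow> fst q \<in> fst c' \<Longrightarrow> frame c v q (bundle_chart c') = f c'"
  shows "(THE \<xi>. \<xi> \<in> tspace (tangent_bundle M) q \<and> (\<forall>c\<in>M. fst q \<in> fst c \<longrightarrow> \<xi> (bundle_chart c) = f c)) = frame c v q"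
proof (rule the_equality)
  show "frame c v q \<in> tspace (tangent_bundle M) q \<and> (\<forall>c'\<in>M. fst q \<in> fst c' \<longrightarrow> frame c v q (bundle_chart c') = f c')"
    using frame_tspace[OF c q] f by blast
  fix \<xi> assume "\<xi> \<in> tspace (tangent_bundle M) q \<and> (\<forall>c\<in>M. fst q \<in> fst c \<longrightarrow> \<xi> (bundle_chart c) = f c)"
  then show "\<xi> = frame c v q"
    using frame_eqI[OF c q] f[OF c] frame_self[OF c q] q c by (metis mem_bundle_chart)
qed

text \<open>The second derivative of the coordinate change of the bundle cancels against the inhomogeneous term in the
  transformation law. As the lift contains \<open>\<Gamma>(y, a)\<close> whereas the second derivative arises from
  differentiating along \<open>a\<close>, the law is applied to \<open>\<Gamma>(a, y)\<close>, using symmetry.\<close>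

lemma frame_other_chart:
  assumes c: "c \<in> M" "c' \<in> M" and q: "q \<in> fst (bundle_chart c)" "fst q \<in> fst c'"
  defines "d \<equiv> frechet_derivative (transition c c') (at (snd c (fst q)))"
  shows "frame c v q (bundle_chart c') = frame_comp c' q (d (fst v), d (snd v))"
proof -
  define p where "p = fst q"
  have p: "p \<in> fst c" "p \<in> fst c'" and y: "snd q \<in> tspace M p"
    using q unfolding p_def mem_bundle_chart by auto
  have q': "q \<in> fst (bundle_chart c')" using q unfolding mem_bundle_chart by auto
  let ?y = "snd q c"
  have y': "snd q c' = d ?y" unfolding d_def p_def[symmetric] by (rule tspaceD[OF y c p])
  have L: "linear d" unfolding d_def p_def[symmetric] by (rule linear_transition_derivative[OF c p])
  have "frame c v q (bundle_chart c') =
      frechet_derivative (transition (bundle_chart c) (bundle_chart c')) (at (snd c p, ?y)) (frame_comp c q v)"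
    unfolding frame_def coord_field_def using q q' c bundle_chart_in by (simp add: bundle_chart_apply p_def)
  also have "\<dots> = (d (fst v), frechet_derivative (\<lambda>x. frechet_derivative (transition c c') (at x) ?y) (at (snd c p)) (fst v)
      + d (snd v - \<Gamma> c p ?y (fst v)))"
    unfolding frame_comp_def p_def[symmetric] transition_bundle_chart_derivative[OF c p] d_def ..
  also have "\<dots> = (d (fst v), d (snd v) - \<Gamma> c' p (d (fst v)) (d ?y))"
    unfolding christoffel_transformation[OF c p, folded d_def[folded p_def]] linear_diff[OF L]
      christoffel_sym[OF c(1) p(1), of ?y] by simp
  also have "\<dots> = frame_comp c' q (d (fst v), d (snd v))"
    unfolding frame_comp_def y' p_def[symmetric] christoffel_sym[OF c(2) p(2), of "d ?y"] by simp
  finally show ?thesis .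
qed

lemma hlift_eq_frame:
  assumes c: "c \<in> M" and q: "q \<in> fst (bundle_chart c)" and w: "w \<in> tspace M (fst q)"
  shows "hlift M D q w = frame c (w c, 0) q"
  unfolding hlift_def
proof (rule the_prescribed_vector[OF c q])
  fix c' assume c': "c' \<in> M" "fst q \<in> fst c'"
  have p: "fst q \<in> fst c" using q by (simp add: mem_bundle_chart)
  show "frame c (w c, 0) q (bundle_chart c') = (w c', - \<Gamma> c' (fst q) (snd q c') (w c'))"
    unfolding frame_other_chart[OF c c'(1) q c'(2)] tspaceD[OF w c c'(1) p c'(2)]
    using linear_0[OF linear_transition_derivative[OF c c'(1) p c'(2)]] by (simp add: frame_comp_def)
qed

lemma vlift_eq_frame:
  assumes c: "c \<in> M" and q: "q \<in> fst (bundle_chart c)" and w: "w \<in> tspace M (fst q)"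
  shows "vlift M q w = frame c (0, w c) q"
  unfolding vlift_def
proof (rule the_prescribed_vector[OF c q])
  fix c' assume c': "c' \<in> M" "fst q \<in> fst c'"
  have p: "fst q \<in> fst c" using q by (simp add: mem_bundle_chart)
  show "frame c (0, w c) q (bundle_chart c') = (0, w c')"
    unfolding frame_other_chart[OF c c'(1) q c'(2)] tspaceD[OF w c c'(1) p c'(2)]
    using linear_0[OF linear_transition_derivative[OF c c'(1) p c'(2)]]
      linear_0[OF christoffel_linear(2)[OF c']] by (simp add: frame_comp_def)
qed

lemma frame_add: "c \<in> M \<Longrightarrow> q \<in> fst (bundle_chart c) \<Longrightarrow> frame c (v + w) q = vadd (frame c v q) (frame c w q)"
  unfolding frame_def using linear_add[OF frame_comp_linear(1)] TM.coord_field_add[OF bundle_chart_in] by metis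

lemma frame_scale: "c \<in> M \<Longrightarrow> q \<in> fst (bundle_chart c) \<Longrightarrow> frame c (r *\<^sub>R v) q = vscale r (frame c v q)"
  unfolding frame_def using linear_cmul[OF frame_comp_linear(1)] TM.coord_field_scale[OF bundle_chart_in] by metis

lemma frame_eq_vzero:
  assumes c: "c \<in> M" and q: "q \<in> fst (bundle_chart c)"
  shows "frame c 0 q = vzero"
  using frame_scale[OF c q, of 0 0] by (simp add: vscale_def vzero_def)

lemma frame_diff: "c \<in> M \<Longrightarrow> q \<in> fst (bundle_chart c) \<Longrightarrow> frame c (v - w) q = vsub (frame c v q) (frame c w q)"
  using frame_add[of c q v "(-1) *\<^sub>R w"] frame_scale[of c q "-1" w] by (simp add: vadd_def vsub_def vscale_def)

lemma lift_sum_eq_frame: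
  assumes c: "c \<in> M" and q: "q \<in> fst (bundle_chart c)" and w: "x \<in> tspace M (fst q)" "y \<in> tspace M (fst q)"
  shows "vadd (hlift M D q x) (vlift M q y) = frame c (x c, y c) q"
  unfolding hlift_eq_frame[OF c q w(1)] vlift_eq_frame[OF c q w(2)] frame_add[OF c q, symmetric] by simp

lemma lift_parts_frame:
  assumes c: "c \<in> M" and q: "q \<in> fst (bundle_chart c)"
  shows "lift_parts M D q (frame c v q) = (coord_field M c (fst v) (fst q), coord_field M c (snd v) (fst q))"
proof -
  have p: "fst q \<in> fst c" using q by (simp add: mem_bundle_chart)
  note cf = coord_field_tspace[OF c p] and cs = coord_field_self[OF c p]
  show ?thesis unfolding lift_parts_def
  proof (rule the_equality)
    show "fst (coord_field M c (fst v) (fst q), coord_field M c (snd v) (fst q)) \<in> tspace M (fst q) \<and>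
      snd (coord_field M c (fst v) (fst q), coord_field M c (snd v) (fst q)) \<in> tspace M (fst q) \<and>
      frame c v q = vadd (hlift M D q (fst (coord_field M c (fst v) (fst q), coord_field M c (snd v) (fst q))))
        (vlift M q (snd (coord_field M c (fst v) (fst q), coord_field M c (snd v) (fst q))))"
      using cf lift_sum_eq_frame[OF c q cf cf] cs by simp
    fix P assume P: "fst P \<in> tspace M (fst q) \<and> snd P \<in> tspace M (fst q) \<and>
      frame c v q = vadd (hlift M D q (fst P)) (vlift M q (snd P))"
    then have "v = (fst P c, snd P c)" using lift_sum_eq_frame[OF c q] frame_inject[OF c q] by metis
    then show "P = (coord_field M c (fst v) (fst q), coord_field M c (snd v) (fst q))"
      using P coord_field_of_component[OF _ c p] by (simp add: prod_eq_iff)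
  qed
qed

lemma J1_lift_frame:
  assumes c: "c \<in> M" and q: "q \<in> fst (bundle_chart c)"
  shows "J1_lift M D q (frame c v q) = frame c (- snd v, fst v) q"
proof -
  have p: "fst q \<in> fst c" using q by (simp add: mem_bundle_chart)
  note cf = coord_field_tspace[OF c p] and cs = coord_field_self[OF c p]
  show ?thesis
    unfolding J1_lift_def lift_parts_frame[OF c q] prod.case hlift_eq_frame[OF c q cf] vlift_eq_frame[OF c q cf]
      frame_diff[OF c q, symmetric] cs by simp
qed

lemma J2_lift_frame:
  assumes J: "smooth_endo M J" and c: "c \<in> M" and q: "q \<in> fst (bundle_chart c)"
  shows "J2_lift M D J q (frame c v q) = frame c (endo_comp M J c (fst q) (snd v), endo_comp M J c (fst q) (fst v)) q"
proof -
  have p: "fst q \<in> fst c" using q by (simp add: mem_bundle_chart)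
  note cf = smooth_endo_tspace[OF J c p coord_field_tspace[OF c p]]
  show ?thesis
    unfolding J2_lift_def lift_parts_frame[OF c q] prod.case hlift_eq_frame[OF c q cf] vlift_eq_frame[OF c q cf]
      frame_add[OF c q, symmetric] by (simp add: endo_comp_def)
qed

lemma J3_lift_frame:
  assumes J: "smooth_endo M J" and c: "c \<in> M" and q: "q \<in> fst (bundle_chart c)"
  shows "J3_lift M D J q (frame c v q) = frame c (- endo_comp M J c (fst q) (fst v), endo_comp M J c (fst q) (snd v)) q"
  unfolding J3_lift_def comp_def J2_lift_frame[OF J c q] J1_lift_frame[OF c q] by simp

end

context base_manifold
begin

lemma open_bundle_image: "c \<in> M \<Longrightarrow> open ((snd c ` fst c) \<times> (UNIV :: 'e set))"
  by (rule open_Times[OF open_image open_UNIV])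

lemma smooth_on_christoffel_fibre:
  assumes c: "c \<in> M"
  shows "smooth_on ((snd c ` fst c) \<times> UNIV) (\<lambda>z. \<Gamma> c (param c (fst z)) (snd z) a)"
proof (rule smooth_on_linear_family[where T = "\<lambda>z y. \<Gamma> c (param c (fst z)) y a" and f = snd,
      OF open_bundle_image[OF c] _ _ smooth_on_snd[OF open_bundle_image[OF c]]])
  show "linear (\<lambda>y. \<Gamma> c (param c (fst z)) y a)" if "z \<in> (snd c ` fst c) \<times> UNIV" for z :: "'e \<times> 'e"
    by (rule christoffel_linear(1)[OF c]) (use that param_chart[OF c] in auto)
  show "smooth_on ((snd c ` fst c) \<times> (UNIV :: 'e set)) (\<lambda>z. \<Gamma> c (param c (fst z)) y a)" for y
    by (rule smooth_on_fst_compose[OF open_image[OF c] christoffel_smooth[OF c]])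
qed

lemma christoffel_fibre_has_derivative:
  assumes c: "c \<in> M" "p \<in> fst c"
  shows "((\<lambda>z. \<Gamma> c (param c (fst z)) (snd z) a) has_derivative
    (\<lambda>w. frechet_derivative (\<lambda>x. \<Gamma> c (param c x) y a) (at (snd c p)) (fst w) + \<Gamma> c p (snd w) a)) (at (snd c p, y))"
proof -
  let ?z = "(snd c p, y)"
  have z: "?z \<in> (snd c ` fst c) \<times> UNIV" using c by auto
  have df: "(fst has_derivative fst) (at ?z)" "(snd has_derivative snd) (at ?z)"
    by (rule has_derivative_fst[OF has_derivative_ident] has_derivative_snd[OF has_derivative_ident])+
  have "((\<lambda>z. \<Gamma> c (param c (fst z)) (snd z) a) has_derivative
    (\<lambda>w. frechet_derivative (\<lambda>x. \<Gamma> c (param c x) (snd ?z) a) (at (snd c p)) (fst w)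
      + \<Gamma> c (param c (fst ?z)) (snd w) a)) (at ?z)"
  proof (rule has_derivative_linear_family[where T = "\<lambda>z y. \<Gamma> c (param c (fst z)) y a", OF open_bundle_image[OF c(1)] z _ _ df(2)])
    show "linear (\<lambda>y. \<Gamma> c (param c (fst z)) y a)" if "z \<in> (snd c ` fst c) \<times> UNIV" for z :: "'e \<times> 'e"
      by (rule christoffel_linear(1)[OF c(1)]) (use that param_chart[OF c(1)] in auto)
    have "snd c p \<in> snd c ` fst c" using c(2) by auto
    then show "((\<lambda>z. \<Gamma> c (param c (fst z)) b a) has_derivative
        (\<lambda>w. frechet_derivative (\<lambda>x. \<Gamma> c (param c x) b a) (at (snd c p)) (fst w))) (at ?z)" for b
      using has_derivative_compose[where g = "\<lambda>x. \<Gamma> c (param c x) b a", OF df(1)]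
        smooth_on_has_derivative[OF christoffel_smooth[OF c(1)]] by simp
  qed
  then show ?thesis by (simp add: param_chart[OF c])
qed

lemma param_bundle_image:
  assumes c: "c \<in> M" and z: "z \<in> (snd c ` fst c) \<times> UNIV"
  shows "fst (param (bundle_chart c) z) = param c (fst z)" "snd (param (bundle_chart c) z) c = snd z"
    "param (bundle_chart c) z \<in> fst (bundle_chart c)"
proof -
  have x: "fst z \<in> snd c ` fst c" using z by auto
  then have p: "param c (fst z) \<in> fst c" using param_chart[OF c] by auto
  have e: "param (bundle_chart c) z = (param c (fst z), coord_field M c (snd z) (param c (fst z)))"
    using param_bundle_chart[OF c x, of "snd z"] by simp
  show "fst (param (bundle_chart c) z) = param c (fst z)" "snd (param (bundle_chart c) z) c = snd z"
    "param (bundle_chart c) z \<in> fst (bundle_chart c)"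
    unfolding e mem_bundle_chart using p c coord_field_tspace coord_field_self by auto
qed

lemma frame_comp_param:
  assumes "c \<in> M" "z \<in> (snd c ` fst c) \<times> UNIV"
  shows "frame_comp c (param (bundle_chart c) z) v = (fst v, snd v - \<Gamma> c (param c (fst z)) (snd z) (fst v))"
    and "frame_coeff c (param (bundle_chart c) z) v = (fst v, snd v + \<Gamma> c (param c (fst z)) (snd z) (fst v))"
  by (simp_all add: frame_comp_def frame_coeff_def param_bundle_image[OF assms])

lemma frame_comp_smooth:
  assumes c: "c \<in> M"
  shows "smooth_on ((snd c ` fst c) \<times> UNIV) (\<lambda>z. frame_comp c (param (bundle_chart c) z) v)"
    and "smooth_on ((snd c ` fst c) \<times> UNIV) (\<lambda>z. frame_coeff c (param (bundle_chart c) z) v)"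
proof -
  note o = open_bundle_image[OF c]
  note s = smooth_on_christoffel_fibre[OF c, of "fst v"]
  have "linear (\<lambda>x::'e. - x)" by (auto intro: linearI)
  note m = smooth_on_linear[OF o this s]
  have "smooth_on ((snd c ` fst c) \<times> UNIV) (\<lambda>z. (fst v, snd v + - \<Gamma> c (param c (fst z)) (snd z) (fst v)))"
    "smooth_on ((snd c ` fst c) \<times> UNIV) (\<lambda>z. (fst v, snd v + \<Gamma> c (param c (fst z)) (snd z) (fst v)))"
    by (intro smooth_on_Pair[OF o] smooth_on_add[OF o] smooth_on_const s m)+
  note p = this
  show "smooth_on ((snd c ` fst c) \<times> UNIV) (\<lambda>z. frame_comp c (param (bundle_chart c) z) v)"
    by (rule smooth_on_cong[OF o p(1)]) (simp add: frame_comp_param[OF c])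
  show "smooth_on ((snd c ` fst c) \<times> UNIV) (\<lambda>z. frame_coeff c (param (bundle_chart c) z) v)"
    by (rule smooth_on_cong[OF o p(2)]) (simp add: frame_comp_param[OF c])
qed

lemma frame_vfields:
  assumes c: "c \<in> M"
  shows "frame c v \<in> vfields (tangent_bundle M) (fst (bundle_chart c))"
proof (rule TM.vfieldsI_chart[OF TM.openin_chart[OF bundle_chart_in[OF c]] subset_refl bundle_chart_in[OF c]])
  show "frame c v q \<in> tspace (tangent_bundle M) q" if "q \<in> fst (bundle_chart c)" for q
    by (rule frame_tspace[OF c that])
  show "smooth_on (snd (bundle_chart c) ` fst (bundle_chart c)) (\<lambda>z. frame c v (param (bundle_chart c) z) (bundle_chart c))"
    unfolding bundle_chart_full_image[OF c]
    by (rule smooth_on_cong[OF open_bundle_image[OF c] frame_comp_smooth(1)[OF c]])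
      (simp add: frame_self[OF c param_bundle_image(3)[OF c]])
qed

lemma frame_has_derivative:
  assumes c: "c \<in> M" and q: "q \<in> fst (bundle_chart c)"
  shows "((\<lambda>z. frame c v (param (bundle_chart c) z) (bundle_chart c)) has_derivative
    (\<lambda>w. (0, - (frechet_derivative (\<lambda>x. \<Gamma> c (param c x) (snd q c) (fst v)) (at (snd c (fst q))) (fst w)
      + \<Gamma> c (fst q) (snd w) (fst v))))) (at (snd (bundle_chart c) q))"
proof (rule has_derivative_transform_within_open[OF _ open_bundle_image[OF c]])
  have p: "fst q \<in> fst c" using q by (simp add: mem_bundle_chart)
  have "((\<lambda>z. (fst v, snd v - \<Gamma> c (param c (fst z)) (snd z) (fst v))) has_derivative
    (\<lambda>w. (0, 0 - (frechet_derivative (\<lambda>x. \<Gamma> c (param c x) (snd q c) (fst v)) (at (snd c (fst q))) (fst w)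
      + \<Gamma> c (fst q) (snd w) (fst v))))) (at (snd (bundle_chart c) q))"
    unfolding bundle_chart_apply
    by (intro has_derivative_Pair has_derivative_diff has_derivative_const christoffel_fibre_has_derivative[OF c p])
  then show "((\<lambda>z. (fst v, snd v - \<Gamma> c (param c (fst z)) (snd z) (fst v))) has_derivative
    (\<lambda>w. (0, - (frechet_derivative (\<lambda>x. \<Gamma> c (param c x) (snd q c) (fst v)) (at (snd c (fst q))) (fst w)
      + \<Gamma> c (fst q) (snd w) (fst v))))) (at (snd (bundle_chart c) q))" by simp
  show "snd (bundle_chart c) q \<in> (snd c ` fst c) \<times> UNIV" using bundle_chart_full_image[OF c] q by blast
  show "(fst v, snd v - \<Gamma> c (param c (fst z)) (snd z) (fst v)) = frame c v (param (bundle_chart c) z) (bundle_chart c)"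
    if "z \<in> (snd c ` fst c) \<times> UNIV" for z
    by (simp add: frame_self[OF c param_bundle_image(3)[OF c that]] frame_comp_param[OF c that])
qed

lemma christoffel_derivative_sym:
  assumes c: "c \<in> M"
  shows "p \<in> fst c \<Longrightarrow> frechet_derivative (\<lambda>x. \<Gamma> c (param c x) a b) (at (snd c p))
    = frechet_derivative (\<lambda>x. \<Gamma> c (param c x) b a) (at (snd c p))"
proof -
  assume p: "p \<in> fst c"
  have x: "snd c p \<in> snd c ` fst c" using p by auto
  have "((\<lambda>x. \<Gamma> c (param c x) b a) has_derivative frechet_derivative (\<lambda>x. \<Gamma> c (param c x) a b) (at (snd c p))) (at (snd c p))"
    by (rule has_derivative_transform_within_open[OF
          smooth_on_has_derivative[OF christoffel_smooth[OF c] x] open_image[OF c] x])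
      (use c in \<open>auto simp: param_chart[OF c] intro: christoffel_sym\<close>)
  then show ?thesis by (rule frechet_derivative_at)
qed

text \<open>For coordinate fields \<open>X\<close> and \<open>Y\<close> this comprises \<open>[X\<^sup>H, Y\<^sup>H] = - (R(X, Y)y)\<^sup>V\<close>,
  \<open>[X\<^sup>H, Y\<^sup>V] = (\<nabla>\<^sub>XY)\<^sup>V\<close> and \<open>[X\<^sup>V, Y\<^sup>V] = 0\<close>. The value has no horizontal part, so its
  components in the chart are also its frame coefficients.\<close>

lemma lie_bracket_frame:
  assumes c: "c \<in> M" and q: "q \<in> fst (bundle_chart c)"
  shows "lie_bracket (tangent_bundle M) (frame c v) (frame c w) q (bundle_chart c) =
    (0, \<Gamma> c (fst q) (fst v) (snd w) - \<Gamma> c (fst q) (fst w) (snd v) - curv_comp M D c (fst q) (fst v) (fst w) (snd q c))"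
proof -
  have p: "fst q \<in> fst c" using q by (simp add: mem_bundle_chart)
  note d = frechet_derivative_at[OF frame_has_derivative[OF c q], symmetric]
  note l = linear_diff[OF christoffel_linear(1)[OF c p]]
  note s = christoffel_sym[OF c p]
  let ?y = "snd q c" and ?G = "\<Gamma> c (fst q)"
  have "lie_bracket (tangent_bundle M) (frame c v) (frame c w) q (bundle_chart c) =
    (0, - (frechet_derivative (\<lambda>x. \<Gamma> c (param c x) ?y (fst w)) (at (snd c (fst q))) (fst v)
      + ?G (snd v - ?G ?y (fst v)) (fst w)))
    - (0, - (frechet_derivative (\<lambda>x. \<Gamma> c (param c x) ?y (fst v)) (at (snd c (fst q))) (fst w)
      + ?G (snd w - ?G ?y (fst w)) (fst v)))"
    using bundle_chart_in[OF c] q by (simp add: lie_bracket_def d frame_self[OF c q] frame_comp_def)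
  then show ?thesis
    unfolding curv_comp_def l christoffel_derivative_sym[OF c p, of ?y]
      s[of "snd v" "fst w"] s[of "snd w" "fst v"] s[of "?G (fst v) ?y" "fst w"] s[of "?G (fst w) ?y" "fst v"] s[of ?y]
    by simp
qed

lemma bianchi:
  assumes c: "c \<in> M" "p \<in> fst c"
  shows "curv_comp M D c p a b z + curv_comp M D c p b z a + curv_comp M D c p z a b = 0"
  unfolding curv_comp_def christoffel_derivative_sym[OF c, of z a] christoffel_derivative_sym[OF c, of z b]
    christoffel_derivative_sym[OF c, of b a] christoffel_sym[OF c, of z a] christoffel_sym[OF c, of z b]
    christoffel_sym[OF c, of b a] by simp

text \<open>In a bundle chart, \<open>H\<close> is the composition of three smooth families of linear maps: passing to frame
  coefficients, \<open>K\<close>, and passing back.\<close>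

lemma smooth_endo_from_frame:
  assumes H: "\<And>c q v. c \<in> M \<Longrightarrow> q \<in> fst (bundle_chart c) \<Longrightarrow> H q (frame c v q) = frame c (K c (fst q) v) q"
    and Kl: "\<And>c p. c \<in> M \<Longrightarrow> p \<in> fst c \<Longrightarrow> linear (K c p)"
    and Ks: "\<And>c v. c \<in> M \<Longrightarrow> smooth_on (snd c ` fst c) (\<lambda>x. K c (param c x) v)"
  shows "smooth_endo (tangent_bundle M) H"
proof -
  have val: "H q \<xi> = frame c (K c (fst q) (frame_coeff c q (\<xi> (bundle_chart c)))) q"
    if "c \<in> M" "q \<in> fst (bundle_chart c)" "\<xi> \<in> tspace (tangent_bundle M) q" for c q \<xi>
    using H[OF that(1,2)] frame_of_coeff[OF that] by metis
  have ts: "H q \<xi> \<in> tspace (tangent_bundle M) q"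
    if "c \<in> M" "q \<in> fst (bundle_chart c)" "\<xi> \<in> tspace (tangent_bundle M) q" for c q \<xi>
    using val[OF that] frame_tspace[OF that(1,2)] by simp
  have lin: "H q (vadd (vscale r u) v) = vadd (vscale r (H q u)) (H q v)"
    if c: "c \<in> M" "q \<in> fst (bundle_chart c)" and u: "u \<in> tspace (tangent_bundle M) q" and v: "v \<in> tspace (tangent_bundle M) q"
    for c q u v r
  proof -
    have p: "fst q \<in> fst c" using c by (simp add: mem_bundle_chart)
    obtain a b where ab: "u = frame c a q" "v = frame c b q"
      using frame_of_coeff[OF c u] frame_of_coeff[OF c v] by metis
    show ?thesis
      unfolding ab frame_scale[OF c, symmetric] frame_add[OF c, symmetric] H[OF c]
        linear_add[OF Kl[OF c(1) p]] linear_cmul[OF Kl[OF c(1) p]] ..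
  qed
  have ex: "\<exists>c\<in>M. q \<in> fst (bundle_chart c)" if "q \<in> carrier (tangent_bundle M)" for q
    using that by (auto simp: carrier_def tangent_bundle_def)
  show ?thesis unfolding smooth_endo_def
  proof (intro conjI ballI allI impI)
    fix q u assume "q \<in> carrier (tangent_bundle M)" and u: "u \<in> tspace (tangent_bundle M) q"
    then obtain c where c: "c \<in> M" "q \<in> fst (bundle_chart c)" using ex by blast
    show "H q u \<in> tspace (tangent_bundle M) q" by (rule ts[OF c u])
    show "H q (vadd (vscale r u) v) = vadd (vscale r (H q u)) (H q v)" if "v \<in> tspace (tangent_bundle M) q" for v r
      by (rule lin[OF c u that])
  next
    fix U X assume "openin (mtop (tangent_bundle M)) U \<and> X \<in> vfields (tangent_bundle M) U"
    then have U: "openin (mtop (tangent_bundle M)) U" and X: "X \<in> vfields (tangent_bundle M) U" by auto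
    show "(\<lambda>q. H q (X q)) \<in> vfields (tangent_bundle M) U"
    proof (rule TM.vfieldsI)
      fix q assume q: "q \<in> U"
      obtain c' where "c' \<in> tangent_bundle M" "q \<in> fst c'" using TM.openin_carrier[OF U q] .
      then obtain c where "c \<in> M" "q \<in> fst (bundle_chart c)" by (auto simp: tangent_bundle_def)
      then show "H q (X q) \<in> tspace (tangent_bundle M) q" by (rule ts[OF _ _ TM.vfieldsD[OF X q]])
    next
      fix c' assume "c' \<in> tangent_bundle M"
      then obtain c where c: "c \<in> M" "c' = bundle_chart c" by (auto simp: tangent_bundle_def)
      let ?S = "snd (bundle_chart c) ` (U \<inter> fst (bundle_chart c))" and ?p = "param (bundle_chart c)"
      have o: "open ?S" by (rule TM.open_chart_image[OF U bundle_chart_in[OF c(1)]])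
      have S: "?S \<subseteq> (snd c ` fst c) \<times> UNIV" unfolding bundle_chart_full_image[OF c(1), symmetric] by auto
      note pS = param_bundle_image[OF c(1) subsetD[OF S]]
      have in_c: "fst (?p z) \<in> fst c" if "z \<in> ?S" for z using pS(3)[OF that] by (simp add: mem_bundle_chart)
      have "smooth_on ?S (\<lambda>z. frame_comp c (?p z) (K c (fst (?p z)) (frame_coeff c (?p z) (X (?p z) (bundle_chart c)))))"
      proof (rule smooth_on_linear_family[where T = "\<lambda>z. frame_comp c (?p z)", OF o])
        show "linear (frame_comp c (?p z))" if "z \<in> ?S" for z by (rule frame_comp_linear[OF c(1) pS(3)[OF that]])
        show "smooth_on ?S (\<lambda>z. frame_comp c (?p z) a)" for a
          by (rule smooth_on_subset[OF frame_comp_smooth(1)[OF c(1)] S])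
        show "smooth_on ?S (\<lambda>z. K c (fst (?p z)) (frame_coeff c (?p z) (X (?p z) (bundle_chart c))))"
        proof (rule smooth_on_linear_family[where T = "\<lambda>z. K c (fst (?p z))", OF o])
          show "linear (K c (fst (?p z)))" if "z \<in> ?S" for z by (rule Kl[OF c(1) in_c[OF that]])
          have "smooth_on ?S (\<lambda>z. K c (param c (fst z)) a)" for a
            by (rule smooth_on_subset[OF smooth_on_fst_compose[OF open_image[OF c(1)] Ks[OF c(1)]] S])
          then show "smooth_on ?S (\<lambda>z. K c (fst (?p z)) a)" for a
            by (rule smooth_on_cong[OF o]) (simp add: pS(1))
          show "smooth_on ?S (\<lambda>z. frame_coeff c (?p z) (X (?p z) (bundle_chart c)))"
          proof (rule smooth_on_linear_family[where T = "\<lambda>z. frame_coeff c (?p z)", OF o])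
            show "linear (frame_coeff c (?p z))" if "z \<in> ?S" for z by (rule frame_comp_linear[OF c(1) pS(3)[OF that]])
            show "smooth_on ?S (\<lambda>z. frame_coeff c (?p z) a)" for a
              by (rule smooth_on_subset[OF frame_comp_smooth(2)[OF c(1)] S])
            show "smooth_on ?S (\<lambda>z. X (?p z) (bundle_chart c))"
              by (rule TM.vfields_smooth[OF X bundle_chart_in[OF c(1)]])
          qed
        qed
      qed
      then show "smooth_on (snd c' ` (U \<inter> fst c')) (\<lambda>z. H (param c' z) (X (param c' z)) c')"
        unfolding c(2)
      proof (rule smooth_on_cong[OF o])
        fix z assume z: "z \<in> ?S"
        have "?p z \<in> U" using TM.param_in[OF z bundle_chart_in[OF c(1)]] by blast
        then show "frame_comp c (?p z) (K c (fst (?p z)) (frame_coeff c (?p z) (X (?p z) (bundle_chart c))))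
          = H (?p z) (X (?p z)) (bundle_chart c)"
          unfolding val[OF c(1) pS(3)[OF z] TM.vfieldsD[OF X]] frame_self[OF c(1) pS(3)[OF z]]
          using val[OF c(1) pS(3)[OF z] TM.vfieldsD[OF X]] frame_self[OF c(1) pS(3)[OF z]] by simp
      qed
    qed
  qed
qed

end

section \<open>The Levi-Civita connection of the Sasaki metric\<close>

locale riemannian_base = base_manifold M D
  for M :: "('a, 'e::euclidean_space) chart set" and D +
  fixes g :: "('a, 'e) bilin"
  assumes pseudo_riemannian: "pseudo_riemannian M g"
    and metric: "openin (mtop M) U \<Longrightarrow> X \<in> vfields M U \<Longrightarrow> Y \<in> vfields M U \<Longrightarrow> Z \<in> vfields M U \<Longrightarrow> p \<in> U \<Longrightarrow>
      vderiv M p (X p) (\<lambda>q. g q (Y q) (Z q)) = g p (D X Y p) (Z p) + g p (Y p) (D X Z p)"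
begin

definition G :: "('a, 'e) chart \<Rightarrow> 'a \<Rightarrow> 'e \<Rightarrow> 'e \<Rightarrow> real" where
  "G c p a b = g p (coord_field M c a p) (coord_field M c b p)"

lemma metric_pointwise:
  assumes "c \<in> M" "p \<in> fst c" "u \<in> tspace M p" "v \<in> tspace M p"
  shows "g p u v = g p v u"
    and "w \<in> tspace M p \<Longrightarrow> g p (vadd (vscale r u) v) w = r * g p u w + g p v w"
    and "(\<And>v. v \<in> tspace M p \<Longrightarrow> g p u v = 0) \<Longrightarrow> u = vzero"
proof -
  note pr = pseudo_riemannian[unfolded pseudo_riemannian_def]
  note s = pr[THEN conjunct1, THEN bspec, OF carrierI[OF assms(1,2)], THEN bspec, OF assms(3), THEN bspec, OF assms(4)]
  show "g p u v = g p v u" by (rule conjunct1[OF s])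
  show "w \<in> tspace M p \<Longrightarrow> g p (vadd (vscale r u) v) w = r * g p u w + g p v w"
    using conjunct2[OF s] by blast
  note n = pr[THEN conjunct2, THEN conjunct1, THEN bspec, OF carrierI[OF assms(1,2)], THEN bspec, OF assms(3)]
  show "u = vzero" if "\<And>v. v \<in> tspace M p \<Longrightarrow> g p u v = 0" using n that by blast
qed

lemma G_apply:
  assumes "c \<in> M" "p \<in> fst c" "u \<in> tspace M p" "v \<in> tspace M p"
  shows "g p u v = G c p (u c) (v c)"
  unfolding G_def coord_field_of_component[OF assms(3,1,2)] coord_field_of_component[OF assms(4,1,2)] ..

lemma G_sym: "c \<in> M \<Longrightarrow> p \<in> fst c \<Longrightarrow> G c p a b = G c p b a"
  unfolding G_def using metric_pointwise(1) coord_field_tspace by blast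

lemma G_linear:
  assumes c: "c \<in> M" "p \<in> fst c"
  shows "linear (\<lambda>a. G c p a b)" "linear (G c p a)"
proof -
  have l: "G c p (r *\<^sub>R u + v) w = r * G c p u w + G c p v w" for r u v w
    unfolding G_def coord_field_add[OF c(1)] coord_field_scale[OF c(1)]
    by (rule metric_pointwise(2)[OF c]) (intro coord_field_tspace c)+
  have z: "G c p 0 w = 0" for w using l[of "-1" 0 0] by simp
  show 1: "linear (\<lambda>a. G c p a b)" for b
    by (rule linearI) (use l[of 1] l[of _ _ 0] z in simp_all)
  have "G c p a = (\<lambda>b. G c p b a)" using G_sym[OF c] by blast
  then show "linear (G c p a)" using 1 by simp
qed

lemma G_nondegenerate:
  assumes c: "c \<in> M" "p \<in> fst c" and z: "\<And>b. G c p a b = 0"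
  shows "a = 0"
proof -
  note cf = coord_field_tspace[OF c]
  have "coord_field M c a p = vzero"
    by (rule metric_pointwise(3)[OF c cf cf]) (use G_apply[OF c cf] coord_field_self[OF c] z in simp)
  then show ?thesis using coord_field_self[OF c, of a] by (simp add: vzero_def)
qed

lemma G_smooth_fun: "c \<in> M \<Longrightarrow> smooth_fun M (fst c) (\<lambda>q. G c q a b)"
  unfolding G_def
  by (rule pseudo_riemannian[unfolded pseudo_riemannian_def, THEN conjunct2, THEN conjunct2, rule_format])
    (simp add: openin_chart coord_field_vfields)

lemma G_has_derivative:
  assumes c: "c \<in> M" "p \<in> fst c"
  shows "((\<lambda>x. G c (param c x) a b) has_derivative (\<lambda>v. G c p (\<Gamma> c p v a) b + G c p a (\<Gamma> c p v b))) (at (snd c p))"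
proof -
  note cf = coord_field_vfields[OF c(1)] and ct = coord_field_tspace[OF c] and o = openin_chart[OF c(1)]
  have s: "smooth_on (snd c ` fst c) (\<lambda>x. G c (param c x) a b)"
    using G_smooth_fun[OF c(1)] c(1) unfolding smooth_fun_def by force
  have "frechet_derivative (\<lambda>x. G c (param c x) a b) (at (snd c p)) v = G c p (\<Gamma> c p v a) b + G c p a (\<Gamma> c p v b)" for v
  proof -
    have "frechet_derivative (\<lambda>x. G c (param c x) a b) (at (snd c p)) v = vderiv M p (coord_field M c v p) (\<lambda>q. G c q a b)"
      unfolding vderiv_chart[OF G_smooth_fun[OF c(1)] c(2) c ct] coord_field_self[OF c] ..
    also have "\<dots> = G c p (\<Gamma> c p v a) b + G c p a (\<Gamma> c p v b)"
      unfolding G_def[abs_def] metric[OF o cf cf cf c(2)]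
      using G_apply[OF c] vfieldsD[OF D_vfields[OF o cf cf] c(2)] ct coord_field_self[OF c]
      unfolding G_def christoffel_def by metis
    finally show ?thesis .
  qed
  then have "frechet_derivative (\<lambda>x. G c (param c x) a b) (at (snd c p)) =
      (\<lambda>v. G c p (\<Gamma> c p v a) b + G c p a (\<Gamma> c p v b))" by (rule ext)
  then show ?thesis using smooth_on_has_derivative[OF s, of "snd c p"] c(2) by simp
qed

lemma sasaki_frame:
  assumes c: "c \<in> M" and q: "q \<in> fst (bundle_chart c)"
  shows "sasaki M D g q (frame c v q) (frame c w q) = G c (fst q) (fst v) (fst w) + G c (fst q) (snd v) (snd w)"
  unfolding sasaki_def lift_parts_frame[OF c q] prod.case G_def ..

end

text \<open>The algebra behind the Koszul formula: a trilinear form skew in its last two arguments is determined by its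
  antisymmetrisation \<open>t\<close> in the first two.\<close>

lemma trilinear_from_skew_parts:
  fixes s :: "'v \<Rightarrow> 'v \<Rightarrow> 'v \<Rightarrow> real"
  assumes skew: "\<And>A B C. s A B C = - s A C B" and t: "\<And>A B C. s A B C - s B A C = t A B C"
  shows "2 * s A B C = t A B C - t B C A + t C A B"
  using skew[of A C B] skew[of B C A] skew[of C B A] t[of A B C] t[of B C A] t[of C A B] by linarith

locale sasaki_connection = riemannian_base M D g
  for M :: "('a, 'e::euclidean_space) chart set" and D g +
  fixes Dh :: "('a \<times> ('a, 'e) tvec, 'e \<times> 'e) conn"
  assumes Dh: "levi_civita (tangent_bundle M) (sasaki M D g) Dh"
begin

sublocale TC: torsion_free_connection "tangent_bundle M" Dh
proof
  show "affine_connection (tangent_bundle M) Dh" using Dh unfolding levi_civita_def by blast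
  show "vsub (Dh X Y p) (Dh Y X p) = lie_bracket (tangent_bundle M) X Y p"
    if "openin (mtop (tangent_bundle M)) U" "X \<in> vfields (tangent_bundle M) U" "Y \<in> vfields (tangent_bundle M) U" "p \<in> U" for U X Y p
    using Dh that unfolding levi_civita_def by blast
qed

text \<open>The connection coefficients of the Levi-Civita connection of the Sasaki metric in the adapted frame.\<close>

definition N :: "('a, 'e) chart \<Rightarrow> 'a \<times> ('a, 'e) tvec \<Rightarrow> 'e \<times> 'e \<Rightarrow> 'e \<times> 'e \<Rightarrow> 'e \<times> 'e" where
  "N c q v w = frame_coeff c q (Dh (frame c v) (frame c w) q (bundle_chart c))"

lemma Dh_frame:
  assumes c: "c \<in> M" and q: "q \<in> fst (bundle_chart c)"
  shows "Dh (frame c v) (frame c w) q = frame c (N c q v w) q"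
  unfolding N_def
  by (rule frame_of_coeff[OF c q TM.vfieldsD[OF TC.D_vfields[OF TM.openin_chart[OF bundle_chart_in[OF c]]
          frame_vfields[OF c] frame_vfields[OF c]] q], symmetric])

lemma N_torsion:
  assumes c: "c \<in> M" and q: "q \<in> fst (bundle_chart c)"
  shows "N c q v w - N c q w v =
    (0, \<Gamma> c (fst q) (fst v) (snd w) - \<Gamma> c (fst q) (fst w) (snd v) - curv_comp M D c (fst q) (fst v) (fst w) (snd q c))"
proof -
  have p: "fst q \<in> fst c" using q by (simp add: mem_bundle_chart)
  have "frame c (N c q v w - N c q w v) q = lie_bracket (tangent_bundle M) (frame c v) (frame c w) q"
    unfolding frame_diff[OF c q] Dh_frame[OF c q, symmetric]
    by (rule TC.torsion_free[OF TM.openin_chart[OF bundle_chart_in[OF c]] frame_vfields[OF c] frame_vfields[OF c] q])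
  from fun_cong[OF this, of "bundle_chart c"]
  have "frame_comp c q (N c q v w - N c q w v) =
    (0, \<Gamma> c (fst q) (fst v) (snd w) - \<Gamma> c (fst q) (fst w) (snd v) - curv_comp M D c (fst q) (fst v) (fst w) (snd q c))"
    unfolding frame_self[OF c q] lie_bracket_frame[OF c q] .
  then show ?thesis
    using linear_0[OF christoffel_linear(2)[OF c p]] by (auto simp: frame_comp_def prod_eq_iff)
qed

text \<open>Along \<open>u\<close> the products of frame fields change only through the base point. As \<open>\<nabla>\<close> is compatible with
  \<open>g\<close>, this change is the one that the coefficients \<open>\<gamma>\<close>, formed from \<open>\<Gamma>\<close> alone, would produce. So
  \<open>N - \<gamma>\<close> is skew.\<close>

lemma N_metric:
  assumes c: "c \<in> M" and q: "q \<in> fst (bundle_chart c)"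
  defines "h v w \<equiv> G c (fst q) (fst v) (fst w) + G c (fst q) (snd v) (snd w)"
    and "\<gamma> v w \<equiv> (\<Gamma> c (fst q) (fst v) (fst w), \<Gamma> c (fst q) (fst v) (snd w))"
  shows "h (\<gamma> u v) w + h v (\<gamma> u w) = h (N c q u v) w + h v (N c q u w)"
proof -
  let ?TM = "tangent_bundle M" and ?c = "bundle_chart c"
  have p: "fst q \<in> fst c" using q by (simp add: mem_bundle_chart)
  note o = TM.openin_chart[OF bundle_chart_in[OF c]] and f = frame_vfields[OF c]
  let ?f = "\<lambda>z. sasaki M D g z (frame c v z) (frame c w z)"
  have z: "snd ?c q \<in> (snd c ` fst c) \<times> UNIV" using bundle_chart_full_image[OF c] q by blast
  have e: "G c (param c (fst z)) (fst v) (fst w) + G c (param c (fst z)) (snd v) (snd w) = ?f (param ?c z)"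
    if "z \<in> (snd c ` fst c) \<times> UNIV" for z
    unfolding sasaki_frame[OF c param_bundle_image(3)[OF c that]] param_bundle_image(1)[OF c that] ..
  have sG: "smooth_on (snd c ` fst c) (\<lambda>x. G c (param c x) a b)" for a b
    using G_smooth_fun[OF c] c unfolding smooth_fun_def by force
  have sf: "smooth_fun ?TM (fst ?c) ?f"
  proof (rule TM.smooth_funI_chart[OF o subset_refl bundle_chart_in[OF c]])
    show "smooth_on (snd ?c ` fst ?c) (\<lambda>z. ?f (param ?c z))"
      unfolding bundle_chart_full_image[OF c]
      by (rule smooth_on_cong[OF open_bundle_image[OF c] smooth_on_add[OF open_bundle_image[OF c]
            smooth_on_fst_compose[OF open_image[OF c] sG] smooth_on_fst_compose[OF open_image[OF c] sG]] e])
  qed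
  have dG: "((\<lambda>z. G c (param c (fst z)) a b) has_derivative
      (\<lambda>t. G c (fst q) (\<Gamma> c (fst q) (fst t) a) b + G c (fst q) a (\<Gamma> c (fst q) (fst t) b))) (at (snd ?c q))" for a b
  proof -
    have "((\<lambda>x. G c (param c x) a b) has_derivative
        (\<lambda>v. G c (fst q) (\<Gamma> c (fst q) v a) b + G c (fst q) a (\<Gamma> c (fst q) v b))) (at (fst (snd ?c q)))"
      using G_has_derivative[OF c p] by (simp add: bundle_chart_apply)
    from has_derivative_compose[OF has_derivative_fst[OF has_derivative_ident] this] show ?thesis .
  qed
  have "((\<lambda>z. ?f (param ?c z)) has_derivative
      (\<lambda>t. (G c (fst q) (\<Gamma> c (fst q) (fst t) (fst v)) (fst w) + G c (fst q) (fst v) (\<Gamma> c (fst q) (fst t) (fst w)))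
       + (G c (fst q) (\<Gamma> c (fst q) (fst t) (snd v)) (snd w) + G c (fst q) (snd v) (\<Gamma> c (fst q) (fst t) (snd w))))) (at (snd ?c q))"
    by (rule has_derivative_transform_within_open[OF has_derivative_add[OF dG dG] open_bundle_image[OF c] z e])
  from frechet_derivative_at[OF this, symmetric]
  have "vderiv ?TM q (frame c u q) ?f = h (\<gamma> u v) w + h v (\<gamma> u w)"
    unfolding TM.vderiv_chart[OF sf q bundle_chart_in[OF c] q frame_tspace[OF c q]] frame_self[OF c q]
    by (simp add: frame_comp_def h_def \<gamma>_def)
  moreover have "vderiv ?TM q (frame c u q) ?f =
      sasaki M D g q (Dh (frame c u) (frame c v) q) (frame c w q) + sasaki M D g q (frame c v q) (Dh (frame c u) (frame c w) q)"
    using Dh o f q unfolding levi_civita_def by blast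
  ultimately show ?thesis unfolding Dh_frame[OF c q] sasaki_frame[OF c q] h_def by simp
qed

text \<open>The difference \<open>N - \<gamma>\<close> is skew by \<open>N_metric\<close>, and by \<open>N_torsion\<close> its antisymmetrisation in the first two
  arguments is the vertical vector \<open>- R(a, b)y\<close>.\<close>

lemma koszul_frame:
  assumes c: "c \<in> M" and q: "q \<in> fst (bundle_chart c)"
  defines "R \<equiv> \<lambda>a b. curv_comp M D c (fst q) a b (snd q c)"
  shows "2 * (G c (fst q) (fst (N c q u v) - \<Gamma> c (fst q) (fst u) (fst v)) (fst w)
      + G c (fst q) (snd (N c q u v) - \<Gamma> c (fst q) (fst u) (snd v)) (snd w))
    = - G c (fst q) (R (fst u) (fst v)) (snd w) + G c (fst q) (R (fst v) (fst w)) (snd u) - G c (fst q) (R (fst w) (fst u)) (snd v)"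
proof -
  have p: "fst q \<in> fst c" using q by (simp add: mem_bundle_chart)
  note Gl = linear_diff[OF G_linear(1)[OF c p]] linear_diff[OF G_linear(2)[OF c p]]
  note sym = G_sym[OF c p]
  define s where "s u v w = G c (fst q) (fst (N c q u v) - \<Gamma> c (fst q) (fst u) (fst v)) (fst w)
      + G c (fst q) (snd (N c q u v) - \<Gamma> c (fst q) (fst u) (snd v)) (snd w)" for u v w
  have "2 * s u v w = - G c (fst q) (R (fst u) (fst v)) (snd w) - (- G c (fst q) (R (fst v) (fst w)) (snd u))
      + (- G c (fst q) (R (fst w) (fst u)) (snd v))"
  proof (rule trilinear_from_skew_parts[where t = "\<lambda>u v w. - G c (fst q) (R (fst u) (fst v)) (snd w)"])
    fix u v w
    show "s u v w = - s u w v"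
      using N_metric[OF c q, of u v w] sym[of "fst v"] sym[of "snd v"] unfolding s_def Gl by simp
    have "N c q u v = N c q v u + (0, \<Gamma> c (fst q) (fst u) (snd v) - \<Gamma> c (fst q) (fst v) (snd u) - R (fst u) (fst v))"
      using N_torsion[OF c q, of u v] unfolding R_def by (simp add: algebra_simps)
    then show "s u v w - s v u w = - G c (fst q) (R (fst u) (fst v)) (snd w)"
      using christoffel_sym[OF c p, of "fst u" "fst v"] unfolding s_def
      by (simp add: Gl linear_add[OF G_linear(1)[OF c p]] linear_neg[OF G_linear(1)[OF c p]])
  qed
  then show ?thesis unfolding s_def by simp
qed

text \<open>The vertical and the horizontal part of the coefficients, obtained by inserting a vertical and a
  horizontal vector for \<open>w\<close> in \<open>koszul_frame\<close>. The classical form of the curvature terms in the horizontal part,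
  \<open>R(y, a')b / 2\<close> and \<open>R(y, b')a / 2\<close>, arises from \<open>N_fst\<close> by the pair symmetry of the curvature.\<close>

lemma N_snd:
  assumes c: "c \<in> M" and q: "q \<in> fst (bundle_chart c)"
  shows "snd (N c q u v) = \<Gamma> c (fst q) (fst u) (snd v) - (1/2) *\<^sub>R curv_comp M D c (fst q) (fst u) (fst v) (snd q c)"
proof -
  have p: "fst q \<in> fst c" using q by (simp add: mem_bundle_chart)
  let ?R = "\<lambda>a b. curv_comp M D c (fst q) a b (snd q c)"
  have R0: "G c (fst q) (?R b 0) a = 0" "G c (fst q) (?R 0 b) a = 0" for a b
    using linear_0[OF G_linear(1)[OF c p]] by (auto simp: curv_comp_zero[OF c p])
  have "G c (fst q) (2 *\<^sub>R (snd (N c q u v) - \<Gamma> c (fst q) (fst u) (snd v)) + ?R (fst u) (fst v)) b = 0" for b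
    using koszul_frame[OF c q, of u v "(0, b)"] R0 linear_0[OF G_linear(2)[OF c p]]
    by (simp add: linear_add[OF G_linear(1)[OF c p]] linear_cmul[OF G_linear(1)[OF c p]])
  from G_nondegenerate[OF c p this]
  have "2 *\<^sub>R snd (N c q u v) = 2 *\<^sub>R (\<Gamma> c (fst q) (fst u) (snd v) - (1/2) *\<^sub>R ?R (fst u) (fst v))"
    by (simp add: algebra_simps)
  then show ?thesis by simp
qed

lemma N_fst:
  assumes c: "c \<in> M" and q: "q \<in> fst (bundle_chart c)"
  shows "2 * G c (fst q) (fst (N c q u v) - \<Gamma> c (fst q) (fst u) (fst v)) w
    = G c (fst q) (curv_comp M D c (fst q) (fst v) w (snd q c)) (snd u)
      - G c (fst q) (curv_comp M D c (fst q) w (fst u) (snd q c)) (snd v)"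
proof -
  have p: "fst q \<in> fst c" using q by (simp add: mem_bundle_chart)
  show ?thesis using koszul_frame[OF c q, of u v "(w, 0)"] linear_0[OF G_linear(2)[OF c p]] by simp
qed

lemma N_fst_horizontal:
  assumes c: "c \<in> M" and q: "q \<in> fst (bundle_chart c)"
  shows "fst (N c q (a, 0) (b, 0)) = \<Gamma> c (fst q) a b"
proof -
  have p: "fst q \<in> fst c" using q by (simp add: mem_bundle_chart)
  have "G c (fst q) (fst (N c q (a, 0) (b, 0)) - \<Gamma> c (fst q) a b) w = 0" for w
    using N_fst[OF c q, of "(a, 0)" "(b, 0)" w] linear_0[OF G_linear(2)[OF c p]] by simp
  from G_nondegenerate[OF c p this] show ?thesis by simp
qed

lemma N_flat:
  assumes c: "c \<in> M" and q: "q \<in> fst (bundle_chart c)"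
    and R: "\<And>a b z. curv_comp M D c (fst q) a b z = 0"
  shows "N c q u v = (\<Gamma> c (fst q) (fst u) (fst v), \<Gamma> c (fst q) (fst u) (snd v))"
proof -
  have p: "fst q \<in> fst c" using q by (simp add: mem_bundle_chart)
  have "G c (fst q) (fst (N c q u v) - \<Gamma> c (fst q) (fst u) (fst v)) w = 0" for w
    using N_fst[OF c q, of u v w] linear_0[OF G_linear(1)[OF c p]] by (simp add: R)
  from G_nondegenerate[OF c p this] show ?thesis using N_snd[OF c q] by (simp add: R prod_eq_iff)
qed

end

section \<open>Endomorphism fields with coefficients constant along the fibres\<close>

text \<open>The common form of \<open>J\<^sub>1\<close>, \<open>J\<^sub>2\<close> and \<open>J\<^sub>3\<close>.\<close>

locale frame_endo = sasaki_connection M D g Dh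
  for M :: "('a, 'e::euclidean_space) chart set" and D g Dh +
  fixes H :: "('a \<times> ('a, 'e) tvec, 'e \<times> 'e) endo" and K :: "('a, 'e) chart \<Rightarrow> 'a \<Rightarrow> 'e \<times> 'e \<Rightarrow> 'e \<times> 'e"
  assumes H_frame: "c \<in> M \<Longrightarrow> q \<in> fst (bundle_chart c) \<Longrightarrow> H q (frame c v q) = frame c (K c (fst q) v) q"
    and K_linear: "c \<in> M \<Longrightarrow> p \<in> fst c \<Longrightarrow> linear (K c p)"
    and K_smooth: "c \<in> M \<Longrightarrow> smooth_on (snd c ` fst c) (\<lambda>x. K c (param c x) v)"
begin

definition dK :: "('a, 'e) chart \<Rightarrow> 'a \<Rightarrow> 'e \<Rightarrow> 'e \<times> 'e \<Rightarrow> 'e \<times> 'e" where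
  "dK c p a v = frechet_derivative (\<lambda>x. K c (param c x) v) (at (snd c p)) a"

lemma H_smooth: "smooth_endo (tangent_bundle M) H"
  by (rule smooth_endo_from_frame[OF H_frame K_linear K_smooth])

text \<open>The field \<open>H\<close> applied to a frame field has frame coefficients \<open>K v\<close> that vary with the base point. Freezing
  them at their value at \<open>q\<close> gives a frame field again and changes the covariant derivative by the derivative of
  the coefficients.\<close>

lemma Dh_H_frame:
  assumes c: "c \<in> M" and q: "q \<in> fst (bundle_chart c)"
  shows "Dh (frame c u) (\<lambda>q. H q (frame c v q)) q = frame c (dK c (fst q) (fst u) v + N c q u (K c (fst q) v)) q"
proof -
  let ?TM = "tangent_bundle M" and ?c = "bundle_chart c" and ?S = "(snd c ` fst c) \<times> (UNIV :: 'e set)"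
  let ?p = "param ?c" and ?k = "K c (fst q) v" and ?z = "snd ?c q"
  have p: "fst q \<in> fst c" using q by (simp add: mem_bundle_chart)
  note cb = bundle_chart_in[OF c]
  note o = TM.openin_chart[OF cb] and f = frame_vfields[OF c]
  note Hf = TM.smooth_endo_vfields[OF H_smooth o f]
  have z: "?z \<in> ?S" using bundle_chart_full_image[OF c] q by blast
  have pz: "?p ?z = q" by (rule TM.param_chart[OF cb q])
  have fd: "((\<lambda>z. frame_comp c (?p z) a) has_derivative
     frechet_derivative (\<lambda>z. frame c a (?p z) ?c) (at ?z)) (at ?z)" for a
    by (rule has_derivative_transform_within_open[OF TM.vfields_has_derivative[OF f cb q q] open_bundle_image[OF c] z])
      (simp add: frame_self[OF c param_bundle_image(3)[OF c]])
  have x: "snd c (fst q) \<in> snd c ` fst c" using p by auto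
  have "((\<lambda>z. K c (param c (fst z)) v) has_derivative (\<lambda>t. dK c (fst q) (fst t) v)) (at ?z)"
    using has_derivative_compose[where f = fst and g = "\<lambda>x. K c (param c x) v" and x = ?z and s = UNIV,
        OF has_derivative_fst[OF has_derivative_ident]] smooth_on_has_derivative[OF K_smooth[OF c] x]
    by (simp add: bundle_chart_apply dK_def)
  then have kd: "((\<lambda>z. K c (fst (?p z)) v) has_derivative (\<lambda>t. dK c (fst q) (fst t) v)) (at ?z)"
    by (rule has_derivative_transform_within_open[OF _ open_bundle_image[OF c] z])
      (simp add: param_bundle_image(1)[OF c])
  have "((\<lambda>z. frame_comp c (?p z) (K c (fst (?p z)) v)) has_derivative
    (\<lambda>t. frechet_derivative (\<lambda>z. frame c (K c (fst (?p ?z)) v) (?p z) ?c) (at ?z) t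
       + frame_comp c (?p ?z) (dK c (fst q) (fst t) v))) (at ?z)"
    by (rule has_derivative_linear_family[where T = "\<lambda>z. frame_comp c (?p z)", OF open_bundle_image[OF c] z
          frame_comp_linear(1)[OF c param_bundle_image(3)[OF c]] fd kd])
  then have "((\<lambda>z. H (?p z) (frame c v (?p z)) ?c) has_derivative
    (\<lambda>t. frechet_derivative (\<lambda>z. frame c ?k (?p z) ?c) (at ?z) t + frame_comp c q (dK c (fst q) (fst t) v))) (at ?z)"
    unfolding pz
    by (rule has_derivative_transform_within_open[OF _ open_bundle_image[OF c] z])
      (simp add: H_frame[OF c param_bundle_image(3)[OF c]] frame_self[OF c param_bundle_image(3)[OF c]])
  from fun_cong[OF frechet_derivative_at[OF this, symmetric], of "frame c u q ?c"]
  have "Dh (frame c u) (\<lambda>q. H q (frame c v q)) q ?c = Dh (frame c u) (frame c ?k) q ?c + frame_comp c q (dK c (fst q) (fst u) v)"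
    unfolding TC.D_local[OF o f Hf q cb q] TC.D_local[OF o f f q cb q] H_frame[OF c q]
    by (simp add: frame_self[OF c q]) (simp add: frame_comp_def)
  also have "\<dots> = frame_comp c q (dK c (fst q) (fst u) v + N c q u ?k)"
    unfolding Dh_frame[OF c q] frame_self[OF c q] linear_add[OF frame_comp_linear(1)[OF c q]] by simp
  finally show ?thesis
    by (rule frame_eqI[OF c q TM.vfieldsD[OF TC.D_vfields[OF o f Hf] q]])
qed

lemma cov_deriv_frame:
  assumes c: "c \<in> M" and q: "q \<in> fst (bundle_chart c)"
  shows "cov_deriv_endo Dh H (frame c u) (frame c v) q =
    frame c (dK c (fst q) (fst u) v + N c q u (K c (fst q) v) - K c (fst q) (N c q u v)) q"
  unfolding cov_deriv_endo_def Dh_H_frame[OF c q] Dh_frame[OF c q] H_frame[OF c q] frame_diff[OF c q] ..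

text \<open>By tensoriality (\<open>cov_deriv_local\<close> in the bundle chart) arbitrary fields may be replaced by the frame
  fields with the same values at the point. Testing with frame fields in the third argument suffices in the other
  direction because \<open>g \<oplus> g\<close> is nondegenerate.\<close>

lemma F_vanishes_iff:
  "F_vanishes (tangent_bundle M) (sasaki M D g) Dh H \<longleftrightarrow>
    (\<forall>c\<in>M. \<forall>q\<in>fst (bundle_chart c). \<forall>u v. dK c (fst q) (fst u) v + N c q u (K c (fst q) v) - K c (fst q) (N c q u v) = 0)"
proof
  assume F: "F_vanishes (tangent_bundle M) (sasaki M D g) Dh H"
  show "\<forall>c\<in>M. \<forall>q\<in>fst (bundle_chart c). \<forall>u v. dK c (fst q) (fst u) v + N c q u (K c (fst q) v) - K c (fst q) (N c q u v) = 0"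
  proof (intro ballI allI)
    fix c q u v assume c: "c \<in> M" and q: "q \<in> fst (bundle_chart c)"
    have p: "fst q \<in> fst c" using q by (simp add: mem_bundle_chart)
    let ?w = "dK c (fst q) (fst u) v + N c q u (K c (fst q) v) - K c (fst q) (N c q u v)"
    have "F_tensor (sasaki M D g) Dh H (frame c u) (frame c v) (frame c e) q = 0" for e
      using F TM.openin_chart[OF bundle_chart_in[OF c]] frame_vfields[OF c] q unfolding F_vanishes_def by blast
    then have z: "G c (fst q) (fst ?w) (fst e) + G c (fst q) (snd ?w) (snd e) = 0" for e
      unfolding F_tensor_def cov_deriv_frame[OF c q] sasaki_frame[OF c q] .
    have "G c (fst q) (fst ?w) a = 0" "G c (fst q) (snd ?w) a = 0" for a
      using z[of "(a, 0)"] z[of "(0, a)"] linear_0[OF G_linear(2)[OF c p]] by simp_all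
    then have "fst ?w = 0" "snd ?w = 0" using G_nondegenerate[OF c p] by blast+
    then show "?w = 0" by (simp add: prod_eq_iff)
  qed
next
  assume z: "\<forall>c\<in>M. \<forall>q\<in>fst (bundle_chart c). \<forall>u v. dK c (fst q) (fst u) v + N c q u (K c (fst q) v) - K c (fst q) (N c q u v) = 0"
  let ?TM = "tangent_bundle M"
  show "F_vanishes ?TM (sasaki M D g) Dh H" unfolding F_vanishes_def
  proof (intro allI impI ballI)
    fix U B C E q
    assume "openin (mtop ?TM) U \<and> B \<in> vfields ?TM U \<and> C \<in> vfields ?TM U \<and> E \<in> vfields ?TM U" and q: "q \<in> U"
    then have U: "openin (mtop ?TM) U" "B \<in> vfields ?TM U" "C \<in> vfields ?TM U" and E: "E \<in> vfields ?TM U" by auto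
    obtain c' where "c' \<in> ?TM" "q \<in> fst c'" using TM.openin_carrier[OF U(1) q] .
    then obtain c where c: "c \<in> M" "q \<in> fst (bundle_chart c)" by (auto simp: tangent_bundle_def)
    note cb = bundle_chart_in[OF c(1)] c(2) and f = frame_vfields[OF c(1)]
    have p: "fst q \<in> fst c" using c(2) by (simp add: mem_bundle_chart)
    obtain u v e where uv: "B q = frame c u q" "C q = frame c v q" "E q = frame c e q"
      using frame_of_coeff[OF c TM.vfieldsD[OF U(2) q]] frame_of_coeff[OF c TM.vfieldsD[OF U(3) q]]
        frame_of_coeff[OF c TM.vfieldsD[OF E q]] by metis
    have "cov_deriv_endo Dh H B C q (bundle_chart c) = cov_deriv_endo Dh H (frame c u) (frame c v) q (bundle_chart c)"
      unfolding TC.cov_deriv_local[OF H_smooth U q cb] uv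
        TC.cov_deriv_local[OF H_smooth TM.openin_chart[OF cb(1)] f f cb(2) cb] ..
    also have "\<dots> = vzero (bundle_chart c)"
    proof -
      have "dK c (fst q) (fst u) v + N c q u (K c (fst q) v) - K c (fst q) (N c q u v) = 0" using z c by blast
      then show ?thesis unfolding cov_deriv_frame[OF c] by (simp only: frame_eq_vzero[OF c])
    qed
    finally have "cov_deriv_endo Dh H B C q = frame c 0 q"
      unfolding frame_eq_vzero[OF c] TM.tspace_eq_vzero_iff[OF TC.cov_deriv_tspace[OF H_smooth U q] cb]
      by (simp add: vzero_def)
    then show "F_tensor (sasaki M D g) Dh H B C E q = 0"
      unfolding F_tensor_def uv using sasaki_frame[OF c] linear_0[OF G_linear(1)[OF c(1) p]] by simp
  qed
qed

end

section \<open>The three structures on the tangent bundle\<close>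

locale sasaki_almost_complex = sasaki_connection M D g Dh
  for M :: "('a, 'e::euclidean_space) chart set" and D g Dh +
  fixes J :: "('a, 'e) endo"
  assumes almost_complex: "almost_complex M J"
begin

abbreviation j :: "('a, 'e) chart \<Rightarrow> 'a \<Rightarrow> 'e \<Rightarrow> 'e" where "j \<equiv> endo_comp M J"
abbreviation dj :: "('a, 'e) chart \<Rightarrow> 'a \<Rightarrow> 'e \<Rightarrow> 'e \<Rightarrow> 'e" where "dj \<equiv> endo_deriv_comp M J"
abbreviation R :: "('a, 'e) chart \<Rightarrow> 'a \<Rightarrow> 'e \<Rightarrow> 'e \<Rightarrow> 'e \<Rightarrow> 'e" where "R \<equiv> curv_comp M D"

lemmas J_smooth = almost_complex_smooth_endo[OF almost_complex]

lemma j_linear: "c \<in> M \<Longrightarrow> p \<in> fst c \<Longrightarrow> linear (j c p)"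
  by (rule endo_comp_linear[OF J_smooth])

lemma j_j:
  assumes c: "c \<in> M" "p \<in> fst c" shows "j c p (j c p a) = - a"
proof -
  note cf = coord_field_tspace[OF c]
  have "J p (J p (coord_field M c a p)) = vscale (-1) (coord_field M c a p)"
    using almost_complex carrierI[OF c] cf unfolding almost_complex_def by blast
  then have "J p (J p (coord_field M c a p)) c = - a" by (simp add: vscale_def coord_field_self[OF c])
  then show ?thesis
    unfolding endo_comp_apply[OF c smooth_endo_tspace[OF J_smooth c cf]] endo_comp_def[symmetric] .
qed

lemma j_has_derivative:
  assumes c: "c \<in> M" "p \<in> fst c"
  shows "((\<lambda>x. j c (param c x) b) has_derivative (\<lambda>a. dj c p a b)) (at (snd c p))"
  unfolding endo_deriv_comp_def
  by (rule smooth_on_has_derivative[OF endo_comp_smooth[OF J_smooth c(1)]]) (use c in auto)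

lemma dj_zero:
  assumes c: "c \<in> M" "p \<in> fst c" shows "dj c p 0 b = 0" "dj c p a 0 = 0"
proof -
  show "dj c p 0 b = 0" using linear_0[OF has_derivative_linear[OF j_has_derivative[OF c]]] .
  have x: "snd c p \<in> snd c ` fst c" using c by auto
  have "((\<lambda>x. j c (param c x) 0) has_derivative (\<lambda>a. 0)) (at (snd c p))"
    by (rule has_derivative_transform_within_open[OF has_derivative_const[of 0] open_image[OF c(1)] x])
      (use c in \<open>auto simp: param_chart[OF c(1)] linear_0[OF j_linear]\<close>)
  from has_derivative_unique[OF j_has_derivative[OF c] this] show "dj c p a 0 = 0" by metis
qed

text \<open>The fibre coordinate can be prescribed, so that an identity for \<open>R(a, b)y\<close> at all points of the bundle is one for
  all vectors \<open>y\<close>.\<close>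

lemma fibre_point:
  assumes c: "c \<in> M" "p \<in> fst c"
  obtains q where "q \<in> fst (bundle_chart c)" "fst q = p" "snd q c = y"
  using that[of "(p, coord_field M c y p)"] coord_field_tspace[OF c] coord_field_self[OF c] c
  by (simp add: mem_bundle_chart)

sublocale F1: frame_endo M D g Dh "J1_lift M D" "\<lambda>c p v. (- snd v, fst v)"
proof (intro frame_endo.intro frame_endo_axioms.intro sasaki_connection_axioms)
  show "J1_lift M D q (frame c v q) = frame c (- snd v, fst v) q" if "c \<in> M" "q \<in> fst (bundle_chart c)" for c q v
    by (rule J1_lift_frame[OF that])
  show "linear (\<lambda>v::'e \<times> 'e. (- snd v, fst v))" by (auto intro!: linearI)
  show "smooth_on (snd c ` fst c) (\<lambda>x. (- snd v, fst v))" for c :: "('a, 'e) chart" and v :: "'e \<times> 'e"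
    by (rule smooth_on_const)
qed

sublocale F2: frame_endo M D g Dh "J2_lift M D J" "\<lambda>c p v. (j c p (snd v), j c p (fst v))"
proof (intro frame_endo.intro frame_endo_axioms.intro sasaki_connection_axioms)
  show "J2_lift M D J q (frame c v q) = frame c (j c (fst q) (snd v), j c (fst q) (fst v)) q"
    if "c \<in> M" "q \<in> fst (bundle_chart c)" for c q v
    by (rule J2_lift_frame[OF J_smooth that])
  show "linear (\<lambda>v. (j c p (snd v), j c p (fst v)))" if "c \<in> M" "p \<in> fst c" for c p
    by (rule linearI) (simp_all add: linear_add[OF j_linear[OF that]] linear_cmul[OF j_linear[OF that]])
  show "smooth_on (snd c ` fst c) (\<lambda>x. (j c (param c x) (snd v), j c (param c x) (fst v)))" if "c \<in> M" for c v
    by (intro smooth_on_Pair open_image[OF that] endo_comp_smooth[OF J_smooth that])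
qed

sublocale F3: frame_endo M D g Dh "J3_lift M D J" "\<lambda>c p v. (- j c p (fst v), j c p (snd v))"
proof (intro frame_endo.intro frame_endo_axioms.intro sasaki_connection_axioms)
  show "J3_lift M D J q (frame c v q) = frame c (- j c (fst q) (fst v), j c (fst q) (snd v)) q"
    if "c \<in> M" "q \<in> fst (bundle_chart c)" for c q v
    by (rule J3_lift_frame[OF J_smooth that])
  show "linear (\<lambda>v. (- j c p (fst v), j c p (snd v)))" if "c \<in> M" "p \<in> fst c" for c p
    by (rule linearI) (simp_all add: linear_add[OF j_linear[OF that]] linear_cmul[OF j_linear[OF that]])
  show "smooth_on (snd c ` fst c) (\<lambda>x. (- j c (param c x) (fst v), j c (param c x) (snd v)))" if "c \<in> M" for c v
  proof (intro smooth_on_Pair open_image[OF that] endo_comp_smooth[OF J_smooth that])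
    have "linear (\<lambda>x::'e. - x)" by (auto intro: linearI)
    from smooth_on_linear[OF open_image[OF that] this endo_comp_smooth[OF J_smooth that]]
    show "smooth_on (snd c ` fst c) (\<lambda>x. - j c (param c x) (fst v))" .
  qed
qed

lemma dK_simps:
  assumes c: "c \<in> M" "p \<in> fst c"
  shows "F1.dK c p a v = 0" "F2.dK c p a v = (dj c p a (snd v), dj c p a (fst v))"
    "F3.dK c p a v = (- dj c p a (fst v), dj c p a (snd v))"
proof -
  show "F1.dK c p a v = 0" by (simp add: F1.dK_def)
  note d = j_has_derivative[OF c]
  show "F2.dK c p a v = (dj c p a (snd v), dj c p a (fst v))"
    unfolding F2.dK_def frechet_derivative_at[OF has_derivative_Pair[OF d d], symmetric] ..
  show "F3.dK c p a v = (- dj c p a (fst v), dj c p a (snd v))"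
    unfolding F3.dK_def frechet_derivative_at[OF has_derivative_Pair[OF has_derivative_minus[OF d] d], symmetric] ..
qed

text \<open>For two vertical fields the vertical coefficient vanishes, while the derivative of a horizontal field along a
  vertical one is purely a curvature term.\<close>

lemma vertical_N:
  assumes c: "c \<in> M" and q: "q \<in> fst (bundle_chart c)"
  shows "2 * G c (fst q) (fst (N c q (0, u) (b, 0))) w = G c (fst q) (R c (fst q) b w (snd q c)) u"
    and "snd (N c q (0, u) (0, v)) = 0"
proof -
  have p: "fst q \<in> fst c" using q by (simp add: mem_bundle_chart)
  show "2 * G c (fst q) (fst (N c q (0, u) (b, 0))) w = G c (fst q) (R c (fst q) b w (snd q c)) u"
    using N_fst[OF c q, of "(0, u)" "(b, 0)" w] linear_0[OF G_linear(2)[OF c p]] by (simp add: christoffel_zero[OF c p])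
  show "snd (N c q (0, u) (0, v)) = 0"
    unfolding N_snd[OF c q] by (simp add: christoffel_zero[OF c p] curv_comp_def)
qed

text \<open>The map \<open>f\<close> is the one that takes the vertical coefficient to the horizontal one in the structure under
  consideration: \<open>b \<mapsto> - b\<close> for \<open>J\<^sub>1\<close> and \<open>J\<close> for \<open>J\<^sub>2\<close>.\<close>

lemma flat_from_vertical:
  assumes "\<And>c p b. c \<in> M \<Longrightarrow> p \<in> fst c \<Longrightarrow> \<exists>b'. f c p b' = b"
    and "\<And>c q u b. c \<in> M \<Longrightarrow> q \<in> fst (bundle_chart c) \<Longrightarrow> fst (N c q (0, u) (f c (fst q) b, 0)) = 0"
  shows "flat M D"
  unfolding flat_iff_curv_comp
proof (intro ballI allI)
  fix c p b w y assume c: "c \<in> M" "p \<in> fst c"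
  obtain b' where b': "f c p b' = b" using assms(1)[OF c] by blast
  obtain q where q: "q \<in> fst (bundle_chart c)" "fst q = p" "snd q c = y" using fibre_point[OF c] .
  have "G c p (R c p b w y) u = 0" for u
    using vertical_N(1)[OF c(1) q(1), of u b w] assms(2)[OF c(1) q(1), of u b'] linear_0[OF G_linear(1)[OF c]]
    by (simp add: q(2,3) b')
  then show "R c p b w y = 0" by (rule G_nondegenerate[OF c])
qed

lemma J1_parallel_iff: "F_vanishes (tangent_bundle M) (sasaki M D g) Dh (J1_lift M D) \<longleftrightarrow> flat M D"
proof
  assume F: "F_vanishes (tangent_bundle M) (sasaki M D g) Dh (J1_lift M D)"
  show "flat M D"
  proof (rule flat_from_vertical[where f = "\<lambda>c p b. - b"])
    show "\<exists>b'. - b' = b" for b :: 'e by (rule exI[of _ "- b"]) simp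
    fix c q u b assume c: "c \<in> M" and q: "q \<in> fst (bundle_chart c)"
    have p: "fst q \<in> fst c" using q by (simp add: mem_bundle_chart)
    have "F1.dK c (fst q) 0 (0, b) + N c q (0, u) (- b, 0) - (- snd (N c q (0, u) (0, b)), fst (N c q (0, u) (0, b))) = 0"
      using F[unfolded F1.F_vanishes_iff, rule_format, OF c q, of "(0, u)" "(0, b)"] by simp
    then show "fst (N c q (0, u) (- b, 0)) = 0"
      unfolding dK_simps[OF c p] vertical_N(2)[OF c q] by (simp add: prod_eq_iff)
  qed
next
  assume f: "flat M D"
  show "F_vanishes (tangent_bundle M) (sasaki M D g) Dh (J1_lift M D)"
    unfolding F1.F_vanishes_iff
  proof (intro ballI allI)
    fix c q u v assume c: "c \<in> M" and q: "q \<in> fst (bundle_chart c)"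
    have p: "fst q \<in> fst c" using q by (simp add: mem_bundle_chart)
    have "N c q u v = (\<Gamma> c (fst q) (fst u) (fst v), \<Gamma> c (fst q) (fst u) (snd v))" for u v
      by (rule N_flat[OF c q]) (use f p c in \<open>auto simp: flat_iff_curv_comp\<close>)
    then show "F1.dK c (fst q) (fst u) v + N c q u (- snd v, fst v) - (- snd (N c q u v), fst (N c q u v)) = 0"
      by (simp add: dK_simps[OF c p] linear_neg[OF christoffel_linear(2)[OF c p]] prod_eq_iff)
  qed
qed

lemma J2_J3_parallel_if_flat_skew_kaehler:
  assumes f: "flat M D" and s: "skew_kaehler_base M J D"
  shows "F_vanishes (tangent_bundle M) (sasaki M D g) Dh (J2_lift M D J)"
    and "F_vanishes (tangent_bundle M) (sasaki M D g) Dh (J3_lift M D J)"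
proof -
  have NG: "N c q u v = (\<Gamma> c (fst q) (fst u) (fst v), \<Gamma> c (fst q) (fst u) (snd v))"
    if "c \<in> M" "q \<in> fst (bundle_chart c)" for c q u v
    by (rule N_flat[OF that]) (use f that in \<open>auto simp: flat_iff_curv_comp mem_bundle_chart\<close>)
  have par: "dj c p a b = j c p (\<Gamma> c p a b) - \<Gamma> c p a (j c p b)" if "c \<in> M" "p \<in> fst c" for c p a b
    using s that unfolding skew_kaehler_base_iff[OF J_smooth] cov_endo_comp_def by (simp add: algebra_simps)
  show "F_vanishes (tangent_bundle M) (sasaki M D g) Dh (J2_lift M D J)"
    unfolding F2.F_vanishes_iff
  proof (intro ballI allI)
    fix c q u v assume c: "c \<in> M" and q: "q \<in> fst (bundle_chart c)"
    have p: "fst q \<in> fst c" using q by (simp add: mem_bundle_chart)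
    show "F2.dK c (fst q) (fst u) v + N c q u (j c (fst q) (snd v), j c (fst q) (fst v))
        - (j c (fst q) (snd (N c q u v)), j c (fst q) (fst (N c q u v))) = 0"
      unfolding NG[OF c q] dK_simps[OF c p] par[OF c p] by (simp add: prod_eq_iff)
  qed
  show "F_vanishes (tangent_bundle M) (sasaki M D g) Dh (J3_lift M D J)"
    unfolding F3.F_vanishes_iff
  proof (intro ballI allI)
    fix c q u v assume c: "c \<in> M" and q: "q \<in> fst (bundle_chart c)"
    have p: "fst q \<in> fst c" using q by (simp add: mem_bundle_chart)
    show "F3.dK c (fst q) (fst u) v + N c q u (- j c (fst q) (fst v), j c (fst q) (snd v))
        - (- j c (fst q) (fst (N c q u v)), j c (fst q) (snd (N c q u v))) = 0"
      unfolding NG[OF c q] dK_simps[OF c p] par[OF c p]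
      by (simp add: prod_eq_iff linear_neg[OF christoffel_linear(2)[OF c p]])
  qed
qed

text \<open>Two vertical arguments give flatness. On a flat base, the equation for two horizontal arguments reduces to
  \<open>\<nabla>J = 0\<close>.\<close>

lemma flat_skew_kaehler_if_J2_parallel:
  assumes F: "F_vanishes (tangent_bundle M) (sasaki M D g) Dh (J2_lift M D J)"
  shows "flat M D \<and> skew_kaehler_base M J D"
proof
  note F = F[unfolded F2.F_vanishes_iff, rule_format]
  show f: "flat M D"
  proof (rule flat_from_vertical[where f = j])
    show "\<exists>b'. j c p b' = b" if "c \<in> M" "p \<in> fst c" for c p b
      using j_j[OF that, of b] linear_neg[OF j_linear[OF that], of "j c p b"] by (intro exI[of _ "- j c p b"]) simp
    fix c q u b assume c: "c \<in> M" and q: "q \<in> fst (bundle_chart c)"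
    have p: "fst q \<in> fst c" using q by (simp add: mem_bundle_chart)
    show "fst (N c q (0, u) (j c (fst q) b, 0)) = 0"
      using F[OF c q, of "(0, u)" "(0, b)"]
      unfolding dK_simps[OF c p] vertical_N(2)[OF c q]
      by (simp add: prod_eq_iff vertical_N(2)[OF c q] linear_0[OF j_linear[OF c p]] dj_zero[OF c p])
  qed
  show "skew_kaehler_base M J D" unfolding skew_kaehler_base_iff[OF J_smooth]
  proof (intro ballI allI)
    fix c p a b assume c: "c \<in> M" "p \<in> fst c"
    obtain q where q: "q \<in> fst (bundle_chart c)" "fst q = p" using fibre_point[OF c] by metis
    have NG: "N c q u v = (\<Gamma> c p (fst u) (fst v), \<Gamma> c p (fst u) (snd v))" for u v
      using N_flat[OF c(1) q(1)] f c by (simp add: q(2) flat_iff_curv_comp)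
    show "cov_endo_comp J c p a b = 0"
      using F[OF c(1) q(1), of "(a, 0)" "(b, 0)"]
      unfolding q(2) dK_simps[OF c] NG cov_endo_comp_def by (simp add: prod_eq_iff)
  qed
qed

text \<open>For \<open>J\<^sub>3\<close> two vertical arguments give nothing, since it preserves the vertical subspaces. Two horizontal
  arguments give \<open>\<nabla>J = 0\<close> in the horizontal part and \<open>R(a, - J b) = J R(a, b)\<close> in the vertical part. Together with
  \<open>R(a, b) J = J R(a, b)\<close> the Bianchi identity for \<open>a, b, - J z\<close> reads
  \<open>- J R(a, b) z + J R(b, z) a + J R(z, a) b = 0\<close>, and by the Bianchi identity for \<open>a, b, z\<close> the last two terms
  add up to \<open>- J R(a, b) z\<close>.\<close>

lemma flat_skew_kaehler_if_J3_parallel: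
  assumes F: "F_vanishes (tangent_bundle M) (sasaki M D g) Dh (J3_lift M D J)"
  shows "flat M D \<and> skew_kaehler_base M J D"
proof
  note F = F[unfolded F3.F_vanishes_iff, rule_format]
  have hor: "cov_endo_comp J c p a b = 0 \<and> R c p a (- j c p b) y = j c p (R c p a b y)"
    if c: "c \<in> M" "p \<in> fst c" for c p a b y
  proof -
    obtain q where q: "q \<in> fst (bundle_chart c)" "fst q = p" "snd q c = y" using fibre_point[OF c] .
    have e: "F3.dK c p a (b, 0) + N c q (a, 0) (- j c p b, 0)
        - (- j c p (fst (N c q (a, 0) (b, 0))), j c p (snd (N c q (a, 0) (b, 0)))) = 0"
      using F[OF c(1) q(1), of "(a, 0)" "(b, 0)"] by (simp add: q(2) linear_0[OF j_linear[OF c]])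
    have s: "snd (N c q (a, 0) (b, 0)) = (- (1/2)) *\<^sub>R R c p a b y" for b
      unfolding N_snd[OF c(1) q(1)] by (simp add: q(2,3) christoffel_zero[OF c])
    have h: "fst (N c q (a, 0) (b, 0)) = \<Gamma> c p a b" for b
      using N_fst_horizontal[OF c(1) q(1)] by (simp add: q(2))
    have "- dj c p a b + \<Gamma> c p a (- j c p b) + j c p (\<Gamma> c p a b) = 0"
      using arg_cong[OF e, of fst] by (simp add: dK_simps[OF c] h)
    then have 1: "cov_endo_comp J c p a b = 0"
      unfolding cov_endo_comp_def linear_neg[OF christoffel_linear(2)[OF c]] by (simp add: algebra_simps)
    have "(- (1/2)) *\<^sub>R R c p a (- j c p b) y - (- (1/2)) *\<^sub>R j c p (R c p a b y) = 0"
      using arg_cong[OF e, of snd] unfolding dK_simps[OF c] s linear_cmul[OF j_linear[OF c], symmetric]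
      by (simp add: s dj_zero[OF c])
    then show ?thesis using 1 by simp
  qed
  show s: "skew_kaehler_base M J D" unfolding skew_kaehler_base_iff[OF J_smooth] using hor by blast
  show "flat M D" unfolding flat_iff_curv_comp
  proof (intro ballI allI)
    fix c p a b z assume c: "c \<in> M" "p \<in> fst c"
    note L = linear_neg[OF j_linear[OF c]] linear_add[OF j_linear[OF c]]
    have skew: "R c p a b z = - R c p b a z" for a b z by (simp add: curv_comp_def)
    note com = curv_comp_commutes_parallel_endo[OF J_smooth s c]
    \<comment> \<open>Oddness in \<open>z\<close> is obtained from \<open>- z = J (J z)\<close>.\<close>
    have neg: "R c p a b (- z) = - R c p a b z" for a b z
      using com[of a b "j c p z"] com[of a b z] by (simp add: j_j[OF c])
    have "R c p a b (- j c p z) = - j c p (R c p a b z)" by (simp add: neg com)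
    moreover have "R c p b (- j c p z) a = j c p (R c p b z a)" using hor[OF c] by blast
    moreover have "R c p (- j c p z) a b = j c p (R c p z a b)"
    proof -
      have "R c p (- j c p z) a b = - j c p (R c p a z b)" using skew[of "- j c p z" a b] hor[OF c] by metis
      also have "\<dots> = j c p (R c p z a b)" using skew[of a z b] by (simp add: L)
      finally show ?thesis .
    qed
    ultimately have "- j c p (R c p a b z) + j c p (R c p b z a) + j c p (R c p z a b) = 0"
      using bianchi[OF c, of a b "- j c p z"] by simp
    moreover have "R c p b z a + R c p z a b = - R c p a b z"
      using bianchi[OF c, of a b z] by (simp add: eq_neg_iff_add_eq_0 add_ac)
    then have "j c p (R c p b z a) + j c p (R c p z a b) = - j c p (R c p a b z)" by (metis L)
    ultimately have "- j c p (R c p a b z) - j c p (R c p a b z) = 0" by (metis add.assoc diff_conv_add_uminus)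
    then have "j c p (R c p a b z) + j c p (R c p a b z) = 0" by (metis diff_conv_add_uminus minus_add_distrib neg_equal_0_iff_equal)
    then have "2 *\<^sub>R j c p (R c p a b z) = 0" by (simp only: scaleR_2)
    then have "j c p (R c p a b z) = 0" by simp
    then show "R c p a b z = 0" using j_j[OF c, of "R c p a b z"] linear_0[OF j_linear[OF c]] by simp
  qed
qed

end

theorem proposition3p13:
  fixes M :: "('a, 'e::euclidean_space) chart set"
    and n :: nat
    and J :: "('a, 'e) endo"
    and g gt :: "('a, 'e) bilin"
    and D :: "('a, 'e) conn"
    and Dh :: "('a \<times> ('a, 'e) tvec, 'e \<times> 'e) conn"
  assumes "almost_skew_hermitian n M J g gt"
    and "levi_civita M g D"
    and "levi_civita (tangent_bundle M) (sasaki M D g) Dh"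
  shows "let TM = tangent_bundle M; gh = sasaki M D g;
           J1 = J1_lift M D; J2 = J2_lift M D J; J3 = J3_lift M D J;
           H = (J1, J2, J3); G = derived_metrics gh H
         in
           (kaehler TM J1 gh Dh \<longleftrightarrow> flat M D) \<and>
           (\<forall>J\<^sub>\<beta>\<in>{J2, J3}. skew_kaehler TM J\<^sub>\<beta> gh Dh \<longleftrightarrow> flat M D \<and> skew_kaehler_base M J D) \<and>
           (pseudo_hyper_kaehler TM H G Dh \<longleftrightarrow> flat M D \<and> skew_kaehler_base M J D)"
proof -
  have sm: "smooth_manifold M" and ac: "almost_complex M J" and pr: "pseudo_riemannian M g"
    using assms(1) unfolding almost_skew_hermitian_def by blast+
  interpret sasaki_almost_complex M D g Dh J
  proof
    show "inj_on (snd c) (fst c)" "open (snd c ` fst c)" if "c \<in> M" for c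
      using sm that unfolding smooth_manifold_def by blast+
    show "open (snd c ` (fst c \<inter> fst c'))" "smooth_on (snd c ` (fst c \<inter> fst c')) (transition c c')"
      if "c \<in> M" "c' \<in> M" for c c'
      using sm that unfolding smooth_manifold_def by blast+
    show "affine_connection M D" using assms(2) unfolding levi_civita_def by blast
    fix U X Y Z p assume U: "openin (mtop M) U" "X \<in> vfields M U" "Y \<in> vfields M U" "p \<in> U"
    show "vsub (D X Y p) (D Y X p) = lie_bracket M X Y p"
      using assms(2) U unfolding levi_civita_def by blast
    show "vderiv M p (X p) (\<lambda>q. g q (Y q) (Z q)) = g p (D X Y p) (Z p) + g p (Y p) (D X Z p)"
      if "Z \<in> vfields M U"
      using assms(2) U that unfolding levi_civita_def by blast
  qed (fact pr assms(3) ac)+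
  note J2 = flat_skew_kaehler_if_J2_parallel and J3 = flat_skew_kaehler_if_J3_parallel
  note J23 = J2_J3_parallel_if_flat_skew_kaehler
  show ?thesis
    unfolding Let_def kaehler_def skew_kaehler_def pseudo_hyper_kaehler_def derived_metrics_def prod.case
    using J1_parallel_iff J2 J3 J23 by blast
qed

end
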